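(* Assume that the group $T$ is unimodular and has a van Hove sequence $(D_n)_{n\in\mathbb N}$. Let $\mathcal P\subseteq\mathcal P_r(M)$ be a non-empty collection of point sets of finite local complexity. Then the following statements are equivalent. (i) $X_{\mathcal P}$ is uniquely ergodic. (ii) $\mathcal P$ has uniform pattern frequencies (with respect to $(D_n)_{n\in\mathbb N}$).
   Context: $M$ is a non-empty locally compact, second-countable Hausdorff space. $T$ is a non-compact metrisable topological group with a left action $T\times M\to M$, $(x,m)\mapsto xm$, which is continuous and proper (the map $T\times M\to M\times M$, $(x,m)\mapsto(xm,m)$ has compact preimages of compact sets). It follows that $T$ is locally compact and second countable. $d$ is a fixed metric on $M$ generating its topology which is $T$-invariant ($d(xm,xm')=d(m,m')$) and proper (metric balls have compact closure). $\mathrm{vol}$ is a fixed left Haar measure on $T$. The number $r\in]0,\infty[$ is fixed. $\mathcal P_r(M)$ is the set of all $P\subseteq M$ such that every open ball of radius $r$ in $M$ contains at most one element of $P$; its elements are called point sets. It carries the vague topology: the weakest topology making $P\mapsto\sum_{p\in P}\varphi(p)$ continuous for every real-valued continuous compactly supported $\varphi$ on $M$. With it $\mathcal P_r(M)$ is compact and metrisable. $T$ acts on it by $xP=\{xp:p\in P\}$. For $\mathcal P\subseteq\mathcal P_r(M)$, $X_{\mathcal P}:=\overline{\{xP:x\in T,P\in\mathcal P\}}\subseteq\mathcal P_r(M)$, a compact space on which $T$ acts continuously. $X_{\mathcal P}$ is uniquely ergodic if it carries exactly one $T$-invariant Borel probability measure. A van Hove sequence is an increasing sequence $(D_n)_{n\in\mathbb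 N}$ of non-empty compact subsets of $T$ with $\bigcup_n\mathrm{int}(D_n)=T$ such that for every compact $K\subseteq T$, $\mathrm{vol}(\partial^KD_n)/\mathrm{vol}(D_n)\to0$, where $\partial^KD_n:=\big((KD_n)\setminus\mathrm{int}(D_n)\big)\cup\big((K\overline{D_n^c})\setminus D_n^c\big)$, $AB=\{ab:a\in A,b\in B\}$, and $D_n^c$ is the complement in $T$. Patterns: a pattern of $P\in\mathcal P_r(M)$ is a finite subset $Q\subseteq P$; a pattern of $\mathcal P$ is a pattern of some $P\in\mathcal P$. A compact $V\subseteq M$ with $Q=P\cap\mathrm{int}(V)$ is called a support of the pattern $Q$ of $P$. Two subsets $V,V'$ of $M$ are equivalent if $xV=V'$ for some $x\in T$. $\mathcal P$ is of finite local complexity if for every compact $V\subseteq M$ there is a finite collection $\mathcal F_{\mathcal P}(V)$ of patterns of $\mathcal P$ such that every pattern of $\mathcal P$ which admits a support equivalent to $V$ is equivalent to some pattern in $\mathcal F_{\mathcal P}(V)$. $\mathcal P$ has uniform pattern frequencies if for every pattern $Q$ of $\mathcal P$ the sequence $$\nu_n^{y,P}(Q):=\frac{\mathrm{card}\big(\{\widetilde Q\subseteq P:\exists x\in D_ny: x\widetilde Q=Q\}\big)}{\mathrm{vol}(D_n)}$$ converges as $n\to\infty$ uniformly in $(y,P)\in T\times\mathcal P$, and its limit is independent of $(y,P)\in T\times\mathcal P$. *)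

theory Defs
  imports "HOL-Probability.Probability" "HOL-Library.Set_Algebras"
begin

text \<open>
  The group \<open>T\<close> is a type of class \<open>topological_group_add\<close>. This is the library's class of
  topological groups; it is written additively but does not assume commutativity. So \<open>x + y\<close> is the
  group product \<open>xy\<close>, \<open>0\<close> is the neutral element, \<open>A + B\<close> is the set \<open>AB\<close>, and the order of the
  summands matters. The space \<open>M\<close> is a type of class \<open>metric_space\<close>, with \<open>dist\<close> as the metric \<open>d\<close>.
\<close>

subsection \<open>Actions and Haar measure\<close>

definition left_action :: "('g::group_add \<Rightarrow> 'm \<Rightarrow> 'm) \<Rightarrow> bool" where
  "left_action act \<longleftrightarrow>
     (\<forall>m. act 0 m = m) \<and> (\<forall>x y m. act (x + y) m = act x (act y m))"

definition continuous_action :: "('g::topological_space \<Rightarrow> 'm::topological_space \<Rightarrow> 'm) \<Rightarrow> bool" where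
  "continuous_action act \<longleftrightarrow> continuous_on UNIV (\<lambda>(x, m). act x m)"

definition proper_action :: "('g::topological_space \<Rightarrow> 'm::topological_space \<Rightarrow> 'm) \<Rightarrow> bool" where
  "proper_action act \<longleftrightarrow> (\<forall>K. compact K \<longrightarrow> compact ((\<lambda>(x, m). (act x m, m)) -` K))"

definition isometric_action :: "('g \<Rightarrow> 'm::metric_space \<Rightarrow> 'm) \<Rightarrow> bool" where
  "isometric_action act \<longleftrightarrow> (\<forall>x m m'. dist (act x m) (act x m') = dist m m')"

text \<open>No regularity is demanded: on a locally compact second-countable group every Borel measure
  that is finite on compact sets is a Radon measure.\<close>

definition left_haar_measure :: "'g::topological_group_add measure \<Rightarrow> bool" where
  "left_haar_measure vol \<longleftrightarrow>
     sets vol = sets borel \<and>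
     emeasure vol UNIV \<noteq> 0 \<and>
     (\<forall>K. compact K \<longrightarrow> emeasure vol K < \<infinity>) \<and>
     (\<forall>x. \<forall>A\<in>sets borel. emeasure vol ((\<lambda>y. x + y) ` A) = emeasure vol A)"

text \<open>Unimodularity, expressed through a left Haar measure \<open>vol\<close> of the group; by uniqueness of Haar
  measure up to scaling it does not depend on the choice of \<open>vol\<close>.\<close>

definition unimodular :: "'g::topological_group_add measure \<Rightarrow> bool" where
  "unimodular vol \<longleftrightarrow>
     (\<forall>x. \<forall>A\<in>sets borel. emeasure vol ((\<lambda>y. y + x) ` A) = emeasure vol A)"

subsection \<open>Van Hove sequences\<close>

definition van_hove_boundary :: "'g::topological_group_add set \<Rightarrow> 'g set \<Rightarrow> 'g set" where
  "van_hove_boundary K D = ((K + D) - interior D) \<union> ((K + closure (- D)) - (- D))"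

definition van_hove_sequence ::
  "'g::topological_group_add measure \<Rightarrow> (nat \<Rightarrow> 'g set) \<Rightarrow> bool" where
  "van_hove_sequence vol D \<longleftrightarrow>
     incseq D \<and>
     (\<forall>n. D n \<noteq> {} \<and> compact (D n)) \<and>
     (\<Union>n. interior (D n)) = UNIV \<and>
     (\<forall>K. compact K \<longrightarrow>
        (\<lambda>n. measure vol (van_hove_boundary K (D n)) / measure vol (D n)) \<longlonglongrightarrow> 0)"

subsection \<open>Point sets and the vague topology\<close>

definition point_sets :: "real \<Rightarrow> 'm::metric_space set set" where
  "point_sets r = {P. \<forall>m. \<exists>\<^sub>\<le>\<^sub>1p. p \<in> P \<inter> ball m r}"

definition test_functions :: "('m::topological_space \<Rightarrow> real) set" where
  "test_functions = {\<phi>. continuous_on UNIV \<phi> \<and> compact (closure {m. \<phi> m \<noteq> 0})}"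

text \<open>Point sets may be infinite, so the sum over \<open>P\<close> is an \<open>infsum\<close> (\<open>sum\<close> over an infinite set
  is \<open>0\<close>). Only finitely many of its terms are nonzero when balls have compact closure. The
  subbasis contains \<open>point_sets r\<close> itself (take \<open>U = UNIV\<close>), which is therefore the
  \<open>topspace\<close>.\<close>

definition vague_topology :: "real \<Rightarrow> 'm::metric_space set topology" where
  "vague_topology r = topology_generated_by
     {{P \<in> point_sets r. (\<Sum>\<^sub>\<infinity>p\<in>P. \<phi> p) \<in> U} | \<phi> U. \<phi> \<in> test_functions \<and> open U}"

definition orbit_closure :: "('g \<Rightarrow> 'm::metric_space \<Rightarrow> 'm) \<Rightarrow> real \<Rightarrow> 'm set set \<Rightarrow> 'm set set" where
  "orbit_closure act r \<P> = vague_topology r closure_of {act x ` P | x P. P \<in> \<P>}"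

definition orbit_closure_borel :: "('g \<Rightarrow> 'm::metric_space \<Rightarrow> 'm) \<Rightarrow> real \<Rightarrow> 'm set set \<Rightarrow> 'm set measure" where
  "orbit_closure_borel act r \<P> =
     sigma (orbit_closure act r \<P>) {U. openin (subtopology (vague_topology r) (orbit_closure act r \<P>)) U}"

definition invariant_borel_prob ::
  "('g \<Rightarrow> 'm::metric_space \<Rightarrow> 'm) \<Rightarrow> real \<Rightarrow> 'm set set \<Rightarrow> 'm set measure \<Rightarrow> bool" where
  "invariant_borel_prob act r \<P> \<mu> \<longleftrightarrow>
     sets \<mu> = sets (orbit_closure_borel act r \<P>) \<and>
     prob_space \<mu> \<and>
     (\<forall>x. \<forall>B\<in>sets \<mu>. emeasure \<mu> ((\<lambda>P. act x ` P) ` B) = emeasure \<mu> B)"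

definition uniquely_ergodic_orbit_closure ::
  "('g \<Rightarrow> 'm::metric_space \<Rightarrow> 'm) \<Rightarrow> real \<Rightarrow> 'm set set \<Rightarrow> bool" where
  "uniquely_ergodic_orbit_closure act r \<P> \<longleftrightarrow> (\<exists>!\<mu>. invariant_borel_prob act r \<P> \<mu>)"

subsection \<open>Patterns\<close>

definition pattern_of :: "'m set \<Rightarrow> 'm set \<Rightarrow> bool" where
  "pattern_of P Q \<longleftrightarrow> finite Q \<and> Q \<subseteq> P"

definition is_support :: "'m::topological_space set \<Rightarrow> 'm set \<Rightarrow> 'm set \<Rightarrow> bool" where
  "is_support P Q V \<longleftrightarrow> compact V \<and> Q = P \<inter> interior V"

definition equivalent_sets :: "('g \<Rightarrow> 'm \<Rightarrow> 'm) \<Rightarrow> 'm set \<Rightarrow> 'm set \<Rightarrow> bool" where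
  "equivalent_sets act V V' \<longleftrightarrow> (\<exists>x. act x ` V = V')"

definition finite_local_complexity ::
  "('g \<Rightarrow> 'm::topological_space \<Rightarrow> 'm) \<Rightarrow> 'm set set \<Rightarrow> bool" where
  "finite_local_complexity act \<P> \<longleftrightarrow>
     (\<forall>V. compact V \<longrightarrow>
       (\<exists>F. finite F \<and> (\<forall>Q'\<in>F. \<exists>P\<in>\<P>. pattern_of P Q') \<and>
         (\<forall>P\<in>\<P>. \<forall>Q. pattern_of P Q \<longrightarrow>
            (\<exists>V'. is_support P Q V' \<and> equivalent_sets act V' V) \<longrightarrow>
            (\<exists>Q'\<in>F. equivalent_sets act Q Q'))))"

definition pattern_frequency ::
  "('g::topological_group_add \<Rightarrow> 'm \<Rightarrow> 'm) \<Rightarrow> 'g measure \<Rightarrow> (nat \<Rightarrow> 'g set) \<Rightarrow>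
   'm set \<Rightarrow> nat \<Rightarrow> 'g \<Rightarrow> 'm set \<Rightarrow> real" where
  "pattern_frequency act vol D Q n y P =
     real (card {Q'. Q' \<subseteq> P \<and> (\<exists>x \<in> (\<lambda>a. a + y) ` D n. act x ` Q' = Q)}) / measure vol (D n)"

definition uniform_pattern_frequencies ::
  "('g::topological_group_add \<Rightarrow> 'm \<Rightarrow> 'm) \<Rightarrow> 'g measure \<Rightarrow> (nat \<Rightarrow> 'g set) \<Rightarrow>
   'm set set \<Rightarrow> bool" where
  "uniform_pattern_frequencies act vol D \<P> \<longleftrightarrow>
     (\<forall>Q. (\<exists>P\<in>\<P>. pattern_of P Q) \<longrightarrow>
       (\<exists>\<nu>::real. uniform_limit (UNIV \<times> \<P>)
          (\<lambda>n (y, P). pattern_frequency act vol D Q n y P) (\<lambda>_. \<nu>) sequentially))"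

end

theory Submission
  imports Defs
begin

text \<open>
  Hitting a small ball around each point of a pattern \<open>Q\<close> is an event in the orbit closure \<open>X\<close>, and finite local
  complexity makes the class of \<open>Q\<close> isolated among local configurations. Hence on orbits the proportion
  of time spent in this event equals, up to a van Hove boundary term, a positive constant times the
  frequency of \<open>Q\<close>; unimodularity makes the constant independent of the copy of \<open>Q\<close>.

  If \<open>X\<close> is uniquely ergodic, any sequence of time averages clusters (Krylov-Bogolyubov) at the unique
  invariant measure, which therefore determines all cluster values of the frequencies.

  Conversely, the Laplace functional \<open>P \<mapsto> exp (- (\<Sum>p\<in>P. \<psi> p))\<close> is a sum over the finite subsets
  of \<open>P\<close> of a function of bounded support, so uniform frequencies make its time averages converge
  uniformly to a constant, which is its integral against every invariant measure. Replacing \<open>\<psi>\<close> by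
  \<open>k * \<psi>\<close> with \<open>k \<rightarrow> \<infinity>\<close> gives the probabilities of avoiding an open set; these events form a
  generator of the Borel sets that is stable under intersection.
\<close>

subsection \<open>Point sets and the vague topology\<close>

lemma compact_closure_of_subset:
  fixes S :: "'a::t2_space set"
  assumes "compact K" "S \<subseteq> K"
  shows "compact (closure S)"
proof -
  have "closure S \<subseteq> K"
    using assms compact_imp_closed by (intro closure_minimal)
  then have "K \<inter> closure S = closure S"
    by blast
  then show ?thesis
    using compact_Int_closed[OF assms(1) closed_closure] by metis
qed

lemma point_sets_iff:
  "P \<in> point_sets r \<longleftrightarrow> (\<forall>m. \<forall>p\<in>P. \<forall>q\<in>P. dist m p < r \<longrightarrow> dist m q < r \<longrightarrow> p = q)"
  unfolding point_sets_def Uniq_def by (auto simp: ball_def)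

lemma point_setsD:
  assumes "P \<in> point_sets r" "p \<in> P" "q \<in> P" "dist m p < r" "dist m q < r"
  shows "p = q"
  using assms by (auto simp: point_sets_iff)

lemma closed_point_set:
  assumes "P \<in> point_sets r" "r > 0"
  shows "closed P"
proof (rule discrete_imp_closed[OF \<open>r > 0\<close>], safe)
  fix x y assume "x \<in> P" "y \<in> P" "dist y x < r"
  then show "y = x"
    using point_setsD[OF assms(1), of y x y] assms(2) by auto
qed

lemma card_point_set_bounded:
  fixes K :: "'m::metric_space set"
  assumes "compact K" "r > 0"
  obtains N where "\<And>P. P \<in> point_sets r \<Longrightarrow> finite (P \<inter> K) \<and> card (P \<inter> K) \<le> N"
proof -
  have "K \<subseteq> (\<Union>c\<in>UNIV. ball c r)"
    using assms(2) by (meson UNIV_I UN_iff centre_in_ball subsetI)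
  then obtain C where C: "finite C" "K \<subseteq> (\<Union>c\<in>C. ball c r)"
    using compactE_image[OF assms(1), of UNIV "\<lambda>c. ball c r"] by auto
  have "finite (P \<inter> K) \<and> card (P \<inter> K) \<le> card C" if P: "P \<in> point_sets r" for P
  proof -
    have "\<forall>p\<in>P \<inter> K. \<exists>c\<in>C. dist c p < r"
      using C(2) by (auto simp: subset_iff)
    then obtain f where f: "\<And>p. p \<in> P \<inter> K \<Longrightarrow> f p \<in> C \<and> dist (f p) p < r"
      by metis
    have "inj_on f (P \<inter> K)"
      by (rule inj_onI) (metis IntD1 P f point_setsD)
    moreover have "f ` (P \<inter> K) \<subseteq> C"
      using f by blast
    ultimately show ?thesis
      using C(1) by (meson card_inj_on_le inj_on_finite)
  qed
  then show thesis
    using that by blast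
qed

lemma finite_point_set_Int_compact:
  "P \<in> point_sets r \<Longrightarrow> r > 0 \<Longrightarrow> compact K \<Longrightarrow> finite (P \<inter> K)"
  using card_point_set_bounded[of K r] by metis

lemma infsum_eq_sum_support:
  fixes \<phi> :: "'m::metric_space \<Rightarrow> real"
  assumes "P \<in> point_sets r" "r > 0" "compact K" "\<And>m. m \<notin> K \<Longrightarrow> \<phi> m = 0"
  shows "(\<Sum>\<^sub>\<infinity>p\<in>P. \<phi> p) = (\<Sum>p\<in>P \<inter> K. \<phi> p)"
proof -
  have "(\<Sum>\<^sub>\<infinity>p\<in>P. \<phi> p) = (\<Sum>\<^sub>\<infinity>p\<in>P \<inter> K. \<phi> p)"
    by (rule infsum_cong_neutral) (use assms(4) in auto)
  then show ?thesis
    using finite_point_set_Int_compact[OF assms(1-3)] by simp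
qed

definition hits :: "real \<Rightarrow> 'm::metric_space set \<Rightarrow> 'm set set" where
  "hits r U = {P \<in> point_sets r. P \<inter> U \<noteq> {}}"

definition misses :: "real \<Rightarrow> 'm::metric_space set \<Rightarrow> 'm set set" where
  "misses r K = {P \<in> point_sets r. P \<inter> K = {}}"

lemma misses_eq: "misses r K = point_sets r - hits r K"
  by (auto simp: misses_def hits_def)

lemma hits_UN: "hits r (\<Union>i\<in>I. U i) = (\<Union>i\<in>I. hits r (U i))"
  by (auto simp: hits_def)

lemma topspace_vague [simp]: "topspace (vague_topology r) = point_sets r"
proof -
  have "(\<lambda>_. 0::real) \<in> test_functions"
    by (simp add: test_functions_def)
  then have "{P \<in> point_sets r. (\<Sum>\<^sub>\<infinity>p\<in>P. (\<lambda>_. 0::real) p) \<in> UNIV} \<in>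
    {{P \<in> point_sets r. (\<Sum>\<^sub>\<infinity>p\<in>P. \<phi> p) \<in> U} | \<phi> U. \<phi> \<in> test_functions \<and> open U}"
    by blast
  then show ?thesis
    unfolding vague_topology_def by auto
qed

lemma openin_vague_test:
  assumes "\<phi> \<in> test_functions" "open U"
  shows "openin (vague_topology r) {P \<in> point_sets r. (\<Sum>\<^sub>\<infinity>p\<in>P. \<phi> p) \<in> U}"
  unfolding vague_topology_def by (rule topology_generated_by_Basis) (use assms in blast)

text \<open>A point set that hits small balls around the points of \<open>P0\<close> in \<open>K\<close> and misses the rest of
  \<open>K\<close> has in \<open>K\<close> only small displacements of the points of \<open>P0\<close>.\<close>

lemma openin_test_of_hits_misses:
  fixes \<tau> :: "'m::metric_space set topology"
  assumes r: "r > 0" and top: "topspace \<tau> = point_sets r"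
    and hit: "\<And>U. open U \<Longrightarrow> openin \<tau> (hits r U)"
    and miss: "\<And>K. compact K \<Longrightarrow> openin \<tau> (misses r K)"
    and \<phi>: "\<phi> \<in> test_functions" and V: "open V"
  shows "openin \<tau> {P \<in> point_sets r. (\<Sum>\<^sub>\<infinity>p\<in>P. \<phi> p) \<in> V}"
proof (subst openin_subopen, safe)
  fix P0 assume P0: "P0 \<in> point_sets r" and "(\<Sum>\<^sub>\<infinity>p\<in>P0. \<phi> p) \<in> V"
  define K where "K = closure {m. \<phi> m \<noteq> 0}"
  have K: "compact K" and cont: "continuous_on UNIV \<phi>"
    using \<phi> by (auto simp: K_def test_functions_def)
  have zero: "\<phi> m = 0" if "m \<notin> K" for m
    using that closure_subset[of "{m. \<phi> m \<noteq> 0}"] unfolding K_def by auto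
  have sum_eq: "(\<Sum>\<^sub>\<infinity>p\<in>P. \<phi> p) = (\<Sum>p\<in>P \<inter> K. \<phi> p)" if "P \<in> point_sets r" for P
    by (rule infsum_eq_sum_support[OF that r K zero])
  define A where "A = P0 \<inter> K"
  have A: "finite A"
    unfolding A_def by (rule finite_point_set_Int_compact[OF P0 r K])
  obtain \<epsilon> where \<epsilon>: "\<epsilon> > 0" "\<And>s. \<bar>s - (\<Sum>p\<in>A. \<phi> p)\<bar> < \<epsilon> \<Longrightarrow> s \<in> V"
  proof -
    have "(\<Sum>p\<in>A. \<phi> p) \<in> V"
      using \<open>(\<Sum>\<^sub>\<infinity>p\<in>P0. \<phi> p) \<in> V\<close> sum_eq[OF P0] by (simp add: A_def)
    then show thesis
      using V that unfolding open_dist dist_real_def by metis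
  qed
  define \<eta> where "\<eta> = \<epsilon> / (real (card A) + 1)"
  have \<eta>: "\<eta> > 0" "real (card A) * \<eta> < \<epsilon>"
    using \<epsilon>(1) by (auto simp: \<eta>_def field_simps)
  have "\<forall>a. \<exists>d>0. \<forall>x. dist x a < d \<longrightarrow> \<bar>\<phi> x - \<phi> a\<bar> < \<eta>"
    using cont \<eta>(1) unfolding continuous_on_iff dist_real_def by blast
  then obtain d where d: "\<And>a. d a > 0" "\<And>a x. dist x a < d a \<Longrightarrow> \<bar>\<phi> x - \<phi> a\<bar> < \<eta>"
    by metis
  define \<delta> where "\<delta> = Min (insert (r/2) (d ` A))"
  have \<delta>: "\<delta> > 0" "\<delta> \<le> r/2" "\<And>a. a \<in> A \<Longrightarrow> \<delta> \<le> d a"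
  proof -
    show "\<delta> > 0"
      using A r d(1) by (simp add: \<delta>_def)
    show "\<delta> \<le> r/2" "\<And>a. a \<in> A \<Longrightarrow> \<delta> \<le> d a"
      unfolding \<delta>_def by (rule Min_le; use A in simp)+
  qed
  define L where "L = K - (\<Union>a\<in>A. ball a \<delta>)"
  have L: "compact L"
    unfolding L_def by (intro compact_diff K) auto
  define W where "W = misses r L \<inter> (\<Inter>a\<in>A. hits r (ball a \<delta>))"
  have "openin \<tau> W"
  proof (cases "A = {}")
    case True
    then show ?thesis
      using miss[OF L] by (simp add: W_def)
  next
    case False
    then show ?thesis
      unfolding W_def using A by (intro openin_Int openin_INT2 miss[OF L] hit) auto
  qed
  moreover have "P0 \<in> W"
    using P0 \<delta>(1) by (auto simp: W_def misses_def hits_def L_def A_def)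
  moreover have "(\<Sum>\<^sub>\<infinity>p\<in>P. \<phi> p) \<in> V" if PW: "P \<in> W" for P
  proof -
    have P: "P \<in> point_sets r"
      using PW by (auto simp: W_def misses_def)
    have "\<forall>a\<in>A. \<exists>p\<in>P. dist a p < \<delta>"
      using PW by (fastforce simp: W_def hits_def)
    then obtain f where f: "\<And>a. a \<in> A \<Longrightarrow> f a \<in> P \<and> dist a (f a) < \<delta>"
      by metis
    have inj: "inj_on f A"
    proof (rule inj_onI)
      fix a b assume ab: "a \<in> A" "b \<in> A" "f a = f b"
      have "dist a b < r"
        using f[OF ab(1)] f[OF ab(2)] ab(3) \<delta>(2) dist_triangle_half_l[of a "f a" r b]
        by (simp add: dist_commute)
      then show "a = b"
        using point_setsD[OF P0, of a b a] ab r by (auto simp: A_def)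
    qed
    have sub: "P \<inter> K \<subseteq> f ` A"
    proof
      fix p assume p: "p \<in> P \<inter> K"
      have "p \<notin> L"
        using PW p by (auto simp: W_def misses_def)
      then obtain a where a: "a \<in> A" "dist a p < \<delta>"
        using p by (auto simp: L_def)
      have "p = f a"
        using point_setsD[OF P, of p "f a" a] p f[OF a(1)] a(2) \<delta>(2) r by auto
      then show "p \<in> f ` A"
        using a by blast
    qed
    have "(\<Sum>p\<in>P \<inter> K. \<phi> p) = (\<Sum>p\<in>f ` A. \<phi> p)"
      by (rule sum.mono_neutral_left) (use A sub f zero in auto)
    also have "\<dots> = (\<Sum>a\<in>A. \<phi> (f a))"
      by (simp add: sum.reindex[OF inj])
    finally have "\<bar>(\<Sum>p\<in>P \<inter> K. \<phi> p) - (\<Sum>p\<in>A. \<phi> p)\<bar> = \<bar>\<Sum>a\<in>A. \<phi> (f a) - \<phi> a\<bar>"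
      by (simp add: sum_subtractf)
    also have "\<dots> \<le> (\<Sum>a\<in>A. \<bar>\<phi> (f a) - \<phi> a\<bar>)"
      by (rule sum_abs)
    also have "\<dots> \<le> (\<Sum>a\<in>A. \<eta>)"
    proof (rule sum_mono)
      fix a assume a: "a \<in> A"
      have "dist (f a) a < d a"
        using f[OF a] \<delta>(3)[OF a] by (simp add: dist_commute)
      then show "\<bar>\<phi> (f a) - \<phi> a\<bar> \<le> \<eta>"
        using d(2) less_imp_le by blast
    qed
    also have "\<dots> < \<epsilon>"
      using \<eta>(2) by simp
    finally show ?thesis
      using \<epsilon>(2) sum_eq[OF P] by simp
  qed
  ultimately show "\<exists>T. openin \<tau> T \<and> P0 \<in> T \<and> T \<subseteq> {P \<in> point_sets r. (\<Sum>\<^sub>\<infinity>p\<in>P. \<phi> p) \<in> V}"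
    by (intro exI[of _ W]) (auto simp: W_def misses_def)
qed

lemma openin_of_openin_vague:
  fixes \<tau> :: "'m::metric_space set topology"
  assumes "r > 0" "topspace \<tau> = point_sets r"
    and "\<And>U. open U \<Longrightarrow> openin \<tau> (hits r U)"
    and "\<And>K. compact K \<Longrightarrow> openin \<tau> (misses r K)"
    and W: "openin (vague_topology r) W"
  shows "openin \<tau> W"
proof -
  let ?S = "{{P \<in> point_sets r. (\<Sum>\<^sub>\<infinity>p\<in>P. \<phi> p) \<in> U} | \<phi> U. \<phi> \<in> test_functions \<and> open (U :: real set)}"
  have "generate_topology_on ?S W"
    using W unfolding vague_topology_def openin_topology_generated_by_iff .
  then show ?thesis
    by (rule generate_topology_on_coarsest[rotated 2])
      (use openin_test_of_hits_misses[OF assms(1-4)] in auto)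
qed

lemma compact_space_Fell:
  fixes T :: "'m::metric_space set topology"
  defines "\<B> \<equiv> (\<lambda>U. {F. F \<inter> U \<noteq> {}}) ` {U. open U} \<union> (\<lambda>K. {F. F \<inter> K = {}}) ` {K. compact K}"
  assumes T: "topology (arbitrary union_of (finite intersection_of (\<lambda>x. x \<in> \<B>) relative_to {F. closed F})) = T"
  shows "compact_space T"
proof (rule Alexander_subbase_alt[OF _ _ T])
  show "{F. closed F} \<subseteq> \<Union> \<B>"
    unfolding \<B>_def by (intro subsetI UnionI[of "{F. F \<inter> {} = {}}"]) auto
next
  fix C assume C: "C \<subseteq> \<B>" "{F. closed F} \<subseteq> \<Union> C"
  define \<U> where "\<U> = {U. open U \<and> {F. F \<inter> U \<noteq> {}} \<in> C}"
  have "closed (- \<Union>\<U>)"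
    by (auto simp: \<U>_def)
  then obtain Z where Z: "Z \<in> C" "- \<Union>\<U> \<in> Z"
    using C(2) by blast
  have "\<not> (\<exists>U. open U \<and> Z = {F. F \<inter> U \<noteq> {}})"
    using Z by (auto simp: \<U>_def)
  then obtain K where K: "compact K" "Z = {F. F \<inter> K = {}}"
    using subsetD[OF C(1) Z(1)] unfolding \<B>_def by auto
  have "K \<subseteq> \<Union>\<U>"
    using Z(2) K(2) by auto
  then obtain \<V> where \<V>: "\<V> \<subseteq> \<U>" "finite \<V>" "K \<subseteq> \<Union>\<V>"
    using compactE[OF K(1), of \<U>] unfolding \<U>_def by blast
  let ?C = "insert Z ((\<lambda>U. {F. F \<inter> U \<noteq> {}}) ` \<V>)"
  have "\<Union> ?C = UNIV"
    using K(2) \<V>(3) by auto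
  moreover have "?C \<subseteq> C" "finite ?C"
    using \<V> Z(1) by (auto simp: \<U>_def)
  ultimately show "\<exists>C'. finite C' \<and> C' \<subseteq> C \<and> {F. closed F} \<subseteq> \<Union> C'"
    by (metis subset_UNIV)
qed

lemma compact_space_vague:
  fixes r :: real
  assumes r: "r > 0"
  shows "compact_space (vague_topology r :: 'm::metric_space set topology)"
proof -
  define \<B> :: "'m set set set"
    where "\<B> = (\<lambda>U. {F. F \<inter> U \<noteq> {}}) ` {U. open U} \<union> (\<lambda>K. {F. F \<inter> K = {}}) ` {K. compact K}"
  define T where "T = topology (arbitrary union_of (finite intersection_of (\<lambda>x. x \<in> \<B>) relative_to {F. closed F}))"
  have cT: "compact_space T"
    by (rule compact_space_Fell) (simp add: T_def \<B>_def)
  have topT: "topspace T = {F. closed F}"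
    unfolding T_def by simp
  have sub: "openin T (B \<inter> {F. closed F})" if "B \<in> \<B>" for B
  proof -
    have "((finite intersection_of (\<lambda>x. x \<in> \<B>)) relative_to {F. closed F}) (B \<inter> {F. closed F})"
      unfolding relative_to_def using that
      by (metis finite_intersection_of_inc inf_commute)
    then show ?thesis
      unfolding T_def openin_subbase by (rule arbitrary_union_of_inc)
  qed
  have PSsub: "point_sets r \<subseteq> topspace T"
    using closed_point_set r unfolding topT by blast
  have clos: "closedin T (point_sets r)"
    unfolding closedin_def
  proof (intro conjI PSsub, subst openin_subopen, safe)
    fix F assume F: "F \<in> topspace T" "F \<notin> point_sets r"
    then obtain m p q where pq: "p \<in> F" "q \<in> F" "dist m p < r" "dist m q < r" "p \<noteq> q"
      by (auto simp: point_sets_iff)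
    obtain A B where AB: "open A" "open B" "p \<in> A" "q \<in> B" "A \<inter> B = {}"
      using hausdorff[OF pq(5)] by blast
    let ?W = "({F. F \<inter> (A \<inter> ball m r) \<noteq> {}} \<inter> {F. closed F}) \<inter> ({F. F \<inter> (B \<inter> ball m r) \<noteq> {}} \<inter> {F. closed F})"
    have "openin T ?W"
      by (intro openin_Int sub) (use AB in \<open>auto simp: \<B>_def\<close>)
    moreover have "F \<in> ?W"
      using F(1) pq AB by (auto simp: topT)
    moreover have "?W \<subseteq> topspace T - point_sets r"
    proof
      fix G assume G: "G \<in> ?W"
      then obtain a b where "a \<in> G" "b \<in> G" "a \<in> A" "b \<in> B" "dist m a < r" "dist m b < r"
        by auto
      moreover from this have "a \<noteq> b"
        using AB(5) by blast
      ultimately have "G \<notin> point_sets r"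
        using point_setsD by blast
      then show "G \<in> topspace T - point_sets r"
        using G by (simp add: topT)
    qed
    ultimately show "\<exists>W. openin T W \<and> F \<in> W \<and> W \<subseteq> topspace T - point_sets r"
      by blast
  qed
  let ?\<tau> = "subtopology T (point_sets r)"
  have "compact_space ?\<tau>"
    using closedin_compact_space[OF cT clos] by (simp add: compact_space_subtopology)
  moreover have top\<tau>: "topspace ?\<tau> = point_sets r"
    using PSsub by auto
  have hit: "openin ?\<tau> (hits r U)" if "open U" for U
  proof -
    have "hits r U = ({F. F \<inter> U \<noteq> {}} \<inter> {F. closed F}) \<inter> point_sets r"
      using PSsub by (auto simp: hits_def topT)
    then show ?thesis
      using openin_subtopology_Int[OF sub[of "{F. F \<inter> U \<noteq> {}}"], of "point_sets r"] that by (simp add: \<B>_def)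
  qed
  have miss: "openin ?\<tau> (misses r K)" if "compact K" for K
  proof -
    have "misses r K = ({F. F \<inter> K = {}} \<inter> {F. closed F}) \<inter> point_sets r"
      using PSsub by (auto simp: misses_def topT)
    then show ?thesis
      using openin_subtopology_Int[OF sub[of "{F. F \<inter> K = {}}"], of "point_sets r"] that by (simp add: \<B>_def)
  qed
  ultimately have c\<tau>: "\<exists>\<F>. finite \<F> \<and> \<F> \<subseteq> \<U> \<and> point_sets r \<subseteq> \<Union>\<F>"
    if "\<forall>U\<in>\<U>. openin ?\<tau> U" "point_sets r \<subseteq> \<Union>\<U>" for \<U>
    using that unfolding compact_space_alt top\<tau> by meson
  show ?thesis
    unfolding compact_space_alt topspace_vague
    by (intro allI impI c\<tau>) (use openin_of_openin_vague[OF r top\<tau> hit miss] in auto)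
qed


lemma compact_of_closed_bounded:
  fixes S :: "'m::metric_space set"
  assumes "\<And>(m::'m) \<rho>. compact (closure (ball m \<rho>))" "closed S" "bounded S"
  shows "compact S"
proof -
  obtain a e where "S \<subseteq> cball a e"
    using assms(3) bounded_subset_cball by blast
  then have "S \<subseteq> closure (ball a (e + 1))"
    using closure_subset[of "ball a (e + 1)"] by (force simp: subset_iff)
  then have "S = closure (ball a (e + 1)) \<inter> S"
    by blast
  then show ?thesis
    using compact_Int_closed[OF assms(1,2)] by metis
qed

lemma hits_compact_eq:
  assumes "compact K" "r > 0"
  shows "hits r K = (\<Inter>n::nat. hits r (\<Union>k\<in>K. ball k (1 / real (Suc n))))"
proof (intro equalityI subsetI)
  fix P assume "P \<in> hits r K"
  then show "P \<in> (\<Inter>n::nat. hits r (\<Union>k\<in>K. ball k (1 / real (Suc n))))"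
    by (fastforce simp: hits_def)
next
  fix P assume P: "P \<in> (\<Inter>n::nat. hits r (\<Union>k\<in>K. ball k (1 / real (Suc n))))"
  then have PS: "P \<in> point_sets r"
    by (auto simp: hits_def)
  show "P \<in> hits r K"
  proof (rule ccontr)
    assume "P \<notin> hits r K"
    then have "K \<subseteq> - P" "open (- P)"
      using PS closed_point_set[OF PS assms(2)] by (auto simp: hits_def)
    then obtain d where d: "d > 0" "(\<Union>k\<in>K. ball k d) \<subseteq> - P"
      using compact_subset_open_imp_ball_epsilon_subset[OF assms(1)] by metis
    obtain n where "1 / real (Suc n) < d"
      using reals_Archimedean[OF d(1)] by (auto simp: inverse_eq_divide)
    moreover have "P \<inter> (\<Union>k\<in>K. ball k (1 / real (Suc n))) \<noteq> {}"
      using P unfolding hits_def by blast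
    then obtain p k where "p \<in> P" "k \<in> K" "dist k p < 1 / real (Suc n)"
      by auto
    ultimately have "p \<in> (\<Union>k\<in>K. ball k d)"
      by (intro UN_I[of k]) auto
    then show False
      using d(2) \<open>p \<in> P\<close> by blast
  qed
qed

definition hits_balls :: "real \<Rightarrow> 'm::metric_space set set set" where
  "hits_balls r = {hits r (ball a t) | a t. True}"

lemma hits_open_in_sigma:
  fixes U :: "'m::{metric_space, second_countable_topology} set"
  assumes "open U"
  shows "hits r U \<in> sigma_sets (point_sets r) (hits_balls r)"
proof -
  let ?F = "{ball a t | a t. ball a t \<subseteq> U}"
  have "\<Union>?F = U"
  proof
    show "U \<subseteq> \<Union>?F"
    proof
      fix x assume "x \<in> U"
      then obtain e where "e > 0" "ball x e \<subseteq> U"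
        using assms open_contains_ball by blast
      then show "x \<in> \<Union>?F"
        by (intro UnionI[of "ball x e"]) auto
    qed
  qed auto
  moreover obtain F where F: "F \<subseteq> ?F" "countable F" "\<Union>F = \<Union>?F"
    using Lindelof[of ?F] by auto
  ultimately have "hits r U = (\<Union>B\<in>F. hits r B)"
    using hits_UN[of r "\<lambda>B. B" F] by simp
  moreover have "hits r B \<in> sigma_sets (point_sets r) (hits_balls r)" if "B \<in> F" for B
  proof -
    obtain a t where "B = ball a t"
      using \<open>B \<in> F\<close> F(1) by blast
    then show ?thesis
      by (auto simp: hits_balls_def intro!: sigma_sets.Basic)
  qed
  moreover have "\<Union>(hits r ` F) \<in> sigma_sets (point_sets r) (hits_balls r)"
    by (rule sigma_sets_UNION) (use F(2) calculation(2) in auto)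
  ultimately show ?thesis
    by simp
qed

lemma misses_compact_in_sigma:
  fixes K :: "'m::{metric_space, second_countable_topology} set"
  assumes "compact K" "r > 0"
  shows "misses r K \<in> sigma_sets (point_sets r) (hits_balls r)"
proof -
  have "hits r K \<in> sigma_sets (point_sets r) (hits_balls r)"
    unfolding hits_compact_eq[OF assms]
  proof (rule sigma_sets_INTER)
    show "hits_balls r \<subseteq> Pow (point_sets r)"
      by (auto simp: hits_balls_def hits_def)
    show "hits r (\<Union>k\<in>K. ball k (1 / real (Suc n))) \<in> sigma_sets (point_sets r) (hits_balls r)" for n
      by (rule hits_open_in_sigma) auto
  qed auto
  then show ?thesis
    unfolding misses_eq by (rule sigma_sets.Compl)
qed

lemma openin_vague_in_sigma:
  fixes W :: "'m::{metric_space, second_countable_topology} set set"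
  assumes r: "r > 0" and proper: "\<And>(m::'m) \<rho>. compact (closure (ball m \<rho>))"
    and W: "openin (vague_topology r) W"
  shows "W \<in> sigma_sets (point_sets r) (hits_balls r)"
proof -
  obtain B0 :: "'m set set" where B0: "countable B0" "topological_basis B0"
    using ex_countable_basis by blast
  define B where "B = {b \<in> B0. bounded b}"
  have B: "countable B" "\<And>b. b \<in> B \<Longrightarrow> open b" "\<And>b. b \<in> B \<Longrightarrow> compact (closure b)"
  proof -
    show "countable B"
      using B0(1) unfolding B_def by simp
    show "open b" if "b \<in> B" for b
      using that topological_basis_open[OF B0(2)] by (simp add: B_def)
    show "compact (closure b)" if "b \<in> B" for b
    proof (rule compact_of_closed_bounded[OF proper closed_closure])
      show "bounded (closure b)"
        using that by (intro bounded_closure) (simp add: B_def)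
    qed
  qed
  have base: "\<exists>b\<in>B. x \<in> b \<and> b \<subseteq> U \<and> closure b \<subseteq> U" if xU: "open U" "x \<in> U" for x U
  proof -
    obtain e where e: "e > 0" "cball x e \<subseteq> U"
      using xU(1)[unfolded open_contains_cball] xU(2) by blast
    have "x \<in> ball x e"
      using e(1) by simp
    then obtain b where b: "b \<in> B0" "x \<in> b" "b \<subseteq> ball x e"
      by (rule topological_basisE[OF B0(2) open_ball])
    have "closure b \<subseteq> cball x e"
      using b(3) ball_subset_cball by (intro closure_minimal closed_cball) (rule order_trans)
    moreover have "bounded b"
      by (rule bounded_subset[OF bounded_ball b(3)])
    ultimately show ?thesis
      using b e(2) closure_subset[of b] unfolding B_def by blast
  qed
  define S where "S = insert (point_sets r) (hits r ` B \<union> (\<lambda>b. misses r (closure b)) ` B)"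
  define \<tau> where "\<tau> = topology_generated_by S"
  have top\<tau>: "topspace \<tau> = point_sets r"
    by (auto simp: \<tau>_def S_def hits_def misses_def)
  have S\<tau>: "openin \<tau> s" if "s \<in> S" for s
    using that unfolding \<tau>_def by (rule topology_generated_by_Basis)
  have hit: "openin \<tau> (hits r U)" if U: "open U" for U
  proof -
    have "U = \<Union>{b \<in> B. b \<subseteq> U}"
      using base[OF U] by blast
    then have "hits r U = (\<Union>b\<in>{b \<in> B. b \<subseteq> U}. hits r b)"
      using hits_UN[of r "\<lambda>b. b" "{b \<in> B. b \<subseteq> U}"] by simp
    also have "openin \<tau> \<dots>"
      by (rule openin_Union) (auto simp: S_def intro: S\<tau>)
    finally show ?thesis .
  qed
  have miss: "openin \<tau> (misses r K)" if K: "compact K" for K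
  proof (subst openin_subopen, safe)
    fix P assume "P \<in> misses r K"
    then have P: "P \<in> point_sets r" "P \<inter> K = {}"
      by (auto simp: misses_def)
    have "open (- P)"
      using closed_point_set[OF P(1) r] by auto
    then have "K \<subseteq> \<Union>{b \<in> B. closure b \<subseteq> - P}"
      using base[of "- P"] P(2) by blast
    then obtain F where F: "F \<subseteq> {b \<in> B. closure b \<subseteq> - P}" "finite F" "K \<subseteq> \<Union>F"
      by (rule compactE[OF K]) (use B(2) in auto)
    define V where "V = \<Inter>(insert (point_sets r) ((\<lambda>b. misses r (closure b)) ` F))"
    have "openin \<tau> V"
      unfolding V_def using F by (intro openin_Inter S\<tau>) (auto simp: S_def)
    moreover have "P \<in> V"
      using P(1) F(1) by (auto simp: V_def misses_def)
    moreover have "V \<subseteq> misses r K"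
    proof
      fix P' assume "P' \<in> V"
      then have P': "P' \<in> point_sets r" "\<And>b. b \<in> F \<Longrightarrow> P' \<inter> closure b = {}"
        by (auto simp: V_def misses_def)
      have "P' \<inter> b = {}" if "b \<in> F" for b
        using P'(2)[OF that] closure_subset[of b] by blast
      then show "P' \<in> misses r K"
        using F(3) P'(1) unfolding misses_def by blast
    qed
    ultimately show "\<exists>T. openin \<tau> T \<and> P \<in> T \<and> T \<subseteq> misses r K"
      by blast
  qed
  have "openin \<tau> W"
    by (rule openin_of_openin_vague[OF r top\<tau> hit miss W])
  then have "generate_topology_on S W"
    unfolding \<tau>_def openin_topology_generated_by_iff .
  then have "(arbitrary union_of finite' intersection_of (\<lambda>x. x \<in> S)) W"
    unfolding generate_topology_on_eq .
  then obtain \<U> where \<U>: "\<And>T. T \<in> \<U> \<Longrightarrow> \<exists>\<F>. finite' \<F> \<and> \<F> \<subseteq> S \<and> \<Inter>\<F> = T" "W = \<Union>\<U>"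
    unfolding union_of_def intersection_of_def by (auto simp: subset_iff)
  have cS: "countable S"
    using B(1) by (simp add: S_def)
  have S\<sigma>: "s \<in> sigma_sets (point_sets r) (hits_balls r)" if "s \<in> S" for s
    using that B(2) hits_open_in_sigma misses_compact_in_sigma[OF B(3) r] sigma_sets_top
    unfolding S_def by auto
  have "countable ((\<lambda>\<F>. \<Inter>\<F>) ` {\<F>. finite \<F> \<and> \<F> \<subseteq> S})"
    by (intro countable_image countable_Collect_finite_subset cS)
  moreover have "\<U> \<subseteq> (\<lambda>\<F>. \<Inter>\<F>) ` {\<F>. finite \<F> \<and> \<F> \<subseteq> S}"
    using \<U>(1) by blast
  ultimately have "countable \<U>"
    using countable_subset by blast
  moreover have "T \<in> sigma_sets (point_sets r) (hits_balls r)" if T: "T \<in> \<U>" for T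
  proof -
    obtain \<F> where F: "finite \<F>" "\<F> \<noteq> {}" "\<F> \<subseteq> S" "\<Inter>\<F> = T"
      using \<U>(1)[OF T] by blast
    interpret sigma_algebra "point_sets r" "sigma_sets (point_sets r) (hits_balls r)"
      by (rule sigma_algebra_sigma_sets) (auto simp: hits_balls_def hits_def)
    have "(\<Inter>s\<in>\<F>. s) \<in> sigma_sets (point_sets r) (hits_balls r)"
      by (rule finite_INT[OF F(1,2)]) (use F(3) S\<sigma> in blast)
    then show ?thesis
      using F(4) by simp
  qed
  ultimately show ?thesis
    unfolding \<U>(2) by (rule sigma_sets_UNION)
qed

lemma bump_test_function:
  assumes proper: "\<And>(m::'m::metric_space) \<rho>. compact (closure (ball m \<rho>))"
  shows "(\<lambda>x::'m. max 0 (e - dist x p)) \<in> test_functions"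
proof -
  let ?S = "{x. max 0 (e - dist x p) \<noteq> 0}"
  have "?S \<subseteq> ball p e"
    by (auto simp: max_def dist_commute)
  then have "bounded ?S"
    using bounded_ball bounded_subset by blast
  then have "compact (closure ?S)"
    by (intro compact_of_closed_bounded[OF proper]) auto
  then show ?thesis
    unfolding test_functions_def by (auto intro!: continuous_intros)
qed

lemma openin_hits_vague:
  fixes U :: "'m::metric_space set"
  assumes r: "r > 0" and proper: "\<And>(m::'m) \<rho>. compact (closure (ball m \<rho>))"
    and "open U"
  shows "openin (vague_topology r) (hits r U)"
proof (subst openin_subopen, safe)
  fix P assume "P \<in> hits r U"
  then obtain p where p: "p \<in> P" "p \<in> U" "P \<in> point_sets r"
    by (auto simp: hits_def)
  obtain e where e: "e > 0" "ball p e \<subseteq> U"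
    using assms p(2) open_contains_ball by blast
  define \<psi> where "\<psi> x = max 0 (e - dist x p)" for x
  have \<psi>: "\<psi> \<in> test_functions"
    unfolding \<psi>_def by (rule bump_test_function[OF proper])
  let ?V = "{P' \<in> point_sets r. (\<Sum>\<^sub>\<infinity>p\<in>P'. \<psi> p) \<in> {0<..}}"
  have "openin (vague_topology r) ?V"
    by (rule openin_vague_test[OF \<psi>]) auto
  moreover have "P \<in> ?V"
  proof -
    have K: "compact (closure (ball p e))"
      by (rule proper)
    have "(\<Sum>\<^sub>\<infinity>p\<in>P. \<psi> p) = (\<Sum>x\<in>P \<inter> closure (ball p e). \<psi> x)"
      by (rule infsum_eq_sum_support[OF p(3) r K])
        (use closure_subset[of "ball p e"] in \<open>force simp: \<psi>_def dist_commute subset_iff\<close>)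
    also have "\<dots> > 0"
    proof (rule sum_pos2[of _ p])
      show "finite (P \<inter> closure (ball p e))"
        by (rule finite_point_set_Int_compact[OF p(3) r K])
      show "p \<in> P \<inter> closure (ball p e)"
        using p e(1) closure_subset[of "ball p e"] by auto
    qed (use e in \<open>auto simp: \<psi>_def\<close>)
    finally show ?thesis
      using p(3) by simp
  qed
  moreover have "?V \<subseteq> hits r U"
  proof
    fix P' assume P': "P' \<in> ?V"
    have "\<exists>x\<in>P'. \<psi> x \<noteq> 0"
    proof (rule ccontr)
      assume "\<not> ?thesis"
      then have "(\<Sum>\<^sub>\<infinity>p\<in>P'. \<psi> p) = 0"
        by (intro infsum_0) auto
      then show False
        using P' by simp
    qed
    then obtain x where "x \<in> P'" "dist x p < e"
      by (auto simp: \<psi>_def max_def split: if_splits)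
    then show "P' \<in> hits r U"
      using P' e(2) by (auto simp: hits_def dist_commute subset_iff)
  qed
  ultimately show "\<exists>T. openin (vague_topology r) T \<and> P \<in> T \<and> T \<subseteq> hits r U"
    by blast
qed

lemma openin_misses_vague:
  fixes K :: "'m::metric_space set"
  assumes r: "r > 0" and proper: "\<And>(m::'m) \<rho>. compact (closure (ball m \<rho>))"
    and "compact K"
  shows "openin (vague_topology r) (misses r K)"
proof (subst openin_subopen, safe)
  fix P assume "P \<in> misses r K"
  then have P: "P \<in> point_sets r" "K \<subseteq> - P" "open (- P)"
    using closed_point_set[OF _ r] by (auto simp: misses_def)
  obtain d where d: "d > 0" "(\<Union>k\<in>K. ball k d) \<subseteq> - P"
    using compact_subset_open_imp_ball_epsilon_subset[OF \<open>compact K\<close> P(3,2)] by metis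
  obtain C where C: "finite C" "C \<subseteq> K" "K \<subseteq> (\<Union>k\<in>C. ball k (d/2))"
    using compactE_image[OF \<open>compact K\<close>, of K "\<lambda>k. ball k (d/2)"] d(1)
    by (metis (no_types, lifting) UN_I centre_in_ball half_gt_zero open_ball subsetI)
  let ?\<psi> = "\<lambda>k x. max 0 (d - dist x k)"
  let ?V = "\<lambda>k. {P' \<in> point_sets r. (\<Sum>\<^sub>\<infinity>p\<in>P'. ?\<psi> k p) \<in> {..<d/2}}"
  let ?W = "\<Inter>(insert (point_sets r) (?V ` C))"
  have "openin (vague_topology r) ?W"
  proof (rule openin_Inter)
    fix X assume "X \<in> insert (point_sets r) (?V ` C)"
    then show "openin (vague_topology r) X"
      using openin_vague_test[OF bump_test_function[OF proper], of "{..<d/2}"]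
        openin_topspace[of "vague_topology r"] by auto
  qed (use C in auto)
  moreover have "P \<in> ?W"
  proof -
    have "(\<Sum>\<^sub>\<infinity>p\<in>P. ?\<psi> k p) = 0" if "k \<in> C" for k
    proof (rule infsum_0)
      fix p assume "p \<in> P"
      then have "p \<notin> ball k d"
        using d(2) that C(2) by blast
      then show "?\<psi> k p = 0"
        by (simp add: dist_commute)
    qed
    then show ?thesis
      using P(1) d(1) by auto
  qed
  moreover have "?W \<subseteq> misses r K"
  proof
    fix P' assume P'W: "P' \<in> ?W"
    then have P': "P' \<in> point_sets r"
      by auto
    have "x \<notin> K" if x: "x \<in> P'" for x
    proof
      assume "x \<in> K"
      then obtain k where k: "k \<in> C" "dist k x < d/2"
        using C(3) by auto
      have K: "compact (closure (ball k d))"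
        by (rule proper)
      have sub: "ball k d \<subseteq> closure (ball k d)"
        by (rule closure_subset)
      have "d/2 < ?\<psi> k x"
        using k(2) dist_commute[of x k] by linarith
      also have "\<dots> \<le> (\<Sum>p\<in>P' \<inter> closure (ball k d). ?\<psi> k p)"
      proof (rule member_le_sum)
        show "x \<in> P' \<inter> closure (ball k d)"
          using x k(2) d(1) sub by (auto simp: subset_iff)
        show "finite (P' \<inter> closure (ball k d))"
          by (rule finite_point_set_Int_compact[OF P' r K])
      qed auto
      also have "\<dots> = (\<Sum>\<^sub>\<infinity>p\<in>P'. ?\<psi> k p)"
        by (rule infsum_eq_sum_support[OF P' r K, symmetric])
          (use sub in \<open>force simp: dist_commute subset_iff\<close>)
      also have "\<dots> < d/2"
        using P'W k(1) by auto
      finally show False .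
    qed
    then show "P' \<in> misses r K"
      using P' by (auto simp: misses_def)
  qed
  ultimately show "\<exists>T. openin (vague_topology r) T \<and> P \<in> T \<and> T \<subseteq> misses r K"
    by blast
qed

subsection \<open>Regular extension of finitely additive set functions\<close>

locale finitely_additive_prob =
  fixes X :: "'a topology" and m :: "'a set \<Rightarrow> real"
  assumes nonneg: "m A \<ge> 0"
    and additive: "A \<in> sigma_sets (topspace X) {U. openin X U} \<Longrightarrow> B \<in> sigma_sets (topspace X) {U. openin X U} \<Longrightarrow>
      A \<inter> B = {} \<Longrightarrow> m (A \<union> B) = m A + m B"
    and total: "m (topspace X) = 1"
begin

abbreviation Bor :: "'a set set" where
  "Bor \<equiv> sigma_sets (topspace X) {U. openin X U}"

sublocale Bor: sigma_algebra "topspace X" Bor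
  by (rule sigma_algebra_sigma_sets) (auto dest: openin_subset)

lemma open_Bor: "openin X U \<Longrightarrow> U \<in> Bor"
  by (rule sigma_sets.Basic) simp

lemma closed_Bor: "closedin X K \<Longrightarrow> K \<in> Bor"
  using sigma_sets.Compl[OF open_Bor, of "topspace X - K"] closedin_subset[of X K]
  by (auto simp: closedin_def double_diff)

lemma m_empty: "m {} = 0"
  using additive[of "{}" "{}"] Bor.empty_sets by simp

lemma m_diff:
  assumes "A \<in> Bor" "B \<in> Bor" "A \<subseteq> B"
  shows "m (B - A) = m B - m A"
  using additive[of A "B - A"] assms Bor.Diff[of B A] by (simp add: Un_absorb1)

lemma m_mono:
  assumes "A \<in> Bor" "B \<in> Bor" "A \<subseteq> B"
  shows "m A \<le> m B"
  using m_diff[OF assms] nonneg[of "B - A"] by simp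

lemma m_subadditive:
  assumes "A \<in> Bor" "B \<in> Bor"
  shows "m (A \<union> B) \<le> m A + m B"
proof -
  have "m (A \<union> B) = m A + m (B - A)"
    using additive[of A "B - A"] assms Bor.Diff[of B A] by simp
  also have "m (B - A) \<le> m B"
    using assms by (intro m_mono) auto
  finally show ?thesis
    by simp
qed

lemma m_UN_le:
  assumes "finite I" "\<And>i. i \<in> I \<Longrightarrow> A i \<in> Bor"
  shows "m (\<Union>i\<in>I. A i) \<le> (\<Sum>i\<in>I. m (A i))"
  using assms
proof (induction I rule: finite_induct)
  case (insert i I)
  have "m (\<Union>i\<in>insert i I. A i) \<le> m (A i) + m (\<Union>i\<in>I. A i)"
    using insert by (auto intro!: m_subadditive Bor.finite_UN)
  then show ?case
    using insert by force
qed (simp add: m_empty)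

definition regular_sets :: "'a set set" where
  "regular_sets = {A \<in> Bor. \<forall>e>0. \<exists>K U. closedin X K \<and> openin X U \<and> K \<subseteq> A \<and> A \<subseteq> U \<and> m (U - K) < e}"

lemma regular_setsE:
  assumes "A \<in> regular_sets" "e > 0"
  obtains K U where "closedin X K" "openin X U" "K \<subseteq> A" "A \<subseteq> U" "m (U - K) < e"
  using assms unfolding regular_sets_def by blast

lemma regular_sets_Bor: "A \<in> regular_sets \<Longrightarrow> A \<in> Bor"
  by (simp add: regular_sets_def)

lemma algebra_regular_sets: "algebra (topspace X) regular_sets"
  unfolding algebra_iff_Un
proof (intro conjI ballI)
  show "regular_sets \<subseteq> Pow (topspace X)"
    using Bor.space_closed regular_sets_Bor by blast
  show "{} \<in> regular_sets"
    unfolding regular_sets_def using Bor.empty_sets m_empty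
    by (auto intro!: exI[of _ "{}"])
next
  fix A assume A: "A \<in> regular_sets"
  show "topspace X - A \<in> regular_sets"
    unfolding regular_sets_def
  proof (safe)
    show "topspace X - A \<in> Bor"
      using A regular_sets_Bor by blast
    fix e :: real assume "e > 0"
    then obtain K U where KU: "closedin X K" "openin X U" "K \<subseteq> A" "A \<subseteq> U" "m (U - K) < e"
      using regular_setsE[OF A] by blast
    have "(topspace X - K) - (topspace X - U) = U - K"
      using openin_subset[OF KU(2)] by blast
    then show "\<exists>K U. closedin X K \<and> openin X U \<and> K \<subseteq> topspace X - A \<and> topspace X - A \<subseteq> U \<and> m (U - K) < e"
      using KU by (intro exI[of _ "topspace X - U"] exI[of _ "topspace X - K"]) auto
  qed
next
  fix A B assume A: "A \<in> regular_sets" and B: "B \<in> regular_sets"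
  show "A \<union> B \<in> regular_sets"
    unfolding regular_sets_def
  proof (safe)
    show "A \<union> B \<in> Bor"
      using A B regular_sets_Bor by blast
    fix e :: real assume "e > 0"
    then have "e / 2 > 0"
      by simp
    obtain K U where KU: "closedin X K" "openin X U" "K \<subseteq> A" "A \<subseteq> U" "m (U - K) < e/2"
      using regular_setsE[OF A \<open>e/2 > 0\<close>] by blast
    obtain L V where LV: "closedin X L" "openin X V" "L \<subseteq> B" "B \<subseteq> V" "m (V - L) < e/2"
      using regular_setsE[OF B \<open>e/2 > 0\<close>] by blast
    have bor: "U \<in> Bor" "V \<in> Bor" "K \<in> Bor" "L \<in> Bor"
      using KU(1,2) LV(1,2) by (auto intro: open_Bor closed_Bor)
    have "m ((U \<union> V) - (K \<union> L)) \<le> m ((U - K) \<union> (V - L))"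
      using bor by (intro m_mono) auto
    also have "\<dots> \<le> m (U - K) + m (V - L)"
      using bor by (intro m_subadditive) auto
    finally have "m ((U \<union> V) - (K \<union> L)) < e"
      using KU(5) LV(5) by simp
    then show "\<exists>K U. closedin X K \<and> openin X U \<and> K \<subseteq> A \<union> B \<and> A \<union> B \<subseteq> U \<and> m (U - K) < e"
      using KU LV by (intro exI[of _ "K \<union> L"] exI[of _ "U \<union> V"]) auto
  qed
qed

text \<open>Alexandroff's argument: closed inner approximations of a sequence of regular sets decreasing to
  \<open>{}\<close> have, by compactness, already a finite empty intersection.\<close>

lemma regular_extension:
  assumes compact: "compact_space X"
  shows "\<exists>\<mu>. (\<forall>A\<in>regular_sets. \<mu> A = ennreal (m A)) \<and> measure_space (topspace X) (sigma_sets (topspace X) regular_sets) \<mu>"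
proof -
  interpret R: algebra "topspace X" regular_sets
    by (rule algebra_regular_sets)
  show ?thesis
  proof (rule R.caratheodory_empty_continuous)
    show "positive regular_sets (\<lambda>A. ennreal (m A))"
      by (simp add: positive_def m_empty)
    show "additive regular_sets (\<lambda>A. ennreal (m A))"
      by (auto simp: additive_def additive regular_sets_Bor nonneg)
    show "\<And>A. A \<in> regular_sets \<Longrightarrow> ennreal (m A) \<noteq> \<infinity>"
      by simp
    fix A :: "nat \<Rightarrow> 'a set"
    assume A: "range A \<subseteq> regular_sets" "decseq A" "(\<Inter>i. A i) = {}"
    have ABor: "A i \<in> Bor" for i
      using A(1) regular_sets_Bor by blast
    have "(\<lambda>i. m (A i)) \<longlonglongrightarrow> 0"
    proof (rule LIMSEQ_I)
      fix e :: real assume e: "e > 0"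
      have "\<forall>i. \<exists>K. closedin X K \<and> K \<subseteq> A i \<and> m (A i - K) < e * (1/2) ^ Suc i"
      proof
        fix i
        have Ai: "A i \<in> regular_sets"
          using A(1) by blast
        have "e * (1/2) ^ Suc i > 0"
          using e by simp
        then obtain K U where KU: "closedin X K" "openin X U" "K \<subseteq> A i" "A i \<subseteq> U" "m (U - K) < e * (1/2) ^ Suc i"
          by (rule regular_setsE[OF Ai])
        have "m (A i - K) \<le> m (U - K)"
          using KU(4) ABor[of i] open_Bor[OF KU(2)] closed_Bor[OF KU(1)]
          by (intro m_mono Bor.Diff) (auto intro: Bor.Diff)
        then show "\<exists>K. closedin X K \<and> K \<subseteq> A i \<and> m (A i - K) < e * (1/2) ^ Suc i"
          using KU by (intro exI[of _ K]) auto
      qed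
      then obtain K where K: "\<And>i. closedin X (K i)" "\<And>i. K i \<subseteq> A i" "\<And>i. m (A i - K i) < e * (1/2) ^ Suc i"
        by metis
      have "(\<Inter>i. K i) = {}"
        using INF_mono'[of K A UNIV] K(2) A(3) by simp
      then have "\<exists>\<F>. finite \<F> \<and> \<F> \<subseteq> range K \<and> \<Inter>\<F> = {}"
        using compact K(1) unfolding compact_space_fip by (metis (no_types, lifting) imageE)
      then obtain F where F: "finite F" "(\<Inter>i\<in>F. K i) = {}"
        by (metis finite_subset_image)
      define n where "n = Max (insert 0 F)"
      have n: "i \<le> n" if "i \<in> F" for i
        using F(1) that by (simp add: n_def)
      have "norm (m (A k) - 0) < e" if "k \<ge> n" for k
      proof -
        have "A k \<subseteq> (\<Union>i\<in>F. A i - K i)"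
        proof
          fix x assume x: "x \<in> A k"
          obtain i where i: "i \<in> F" "x \<notin> K i"
            using F(2) by blast
          moreover have "x \<in> A i"
            using x n[OF i(1)] that decseqD[OF A(2), of i k] by auto
          ultimately show "x \<in> (\<Union>i\<in>F. A i - K i)"
            by blast
        qed
        moreover have dif: "A i - K i \<in> Bor" for i
          using ABor[of i] closed_Bor[OF K(1)[of i]] by blast
        ultimately have "m (A k) \<le> m (\<Union>i\<in>F. A i - K i)"
          using ABor F(1) by (intro m_mono Bor.finite_UN) auto
        also have "\<dots> \<le> (\<Sum>i\<in>F. m (A i - K i))"
          using F(1) dif by (rule m_UN_le)
        also have "\<dots> \<le> (\<Sum>i<Suc n. m (A i - K i))"
          using n nonneg by (intro sum_mono2) (auto simp: less_Suc_eq_le)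
        also have "\<dots> \<le> (\<Sum>i<Suc n. e * (1/2) ^ Suc i)"
          using K(3) by (intro sum_mono less_imp_le)
        also have "\<dots> = e * (1 - (1/2) ^ Suc n)"
          by (simp only: sum_distrib_left[symmetric] power_Suc, simp add: sum_distrib_left[symmetric] sum_divide_distrib[symmetric] sum_gp_strict)
        also have "\<dots> < e"
          using e by simp
        finally show ?thesis
          using nonneg[of "A k"] by simp
      qed
      then show "\<exists>n. \<forall>k\<ge>n. norm (m (A k) - 0) < e"
        by blast
    qed
    then show "(\<lambda>i. ennreal (m (A i))) \<longlonglongrightarrow> 0"
      using tendsto_ennrealI by fastforce
  qed
qed

lemma countable_irregular_parameters:
  fixes H C :: "real \<Rightarrow> 'a set"
  assumes H: "\<And>t. openin X (H t)" and C: "\<And>t. closedin X (C t)"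
    and HC: "\<And>t. H t \<subseteq> C t" and CH: "\<And>s t. s < t \<Longrightarrow> C s \<subseteq> H t"
  shows "countable {t. H t \<notin> regular_sets}"
proof -
  have "mono (\<lambda>t. m (H t))"
  proof (rule monoI)
    fix s t :: real assume "s \<le> t"
    then have "H s \<subseteq> H t"
      using HC[of s] CH[of s t] by (cases "s = t") auto
    then show "m (H s) \<le> m (H t)"
      using open_Bor[OF H] by (intro m_mono)
  qed
  then have "countable {t. \<not> isCont (\<lambda>t. m (H t)) t}"
    by (rule mono_ctble_discont)
  moreover have "H t \<in> regular_sets" if cont: "isCont (\<lambda>t. m (H t)) t" for t
    unfolding regular_sets_def
  proof safe
    show "H t \<in> Bor"
      by (rule open_Bor[OF H])
    fix e :: real assume "e > 0"
    then obtain d where d: "d > 0" "\<And>s. \<bar>s - t\<bar> < d \<Longrightarrow> \<bar>m (H s) - m (H t)\<bar> < e"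
      using cont unfolding isCont_def LIM_eq by (metis abs_zero diff_self real_norm_def)
    define s where "s = t - d/2"
    have s: "s < t" "\<bar>m (H s) - m (H t)\<bar> < e"
      using d(1) by (auto simp: s_def intro!: d(2))
    have "m (H t - C s) \<le> m (H t - H s)"
      using HC[of s] open_Bor[OF H] closed_Bor[OF C] by (intro m_mono) auto
    also have "\<dots> = m (H t) - m (H s)"
      using HC[of s] CH[OF s(1)] open_Bor[OF H] by (intro m_diff) auto
    finally have "m (H t - C s) < e"
      using s(2) by simp
    then show "\<exists>K U. closedin X K \<and> openin X U \<and> K \<subseteq> H t \<and> H t \<subseteq> U \<and> m (U - K) < e"
      using H C CH[OF s(1)] by blast
  qed
  then have "{t. H t \<notin> regular_sets} \<subseteq> {t. \<not> isCont (\<lambda>t. m (H t)) t}"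
    by blast
  ultimately show ?thesis
    using countable_subset by blast
qed

end

subsection \<open>Isometric actions and Haar measure\<close>

locale proper_isometric_action =
  fixes act :: "'g::{topological_group_add, metric_space} \<Rightarrow>
      'm::{metric_space, second_countable_topology} \<Rightarrow> 'm"
    and r :: real
  assumes left: "left_action act"
    and continuous: "continuous_action act"
    and proper: "proper_action act"
    and isometric: "isometric_action act"
    and balls_compact: "\<And>(m::'m) \<rho>. compact (closure (ball m \<rho>))"
    and r_pos: "r > 0"
begin

lemma act_0 [simp]: "act 0 m = m"
  using left by (simp add: left_action_def)

lemma act_add: "act (x + y) m = act x (act y m)"
  using left by (simp add: left_action_def)

lemma act_minus [simp]: "act (- x) (act x m) = m"
  by (simp flip: act_add)

lemma act_minus' [simp]: "act x (act (- x) m) = m"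
  by (simp flip: act_add)

lemma act_image_add: "act (x + y) ` A = act x ` act y ` A"
  by (simp add: image_image act_add)

lemma act_image_0 [simp]: "act 0 ` A = A"
  by simp

lemma act_image_minus [simp]: "act (- x) ` act x ` A = A"
  by (simp flip: act_image_add)

lemma act_image_minus' [simp]: "act x ` act (- x) ` A = A"
  by (simp flip: act_image_add)

lemma inj_act: "inj_on (act x) A"
  by (metis act_minus inj_on_def)

lemma dist_act [simp]: "dist (act x m) (act x m') = dist m m'"
  using isometric by (simp add: isometric_action_def)

lemma continuous_on_act [continuous_intros]:
  assumes "continuous_on S f" "continuous_on S h"
  shows "continuous_on S (\<lambda>z. act (f z) (h z))"
  using continuous_on_compose2[of UNIV "\<lambda>(x, m). act x m" S "\<lambda>z. (f z, h z)"] assms continuous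
  by (auto simp: continuous_action_def intro: continuous_on_Pair)

lemma act_image_eq_vimage: "act x ` A = act (- x) -` A"
  by (auto simp: image_iff) (metis act_minus')

lemma open_act_image: "open U \<Longrightarrow> open (act x ` U)"
  unfolding act_image_eq_vimage by (rule open_vimage) (auto intro!: continuous_intros)

lemma compact_act_image: "compact K \<Longrightarrow> compact (act x ` K)"
  by (rule compact_continuous_image) (auto intro!: continuous_intros)

lemma compact_return_set:
  assumes "compact K" "compact L"
  shows "compact {x. \<exists>m\<in>K. act x m \<in> L}"
proof -
  have "compact ((\<lambda>(x, m). (act x m, m)) -` (L \<times> K))"
    using proper assms compact_Times unfolding proper_action_def by blast
  then have "compact (fst ` ((\<lambda>(x, m). (act x m, m)) -` (L \<times> K)))"
    by (rule compact_continuous_image[rotated]) (auto intro!: continuous_intros)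
  also have "fst ` ((\<lambda>(x, m). (act x m, m)) -` (L \<times> K)) = {x. \<exists>m\<in>K. act x m \<in> L}"
  proof (intro equalityI subsetI)
    fix x assume "x \<in> {x. \<exists>m\<in>K. act x m \<in> L}"
    then obtain m where "(x, m) \<in> (\<lambda>(x, m). (act x m, m)) -` (L \<times> K)"
      by auto
    then have "fst (x, m) \<in> fst ` ((\<lambda>(x, m). (act x m, m)) -` (L \<times> K))"
      by (rule imageI)
    then show "x \<in> fst ` ((\<lambda>(x, m). (act x m, m)) -` (L \<times> K))"
      by simp
  qed auto
  finally show ?thesis .
qed

lemma act_point_set [simp]: "act x ` P \<in> point_sets r \<longleftrightarrow> P \<in> point_sets r"
proof -
  have "act x ` P \<in> point_sets r" if P: "P \<in> point_sets r" for x P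
    unfolding point_sets_iff
  proof safe
    fix m p q assume "p \<in> P" "q \<in> P" "dist m (act x p) < r" "dist m (act x q) < r"
    moreover have "dist (act (- x) m) p = dist m (act x p)" for p
      using dist_act[of "- x" m "act x p"] by simp
    ultimately show "act x p = act x q"
      using point_setsD[OF P, of p q "act (- x) m"] by simp
  qed
  from this[of P x] this[of "act x ` P" "- x"] show ?thesis
    by auto
qed

lemma test_function_act:
  assumes \<phi>: "\<phi> \<in> test_functions"
  shows "(\<lambda>m. \<phi> (act x m)) \<in> test_functions"
proof -
  have "continuous_on UNIV (\<lambda>m. \<phi> (act x m))"
    by (rule continuous_on_compose2[of UNIV \<phi>])
      (use \<phi> in \<open>auto simp: test_functions_def intro!: continuous_intros\<close>)
  moreover have "compact (closure {m. \<phi> (act x m) \<noteq> 0})"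
  proof (rule compact_closure_of_subset)
    show "compact (act (- x) ` closure {m. \<phi> m \<noteq> 0})"
      using \<phi> by (intro compact_act_image) (auto simp: test_functions_def)
    have "{m. \<phi> (act x m) \<noteq> 0} = act (- x) ` {m. \<phi> m \<noteq> 0}"
      by (auto simp: act_image_eq_vimage)
    also have "\<dots> \<subseteq> act (- x) ` closure {m. \<phi> m \<noteq> 0}"
      using closure_subset by (intro image_mono)
    finally show "{m. \<phi> (act x m) \<noteq> 0} \<subseteq> act (- x) ` closure {m. \<phi> m \<noteq> 0}" .
  qed
  ultimately show ?thesis
    by (simp add: test_functions_def)
qed

lemma continuous_map_vague_act: "continuous_map (vague_topology r) (vague_topology r) ((`) (act x))"
  unfolding vague_topology_def
proof (rule continuous_on_generated_topo, fold vague_topology_def)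
  fix W :: "'m set set" assume "W \<in> {{P \<in> point_sets r. (\<Sum>\<^sub>\<infinity>p\<in>P. \<phi> p) \<in> U} | \<phi> U. \<phi> \<in> test_functions \<and> open (U :: real set)}"
  then obtain \<phi> U where W: "W = {P \<in> point_sets r. (\<Sum>\<^sub>\<infinity>p\<in>P. \<phi> p) \<in> U}" "\<phi> \<in> test_functions" "open (U :: real set)"
    by blast
  have "(`) (act x) -` W \<inter> topspace (vague_topology r) = {P \<in> point_sets r. (\<Sum>\<^sub>\<infinity>p\<in>P. \<phi> (act x p)) \<in> U}"
    by (auto simp: W(1) infsum_reindex[OF inj_act] o_def)
  then show "openin (vague_topology r) ((`) (act x) -` W \<inter> topspace (vague_topology r))"
    using openin_vague_test[OF test_function_act[OF W(2)] W(3)] by simp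
next
  have "\<Union> {{P \<in> point_sets r. (\<Sum>\<^sub>\<infinity>p\<in>P. \<phi> p) \<in> U} | \<phi> U. \<phi> \<in> test_functions \<and> open (U :: real set)} = topspace (vague_topology r :: 'm set topology)"
    unfolding vague_topology_def by simp
  then show "(`) (act x) ` topspace (vague_topology r) \<subseteq> \<Union> {{P \<in> point_sets r. (\<Sum>\<^sub>\<infinity>p\<in>P. \<phi> p) \<in> U} | \<phi> U. \<phi> \<in> test_functions \<and> open (U :: real set)}"
    by auto
qed

lemma measurable_orbit_visits:
  assumes P: "P \<in> point_sets r" and A: "A \<in> sigma_sets (point_sets r) (hits_balls r)"
  shows "{x. act x ` P \<in> A} \<in> sets borel"
  using A
proof (induction rule: sigma_sets.induct)
  case (Basic A)
  then obtain a t where A: "A = hits r (ball a t)"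
    by (auto simp: hits_balls_def)
  have "{x. act x ` P \<in> A} = (\<Union>p\<in>P. (\<lambda>x. act x p) -` ball a t)"
    using P by (auto simp: A hits_def)
  also have "open \<dots>"
    by (intro open_UN ballI open_vimage) (auto intro!: continuous_intros)
  finally show ?case
    by simp
next
  case (Compl A)
  have "{x. act x ` P \<in> point_sets r - A} = space borel - {x. act x ` P \<in> A}"
    using P by auto
  then show ?case
    using Compl.IH sets.compl_sets by metis
next
  case (Union A)
  have "{x. act x ` P \<in> \<Union> (range A)} = (\<Union>i. {x. act x ` P \<in> A i})"
    by auto
  then show ?case
    using Union by auto
qed auto

end

lemma compact_set_plus:
  fixes K L :: "'g::{topological_group_add, metric_space} set"
  assumes "compact K" "compact L"
  shows "compact (K + L)"
proof -
  have "K + L = (\<lambda>(x, y). x + y) ` (K \<times> L)"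
    by (auto simp: set_plus_def)
  moreover have "continuous_on (K \<times> L) (\<lambda>(x, y). x + y)"
    by (auto simp: case_prod_unfold intro!: continuous_intros)
  ultimately show ?thesis
    using compact_continuous_image compact_Times[OF assms] by metis
qed

lemma compact_uminus_image:
  fixes K :: "'g::{topological_group_add, metric_space} set"
  shows "compact K \<Longrightarrow> compact (uminus ` K)"
  by (rule compact_continuous_image) (auto intro!: continuous_intros)

lemma closed_compact_plus:
  fixes K C :: "'g::{topological_group_add, metric_space} set"
  assumes "compact K" "closed C"
  shows "closed (K + C)"
  unfolding closed_sequential_limits
proof (intro allI impI, elim conjE)
  fix z l assume z: "\<forall>n::nat. z n \<in> K + C" and lim: "z \<longlonglongrightarrow> l"
  have "\<forall>n. \<exists>k c. k \<in> K \<and> c \<in> C \<and> z n = k + c"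
    using z by (metis set_plus_elim)
  then obtain k c where kc: "\<And>n. k n \<in> K" "\<And>n. c n \<in> C" "\<And>n. z n = k n + c n"
    by metis
  obtain k0 s where s: "k0 \<in> K" "strict_mono (s :: nat \<Rightarrow> nat)" "(k \<circ> s) \<longlonglongrightarrow> k0"
    using assms(1) kc(1) unfolding compact_def by metis
  have "(\<lambda>n. - (k \<circ> s) n + (z \<circ> s) n) \<longlonglongrightarrow> - k0 + l"
    by (intro tendsto_intros s(3) LIMSEQ_subseq_LIMSEQ[OF lim s(2)])
  moreover have "- (k \<circ> s) n + (z \<circ> s) n = c (s n)" for n
    by (simp add: kc(3) add.assoc[symmetric])
  ultimately have "(\<lambda>n. c (s n)) \<longlonglongrightarrow> - k0 + l"
    by simp
  then have "- k0 + l \<in> C"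
    by (rule closed_sequentially[OF assms(2) kc(2)])
  then have "k0 + (- k0 + l) \<in> K + C"
    using s(1) by (rule set_plus_intro[rotated])
  then show "l \<in> K + C"
    by (simp add: add.assoc[symmetric])
qed

lemma plus_van_hove_boundary:
  assumes u: "u \<in> U" and z: "z \<in> van_hove_boundary K D"
  shows "u + z \<in> van_hove_boundary (U \<union> (U + K)) D"
proof (cases "z \<in> K + D - interior D")
  case True
  then obtain k d where kd: "k \<in> K" "d \<in> D" "z = k + d"
    by (auto elim: set_plus_elim)
  have "u + z \<in> (U \<union> (U + K)) + D"
    using u kd by (metis Un_iff add.assoc set_plus_intro)
  moreover have "u + z \<in> (U \<union> (U + K)) + closure (- D)"
    using u True by (intro set_plus_intro) (auto simp: closure_complement)
  ultimately show ?thesis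
    using interior_subset[of D] by (auto simp: van_hove_boundary_def)
next
  case False
  then have z': "z \<in> K + closure (- D)" "z \<in> D"
    using z by (auto simp: van_hove_boundary_def)
  then obtain k c where kc: "k \<in> K" "c \<in> closure (- D)" "z = k + c"
    by (auto elim: set_plus_elim)
  have "u + z \<in> (U \<union> (U + K)) + closure (- D)"
    using u kc by (metis Un_iff add.assoc set_plus_intro)
  moreover have "u + z \<in> (U \<union> (U + K)) + D"
    using u z'(2) by (intro set_plus_intro) auto
  ultimately show ?thesis
    using interior_subset[of D] by (auto simp: van_hove_boundary_def)
qed

locale haar_van_hove =
  fixes vol :: "'g::{topological_group_add, metric_space} measure"
    and D :: "nat \<Rightarrow> 'g set"
  assumes haar: "left_haar_measure vol"
    and unimod: "unimodular vol"
    and van_hove: "van_hove_sequence vol D"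
    and noncompact: "\<not> compact (UNIV :: 'g set)"
begin

abbreviation boundary :: "'g set \<Rightarrow> nat \<Rightarrow> 'g set" where
  "boundary K n \<equiv> van_hove_boundary K (D n)"

lemma sets_vol [simp, measurable_cong]: "sets vol = sets borel"
  using haar by (simp add: left_haar_measure_def)

lemma space_vol [simp]: "space vol = UNIV"
  using sets_eq_imp_space_eq[OF sets_vol] by simp

lemma vol_compact: "compact K \<Longrightarrow> emeasure vol K < \<infinity>"
  using haar by (simp add: left_haar_measure_def)

lemma vol_left: "A \<in> sets borel \<Longrightarrow> emeasure vol ((+) x ` A) = emeasure vol A"
  using haar by (simp add: left_haar_measure_def)

lemma vol_right: "A \<in> sets borel \<Longrightarrow> emeasure vol ((\<lambda>y. y + x) ` A) = emeasure vol A"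
  using unimod by (simp add: unimodular_def)

lemma compact_D: "compact (D n)" and D_nonempty: "D n \<noteq> {}" and incseq_D: "incseq D"
  and UN_interior_D: "(\<Union>n. interior (D n)) = UNIV"
  using van_hove by (auto simp: van_hove_sequence_def)

lemma van_hove_tendsto:
  "compact K \<Longrightarrow> (\<lambda>n. measure vol (boundary K n) / measure vol (D n)) \<longlonglongrightarrow> 0"
  using van_hove by (simp add: van_hove_sequence_def)

lemma compact_borel [simp]: "compact (K :: 'g set) \<Longrightarrow> K \<in> sets borel"
  by (rule borel_compact)

lemma distr_right: "distr vol vol (\<lambda>y. y + x) = vol"
proof (rule measure_eqI)
  fix A assume "A \<in> sets (distr vol vol (\<lambda>y. y + x))"
  then have A: "A \<in> sets borel"
    by simp
  have meas: "(\<lambda>y. y + x) \<in> measurable borel borel" for x :: 'g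
    by (intro borel_measurable_continuous_onI continuous_intros)
  have "emeasure (distr vol vol (\<lambda>y. y + x)) A = emeasure vol ((\<lambda>y. y + x) -` A)"
    using A meas by (subst emeasure_distr) (auto cong: measurable_cong_sets)
  also have "(\<lambda>y. y + x) -` A = (\<lambda>y. y + - x) ` A"
    by (auto simp: image_iff add.assoc intro!: bexI[of _ "_ + x"])
  finally show "emeasure (distr vol vol (\<lambda>y. y + x)) A = emeasure vol A"
    using A by (simp only: vol_right)
qed simp

lemma borel_measurable_right_translate:
  "(\<lambda>y. y + x) \<in> measurable vol vol"
  by (auto cong: measurable_cong_sets intro!: borel_measurable_continuous_onI continuous_intros)

lemma integral_right_translate:
  fixes f :: "'g \<Rightarrow> real"
  assumes "f \<in> borel_measurable borel"
  shows "(\<integral>x. f (x + z) \<partial>vol) = (\<integral>x. f x \<partial>vol)"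
proof -
  have "(\<integral>x. f x \<partial>vol) = (\<integral>x. f x \<partial>distr vol vol (\<lambda>y. y + z))"
    by (simp add: distr_right)
  also have "\<dots> = (\<integral>x. f (x + z) \<partial>vol)"
    using assms by (intro integral_distr borel_measurable_right_translate) (auto cong: measurable_cong_sets)
  finally show ?thesis
    by simp
qed

lemma vol_open_pos:
  assumes "open U" "U \<noteq> {}"
  shows "emeasure vol U > 0"
proof (rule ccontr)
  assume "\<not> emeasure vol U > 0"
  then have U0: "emeasure vol U = 0"
    by (simp add: not_gr_zero)
  obtain u where u: "u \<in> U"
    using assms by blast
  have op: "open ((+) x ` U)" for x
  proof -
    have "(+) x ` U = (+) (- x) -` U"
      by (auto simp: image_iff add.assoc[symmetric] intro!: bexI[of _ "- x + _"])
    then show ?thesis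
      using assms(1) by (auto intro!: open_vimage continuous_intros)
  qed
  have "emeasure vol (D n) = 0" for n
  proof -
    have "D n \<subseteq> (\<Union>x\<in>UNIV. (+) x ` U)"
    proof
      fix y assume "y \<in> D n"
      have "y = (y - u) + u"
        by simp
      then show "y \<in> (\<Union>x\<in>UNIV. (+) x ` U)"
        using u by blast
    qed
    then obtain F where F: "finite F" "D n \<subseteq> (\<Union>x\<in>F. (+) x ` U)"
      using compactE_image[OF compact_D, of UNIV "\<lambda>x. (+) x ` U"] op by auto
    have "emeasure vol (D n) \<le> emeasure vol (\<Union>x\<in>F. (+) x ` U)"
      using F op by (intro emeasure_mono) auto
    also have "\<dots> \<le> (\<Sum>x\<in>F. emeasure vol ((+) x ` U))"
      using F(1) op by (intro emeasure_subadditive_finite) auto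
    also have "\<dots> = 0"
      using vol_left[of U] assms(1) U0 by simp
    finally show ?thesis
      by simp
  qed
  then have "emeasure vol (\<Union>n. D n) = 0"
    by (rule emeasure_UN_eq_0) (auto simp: compact_D)
  moreover have "(\<Union>n. D n) = UNIV"
    using UN_interior_D interior_subset by blast
  ultimately show False
    using haar by (simp add: left_haar_measure_def)
qed

lemma vol_UNIV: "emeasure vol UNIV = \<infinity>"
proof -
  obtain N where N: "interior (D N) \<noteq> {}"
    using UN_interior_D by fastforce
  define U where "U = D N"
  have U: "compact U" "U \<in> sets borel"
    using compact_D by (simp_all add: U_def)
  have "0 < emeasure vol (interior U)"
    using N by (intro vol_open_pos) (auto simp: U_def)
  also have "\<dots> \<le> emeasure vol U"
    using U interior_subset by (intro emeasure_mono) auto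
  finally have Upos: "emeasure vol U > 0" .
  have "\<exists>F. finite F \<and> card F = n \<and> disjoint_family_on (\<lambda>x. (+) x ` U) F" for n
  proof (induction n)
    case 0
    show ?case
      by (intro exI[of _ "{}"]) (auto simp: disjoint_family_on_def)
  next
    case (Suc n)
    then obtain F where F: "finite F" "card F = n" "disjoint_family_on (\<lambda>x. (+) x ` U) F"
      by blast
    have "compact ((F + U) + uminus ` U)"
      using finite_imp_compact[OF F(1)] U(1) by (intro compact_set_plus compact_uminus_image)
    then obtain x where x: "x \<notin> (F + U) + uminus ` U"
      using noncompact by (metis UNIV_eq_I)
    have disj: "(+) x ` U \<inter> (+) y ` U = {}" if y: "y \<in> F" for y
    proof (rule ccontr)
      assume "(+) x ` U \<inter> (+) y ` U \<noteq> {}"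
      then obtain u v where uv: "u \<in> U" "v \<in> U" "x + u = y + v"
        by blast
      then have "x = (y + v) + - u"
        by (metis add.assoc add.right_inverse add.right_neutral)
      then show False
        using x y uv by (auto simp: set_plus_def)
    qed
    have "U \<noteq> {}"
      using D_nonempty U_def by simp
    then have "x \<notin> F"
      using disj by blast
    moreover have "(+) y ` U \<inter> (+) x ` U = {}" if "y \<in> F" for y
      using disj[OF that] by blast
    ultimately show ?case
      using F disj by (intro exI[of _ "insert x F"])
        (auto simp: disjoint_family_on_def)
  qed
  then have ge: "of_nat n * emeasure vol U \<le> emeasure vol UNIV" for n
  proof -
    obtain F where F: "finite F" "card F = n" "disjoint_family_on (\<lambda>x. (+) x ` U) F"
      using \<open>\<And>n. \<exists>F. finite F \<and> card F = n \<and> disjoint_family_on (\<lambda>x. (+) x ` U) F\<close> by blast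
    have c: "compact ((+) x ` U)" for x
      using U(1) by (rule compact_continuous_image[rotated]) (auto intro!: continuous_intros)
    have "of_nat n * emeasure vol U = (\<Sum>x\<in>F. emeasure vol ((+) x ` U))"
      using vol_left[OF U(2)] F(2) by simp
    also have "\<dots> = emeasure vol (\<Union>x\<in>F. (+) x ` U)"
      using F c by (intro sum_emeasure) auto
    also have "\<dots> \<le> emeasure vol UNIV"
      by (intro emeasure_mono) auto
    finally show ?thesis .
  qed
  show ?thesis
  proof (rule ccontr)
    assume fin: "emeasure vol UNIV \<noteq> \<infinity>"
    have Ufin: "emeasure vol U \<noteq> \<infinity>"
      using vol_compact[OF U(1)] by simp
    define a b where "a = measure vol U" and "b = measure vol UNIV"
    have "a > 0"
      using Upos Ufin by (simp add: a_def measure_def enn2real_positive_iff less_top)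
    obtain n where n: "real n * a > b"
      using reals_Archimedean3[OF \<open>a > 0\<close>] by blast
    have "ennreal (real n * a) \<le> ennreal b"
      using ge[of n] fin Ufin by (simp add: a_def b_def emeasure_eq_ennreal_measure ennreal_mult ennreal_of_nat_eq_real_of_nat)
    then show False
      using n by (simp add: b_def)
  qed
qed

lemma measure_D_at_top: "filterlim (\<lambda>n. measure vol (D n)) at_top sequentially"
proof -
  have "(\<Union>n. D n) = UNIV"
    using UN_interior_D interior_subset by blast
  then have lim: "(\<lambda>n. emeasure vol (D n)) \<longlonglongrightarrow> \<infinity>"
    using Lim_emeasure_incseq[of D vol] compact_D incseq_D vol_UNIV by (auto simp: image_subset_iff)
  show ?thesis
    unfolding filterlim_at_top_dense
  proof
    fix Z :: real
    have "eventually (\<lambda>n. ennreal Z < emeasure vol (D n)) sequentially"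
      using lim by (rule order_tendstoD) simp
    then show "eventually (\<lambda>n. Z < measure vol (D n)) sequentially"
    proof eventually_elim
      case (elim n)
      then show ?case
        using vol_compact[OF compact_D[of n]]
        by (simp add: emeasure_eq_ennreal_measure ennreal_less_iff less_top)
          (metis ennreal_less_iff ennreal_neg linorder_not_le measure_nonneg order_le_less_trans not_less)
    qed
  qed
qed

lemma measure_D_pos: "eventually (\<lambda>n. measure vol (D n) > 0) sequentially"
  using measure_D_at_top unfolding filterlim_at_top_dense by blast

lemma van_hove_boundary_borel:
  assumes "compact K"
  shows "boundary K n \<in> sets borel"
proof -
  have "closed (K + D n)" "closed (K + closure (- D n))" "closed (D n)"
    using assms compact_D by (auto intro: closed_compact_plus compact_imp_closed)
  then show ?thesis
    unfolding van_hove_boundary_def by (intro sets.Un sets.Diff) auto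
qed

lemma van_hove_boundary_finite:
  assumes "compact K"
  shows "emeasure vol (boundary K n) < \<infinity>"
proof -
  have c: "compact ((K + D n) \<union> D n)"
    using assms compact_D by (intro compact_Un compact_set_plus)
  have "boundary K n \<subseteq> (K + D n) \<union> D n"
    by (auto simp: van_hove_boundary_def)
  then have "emeasure vol (boundary K n) \<le> emeasure vol ((K + D n) \<union> D n)"
    using c by (intro emeasure_mono) auto
  then show ?thesis
    using vol_compact[OF c] by (rule order_le_less_trans)
qed

end

subsection \<open>Counting copies of a pattern\<close>

locale haar_action = proper_isometric_action act r + haar_van_hove vol D
  for act :: "'g::{topological_group_add, metric_space} \<Rightarrow>
      'm::{metric_space, second_countable_topology} \<Rightarrow> 'm"
    and r :: real and vol :: "'g measure" and D :: "nat \<Rightarrow> 'g set"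
begin

abbreviation copies :: "'m set \<Rightarrow> nat \<Rightarrow> 'm set \<Rightarrow> 'm set set" where
  "copies Q n P \<equiv> {Q'. Q' \<subseteq> P \<and> (\<exists>x\<in>D n. act x ` Q' = Q)}"

abbreviation window_integral :: "('m set \<Rightarrow> real) \<Rightarrow> nat \<Rightarrow> 'm set \<Rightarrow> real" where
  "window_integral g n A \<equiv> \<integral>x. indicator (D n) x * g (act x ` A) \<partial>vol"

lemma compact_act_plus:
  assumes "compact U" "compact K"
  shows "compact ((\<lambda>(u, q). act u q) ` (U \<times> K))"
  by (rule compact_continuous_image)
    (auto simp: case_prod_unfold intro!: continuous_intros compact_Times assms)

lemma card_copies_bounded:
  assumes Q: "finite Q" and U: "compact U"
  obtains N :: nat where "\<And>P x \<E>. P \<in> point_sets r \<Longrightarrow>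
    (\<And>Q'. Q' \<in> \<E> \<Longrightarrow> Q' \<subseteq> P \<and> (\<exists>u\<in>U. act x ` Q' = act u ` Q)) \<Longrightarrow> card \<E> \<le> N"
proof -
  define C where "C = (\<lambda>(u, q). act u q) ` (U \<times> Q)"
  have "compact C"
    unfolding C_def by (intro compact_act_plus U finite_imp_compact Q)
  then obtain N where N: "\<And>P. P \<in> point_sets r \<Longrightarrow> finite (P \<inter> C) \<and> card (P \<inter> C) \<le> N"
    using card_point_set_bounded[OF _ r_pos] by metis
  have "card \<E> \<le> 2 ^ N" if P: "P \<in> point_sets r"
    and E: "\<And>Q'. Q' \<in> \<E> \<Longrightarrow> Q' \<subseteq> P \<and> (\<exists>u\<in>U. act x ` Q' = act u ` Q)" for P x \<E>
  proof -
    have F: "finite (act x ` P \<inter> C)" "card (act x ` P \<inter> C) \<le> N"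
      using N P by simp_all
    have "card \<E> \<le> card (Pow (act x ` P \<inter> C))"
    proof (rule card_inj_on_le)
      show "inj_on ((`) (act x)) \<E>"
        by (rule inj_onI) (metis act_image_minus)
      show "(`) (act x) ` \<E> \<subseteq> Pow (act x ` P \<inter> C)"
      proof (rule image_subsetI)
        fix Q' assume "Q' \<in> \<E>"
        then obtain u where u: "Q' \<subseteq> P" "u \<in> U" "act x ` Q' = act u ` Q"
          using E[of Q'] by auto
        have "act u ` Q \<subseteq> C"
          unfolding C_def using u(2) by (auto intro: rev_image_eqI)
        moreover have "act x ` Q' \<subseteq> act x ` P"
          using u(1) by (rule image_mono)
        ultimately show "act x ` Q' \<in> Pow (act x ` P \<inter> C)"
          unfolding u(3) by simp
      qed
    qed (simp only: finite_Pow_iff F(1))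
    also have "\<dots> \<le> 2 ^ N"
      unfolding card_Pow[OF F(1)] using F(2) by simp
    finally show ?thesis .
  qed
  then show thesis
    by (rule that)
qed

text \<open>Thickening the boundary by a compact set \<open>U\<close> of positive volume turns the number of copies
  located in the boundary into a volume: the translates of \<open>U\<close> at the copies have bounded overlap.\<close>

lemma card_boundary_copies:
  assumes Q: "finite Q" and K: "compact K"
  obtains C K' where "C \<ge> 0" "compact K'"
    "\<And>n P \<E>. P \<in> point_sets r \<Longrightarrow> finite \<E> \<Longrightarrow>
      (\<And>Q'. Q' \<in> \<E> \<Longrightarrow> Q' \<subseteq> P \<and> (\<exists>z\<in>boundary K n. act z ` Q' = Q)) \<Longrightarrow>
      real (card \<E>) \<le> C * measure vol (boundary K' n)"
proof -
  obtain N0 where "measure vol (D N0) > 0"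
    using measure_D_pos eventually_sequentially by auto
  then obtain U where U: "compact U" "measure vol U > 0"
    using compact_D by blast
  obtain N :: nat where N: "\<And>P x \<E>. P \<in> point_sets r \<Longrightarrow>
    (\<And>Q'. Q' \<in> \<E> \<Longrightarrow> Q' \<subseteq> P \<and> (\<exists>u\<in>U. act x ` Q' = act u ` Q)) \<Longrightarrow> card \<E> \<le> N"
    using card_copies_bounded[OF Q U(1)] by metis
  define K' where "K' = U \<union> (U + K)"
  have K': "compact K'"
    unfolding K'_def by (intro compact_Un compact_set_plus U(1) K)
  have "real (card \<E>) \<le> real N / measure vol U * measure vol (boundary K' n)"
    if P: "P \<in> point_sets r" and fin: "finite \<E>"
      and E: "\<And>Q'. Q' \<in> \<E> \<Longrightarrow> Q' \<subseteq> P \<and> (\<exists>z\<in>boundary K n. act z ` Q' = Q)" for n P \<E>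
  proof -
    let ?B = "boundary K' n"
    obtain z where z: "\<And>Q'. Q' \<in> \<E> \<Longrightarrow> z Q' \<in> boundary K n \<and> act (z Q') ` Q' = Q"
      using E by metis
    let ?U = "\<lambda>Q'. (\<lambda>u. u + z Q') ` U"
    have Uc: "compact (?U Q')" for Q'
      using U(1) by (rule compact_continuous_image[rotated]) (auto intro!: continuous_intros)
    have le: "(\<Sum>Q'\<in>\<E>. indicator (?U Q') x) \<le> of_nat N * (indicator ?B x :: ennreal)" for x
    proof -
      define \<F> where "\<F> = {Q' \<in> \<E>. x \<in> ?U Q'}"
      have "(\<Sum>Q'\<in>\<E>. indicator (?U Q') x) = (\<Sum>Q'\<in>\<F>. (1::ennreal))"
        unfolding \<F>_def using fin by (intro sum.mono_neutral_cong_right) auto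
      then have eq: "(\<Sum>Q'\<in>\<E>. indicator (?U Q') x) = (of_nat (card \<F>) :: ennreal)"
        by simp
      have F: "\<exists>u\<in>U. x = u + z Q'" "Q' \<in> \<E>" if "Q' \<in> \<F>" for Q'
        using that by (auto simp: \<F>_def)
      have "card \<F> \<le> N"
      proof (rule N[OF P])
        fix Q' assume Q': "Q' \<in> \<F>"
        then obtain u where "u \<in> U" "x = u + z Q'"
          using F(1) by blast
        then show "Q' \<subseteq> P \<and> (\<exists>u\<in>U. act x ` Q' = act u ` Q)"
          using E z F(2)[OF Q'] by (metis act_image_add)
      qed
      moreover have "\<F> = {}" if "x \<notin> ?B"
      proof (rule ccontr)
        assume "\<F> \<noteq> {}"
        then obtain Q' where Q': "Q' \<in> \<F>"
          by blast
        then obtain u where "u \<in> U" "x = u + z Q'"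
          using F(1) by blast
        then show False
          using plus_van_hove_boundary[of u U "z Q'" K "D n"] z F(2)[OF Q'] that by (simp add: K'_def)
      qed
      ultimately show ?thesis
        unfolding eq by (cases "x \<in> ?B") auto
    qed
    have "of_nat (card \<E>) * emeasure vol U = (\<Sum>Q'\<in>\<E>. emeasure vol (?U Q'))"
      using U(1) by (simp add: vol_right)
    also have "\<dots> = (\<integral>\<^sup>+x. (\<Sum>Q'\<in>\<E>. indicator (?U Q') x) \<partial>vol)"
      using Uc by (subst nn_integral_sum) (auto intro!: borel_measurable_indicator)
    also have "\<dots> \<le> (\<integral>\<^sup>+x. of_nat N * indicator ?B x \<partial>vol)"
      by (intro nn_integral_mono le)
    also have "\<dots> = of_nat N * emeasure vol ?B"
      using van_hove_boundary_borel[OF K', of n] by (subst nn_integral_cmult_indicator) auto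
    finally have "ennreal (real (card \<E>) * measure vol U) \<le> ennreal (real N * measure vol ?B)"
      using vol_compact[OF U(1)] van_hove_boundary_finite[OF K', of n]
      by (simp add: emeasure_eq_ennreal_measure ennreal_mult ennreal_of_nat_eq_real_of_nat less_top)
    then have "real (card \<E>) * measure vol U \<le> real N * measure vol ?B"
      by (simp add: ennreal_le_iff)
    then show ?thesis
      using U(2) by (simp add: field_simps)
  qed
  then show thesis
    using that[of "real N / measure vol U" K'] K' by simp
qed

lemma integrable_compact_support:
  fixes h :: "'g \<Rightarrow> real"
  assumes h: "h \<in> borel_measurable borel" and b: "\<And>x. \<bar>h x\<bar> \<le> b"
    and L: "compact L" and supp: "\<And>x. h x \<noteq> 0 \<Longrightarrow> x \<in> L"
  shows "integrable vol h"
proof (rule Bochner_Integration.integrable_bound)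
  have fin: "emeasure vol L < \<infinity>"
    by (rule vol_compact[OF L])
  show "integrable vol (\<lambda>x. b * indicator L x)"
    using L fin by (intro integrable_mult_right integrable_real_indicator) auto
  show "h \<in> borel_measurable vol"
    using h by (simp cong: measurable_cong_sets)
  have "norm (h x) \<le> norm (b * indicator L x)" for x
    using b[of x] supp[of x] by (cases "x \<in> L") auto
  then show "AE x in vol. norm (h x) \<le> norm (b * indicator L x)"
    by simp
qed

lemma integral_translate_bound:
  fixes h :: "'g \<Rightarrow> real"
  assumes h: "h \<in> borel_measurable borel" and b: "\<And>x. \<bar>h x\<bar> \<le> b"
    and L: "compact L" and supp: "\<And>x. h x \<noteq> 0 \<Longrightarrow> x \<in> L" and S: "S \<in> sets borel"
  shows "integrable vol (\<lambda>x. indicator S x * h (x + z))"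
    and "\<bar>\<integral>x. indicator S x * h (x + z) \<partial>vol\<bar> \<le> b * measure vol L"
proof -
  have meas: "(\<lambda>x. h (x + z)) \<in> borel_measurable borel"
    by (rule measurable_compose[OF _ h]) (intro borel_measurable_continuous_onI continuous_intros)
  have cL: "compact ((\<lambda>y. y + - z) ` L)"
    using L by (rule compact_continuous_image[rotated]) (auto intro!: continuous_intros)
  have supp': "x \<in> (\<lambda>y. y + - z) ` L" if "h (x + z) \<noteq> 0" for x
    using supp[OF that] by (intro image_eqI[of _ _ "x + z"]) (auto simp: add.assoc)
  show int: "integrable vol (\<lambda>x. indicator S x * h (x + z))"
  proof (rule integrable_compact_support[OF _ _ cL])
    show "(\<lambda>x. indicator S x * h (x + z)) \<in> borel_measurable borel"
      using meas S by simp
    show "\<bar>indicator S x * h (x + z)\<bar> \<le> b" for x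
      using b[of "x + z"] by (cases "x \<in> S") auto
  qed (use supp' in auto)
  have "\<bar>\<integral>x. indicator S x * h (x + z) \<partial>vol\<bar> \<le> (\<integral>x. \<bar>indicator S x * h (x + z)\<bar> \<partial>vol)"
    by (rule integral_abs_bound)
  also have "\<dots> \<le> (\<integral>x. b * indicator L (x + z) \<partial>vol)"
  proof (rule integral_mono)
    show "integrable vol (\<lambda>x. \<bar>indicator S x * h (x + z)\<bar>)"
      using int by simp
    have "integrable vol (\<lambda>x. b * indicator ((\<lambda>y. y + - z) ` L) x)"
      using cL vol_compact[OF cL] by (intro integrable_mult_right integrable_real_indicator) auto
    moreover have "indicator ((\<lambda>y. y + - z) ` L) x = (indicator L (x + z) :: real)" for x
      by (auto simp: indicator_def image_iff add.assoc intro!: bexI[of _ "x + z"])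
    ultimately show "integrable vol (\<lambda>x. b * indicator L (x + z))"
      by simp
    show "\<bar>indicator S x * h (x + z)\<bar> \<le> b * indicator L (x + z)" for x
      using b[of "x + z"] supp[of "x + z"] by (cases "x \<in> S"; cases "x + z \<in> L") auto
  qed
  also have "\<dots> = (\<integral>x. b * indicator L x \<partial>vol)"
    using L by (intro integral_right_translate borel_measurable_times borel_measurable_indicator) auto
  also have "\<dots> = b * measure vol L"
    by simp
  finally show "\<bar>\<integral>x. indicator S x * h (x + z) \<partial>vol\<bar> \<le> b * measure vol L" .
qed

lemma window_integral_bound:
  fixes h :: "'g \<Rightarrow> real"
  assumes h: "h \<in> borel_measurable borel" and b: "\<And>x. \<bar>h x\<bar> \<le> b"
    and L: "compact L" and supp: "\<And>x. h x \<noteq> 0 \<Longrightarrow> x \<in> L"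
  shows "\<bar>(\<integral>x. indicator (D n) x * h (x + - z) \<partial>vol) - (\<integral>x. h x \<partial>vol) * indicator (D n) z\<bar>
    \<le> b * measure vol L * indicator (boundary (uminus ` L) n) z"
proof -
  have DS: "D n \<in> sets borel" "- D n \<in> sets borel"
    using compact_D[of n] compact_imp_closed by (auto intro!: borel_open)
  have "\<bar>h undefined\<bar> \<le> b"
    by (rule b)
  then have b0: "b \<ge> 0"
    by linarith
  have bd: "integrable vol (\<lambda>x. indicator S x * h (x + z))"
    "\<bar>\<integral>x. indicator S x * h (x + z) \<partial>vol\<bar> \<le> b * measure vol L" if "S \<in> sets borel" for S z
    by (rule integral_translate_bound[OF h b L]; use supp that in blast)+
  show ?thesis
  proof (cases "z \<in> D n")
    case True
    have "(\<integral>x. h x \<partial>vol) = (\<integral>x. h (x + - z) \<partial>vol)"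
      by (rule integral_right_translate[symmetric]) (rule h)
    also have "\<dots> = (\<integral>x. indicator (D n) x * h (x + - z) + indicator (- D n) x * h (x + - z) \<partial>vol)"
      by (intro Bochner_Integration.integral_cong) (auto simp: indicator_def)
    also have "\<dots> = (\<integral>x. indicator (D n) x * h (x + - z) \<partial>vol) + (\<integral>x. indicator (- D n) x * h (x + - z) \<partial>vol)"
      by (rule Bochner_Integration.integral_add) (rule bd(1); use DS in simp)+
    finally have eq: "(\<integral>x. indicator (D n) x * h (x + - z) \<partial>vol) - (\<integral>x. h x \<partial>vol) * indicator (D n) z
        = - (\<integral>x. indicator (- D n) x * h (x + - z) \<partial>vol)"
      using True by simp
    show ?thesis
    proof (cases "z \<in> boundary (uminus ` L) n")
      case True
      then show ?thesis
        unfolding eq using bd(2)[OF DS(2), of "- z"] by simp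
    next
      case False
      have "indicator (- D n) x * h (x + - z) = 0" for x
      proof (rule ccontr)
        assume "indicator (- D n) x * h (x + - z) \<noteq> 0"
        then have x: "x \<notin> D n" "x + - z \<in> L"
          using supp by (auto simp: indicator_def split: if_splits)
        have "z = - (x + - z) + x"
          by (simp add: minus_add add.assoc)
        then have "z \<in> uminus ` L + closure (- D n)"
          using x closure_subset[of "- D n"] by (metis ComplI image_eqI set_plus_intro subsetD)
        then show False
          using False \<open>z \<in> D n\<close> by (auto simp: van_hove_boundary_def)
      qed
      then have "(\<lambda>x. indicator (- D n) x * h (x + - z)) = (\<lambda>_. 0)"
        by (rule ext)
      then show ?thesis
        unfolding eq using b0 by simp
    qed
  next
    case zD: False
    show ?thesis
    proof (cases "z \<in> boundary (uminus ` L) n")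
      case True
      then show ?thesis
        using zD bd(2)[OF DS(1), of "- z"] by simp
    next
      case False
      have "indicator (D n) x * h (x + - z) = 0" for x
      proof (rule ccontr)
        assume "indicator (D n) x * h (x + - z) \<noteq> 0"
        then have x: "x \<in> D n" "x + - z \<in> L"
          using supp by (auto simp: indicator_def split: if_splits)
        have "z = - (x + - z) + x"
          by (simp add: minus_add add.assoc)
        then have "z \<in> uminus ` L + D n"
          using x by (metis image_eqI set_plus_intro)
        then show False
          using False zD interior_subset[of "D n"] by (auto simp: van_hove_boundary_def)
      qed
      then have "(\<lambda>x. indicator (D n) x * h (x + - z)) = (\<lambda>_. 0)"
        by (rule ext)
      then show ?thesis
        using zD b0 by simp
    qed
  qed
qed

lemma window_integral_count:
  fixes g :: "'m set \<Rightarrow> real"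
  assumes Q: "finite Q" and b: "\<And>A. \<bar>g A\<bar> \<le> b"
    and meas: "(\<lambda>x. g (act x ` Q)) \<in> borel_measurable borel"
    and L: "compact L" and supp: "\<And>x. g (act x ` Q) \<noteq> 0 \<Longrightarrow> x \<in> L"
  obtains C K where "compact K"
    "\<And>n P A. P \<in> point_sets r \<Longrightarrow> finite A \<Longrightarrow> A \<subseteq> P \<Longrightarrow>
      (\<And>Q' x. Q' \<subseteq> P \<Longrightarrow> x \<in> D n \<Longrightarrow> act x ` Q' = Q \<Longrightarrow> Q' \<subseteq> A) \<Longrightarrow>
      \<bar>(\<Sum>Q' | Q' \<subseteq> A \<and> equivalent_sets act Q' Q. window_integral g n Q')
        - (\<integral>x. g (act x ` Q) \<partial>vol) * real (card (copies Q n P))\<bar>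
      \<le> C * measure vol (boundary K n)"
proof -
  have cL: "compact (uminus ` L)"
    by (rule compact_uminus_image[OF L])
  obtain C K where CK: "C \<ge> 0" "compact K"
    "\<And>n P \<E>. P \<in> point_sets r \<Longrightarrow> finite \<E> \<Longrightarrow>
      (\<And>Q'. Q' \<in> \<E> \<Longrightarrow> Q' \<subseteq> P \<and> (\<exists>z\<in>boundary (uminus ` L) n. act z ` Q' = Q)) \<Longrightarrow>
      real (card \<E>) \<le> C * measure vol (boundary K n)"
    using card_boundary_copies[OF Q cL] by metis
  have "\<bar>g undefined\<bar> \<le> b"
    by (rule b)
  then have b0: "b \<ge> 0"
    by linarith
  have "\<bar>(\<Sum>Q' | Q' \<subseteq> A \<and> equivalent_sets act Q' Q. window_integral g n Q')
        - (\<integral>x. g (act x ` Q) \<partial>vol) * real (card (copies Q n P))\<bar>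
      \<le> (b * measure vol L * C) * measure vol (boundary K n)"
    if P: "P \<in> point_sets r" and A: "finite A" "A \<subseteq> P"
      and count: "\<And>Q' x. Q' \<subseteq> P \<Longrightarrow> x \<in> D n \<Longrightarrow> act x ` Q' = Q \<Longrightarrow> Q' \<subseteq> A" for n P A
  proof -
    define \<Q> where "\<Q> = {Q'. Q' \<subseteq> A \<and> equivalent_sets act Q' Q}"
    have fin: "finite \<Q>"
      using A(1) by (simp add: \<Q>_def)
    have "\<forall>Q'\<in>\<Q>. \<exists>z. act z ` Q' = Q \<and> ((\<exists>x\<in>D n. act x ` Q' = Q) \<longrightarrow> z \<in> D n)"
      by (auto simp: \<Q>_def equivalent_sets_def) metis
    then obtain z where z: "\<And>Q'. Q' \<in> \<Q> \<Longrightarrow> act (z Q') ` Q' = Q"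
      "\<And>Q'. Q' \<in> \<Q> \<Longrightarrow> (\<exists>x\<in>D n. act x ` Q' = Q) \<Longrightarrow> z Q' \<in> D n"
      by metis
    let ?c = "\<integral>x. g (act x ` Q) \<partial>vol"
    let ?B = "boundary (uminus ` L) n"
    let ?I = "\<lambda>Q'. window_integral g n Q'"
    have "copies Q n P = {Q' \<in> \<Q>. z Q' \<in> D n}"
    proof (intro equalityI subsetI)
      fix Q' assume "Q' \<in> copies Q n P"
      then obtain x where x: "Q' \<subseteq> P" "x \<in> D n" "act x ` Q' = Q"
        by blast
      have "Q' \<in> \<Q>"
        using count[OF x] x(3) unfolding \<Q>_def equivalent_sets_def by blast
      then show "Q' \<in> {Q' \<in> \<Q>. z Q' \<in> D n}"
        using z(2) x by blast
    next
      fix Q' assume "Q' \<in> {Q' \<in> \<Q>. z Q' \<in> D n}"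
      then have "Q' \<subseteq> P" "z Q' \<in> D n" "act (z Q') ` Q' = Q"
        using z(1) A(2) by (auto simp: \<Q>_def)
      then show "Q' \<in> copies Q n P"
        by blast
    qed
    then have card_eq: "real (card (copies Q n P)) = (\<Sum>Q'\<in>\<Q>. indicator (D n) (z Q'))"
      using fin by (simp add: indicator_def sum.If_cases Int_def)
    have item: "\<bar>?I Q' - ?c * indicator (D n) (z Q')\<bar> \<le> b * measure vol L * indicator ?B (z Q')" if "Q' \<in> \<Q>" for Q'
    proof -
      have "act x ` Q' = act (x + - z Q') ` Q" for x
        unfolding act_image_add z(1)[OF that, symmetric] act_image_minus ..
      then have "?I Q' = (\<integral>x. indicator (D n) x * g (act (x + - z Q') ` Q) \<partial>vol)"
        by simp
      moreover have "\<bar>(\<integral>x. indicator (D n) x * g (act (x + - z Q') ` Q) \<partial>vol) - ?c * indicator (D n) (z Q')\<bar>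
          \<le> b * measure vol L * indicator ?B (z Q')"
        by (rule window_integral_bound[OF meas b L]) (rule supp)
      ultimately show ?thesis
        by simp
    qed
    have "\<bar>(\<Sum>Q'\<in>\<Q>. ?I Q') - ?c * (\<Sum>Q'\<in>\<Q>. indicator (D n) (z Q'))\<bar> = \<bar>\<Sum>Q'\<in>\<Q>. ?I Q' - ?c * indicator (D n) (z Q')\<bar>"
      by (simp add: sum_subtractf sum_distrib_left)
    also have "\<dots> \<le> (\<Sum>Q'\<in>\<Q>. \<bar>?I Q' - ?c * indicator (D n) (z Q')\<bar>)"
      by (rule sum_abs)
    also have "\<dots> \<le> (\<Sum>Q'\<in>\<Q>. b * measure vol L * indicator ?B (z Q'))"
      by (intro sum_mono item)
    also have "\<dots> = b * measure vol L * real (card {Q' \<in> \<Q>. z Q' \<in> ?B})"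
      using fin by (simp add: sum_distrib_left[symmetric] indicator_def sum.If_cases Int_def)
    also have "\<dots> \<le> b * measure vol L * (C * measure vol (boundary K n))"
    proof (intro mult_left_mono CK(3)[OF P])
      show "finite {Q' \<in> \<Q>. z Q' \<in> ?B}"
        using fin by simp
      fix Q' assume "Q' \<in> {Q' \<in> \<Q>. z Q' \<in> ?B}"
      then show "Q' \<subseteq> P \<and> (\<exists>z\<in>?B. act z ` Q' = Q)"
        using z(1) A(2) by (auto simp: \<Q>_def)
    qed (use b0 in simp)
    finally show ?thesis
      unfolding card_eq \<Q>_def by (simp add: mult.assoc)
  qed
  then show thesis
    using that[OF CK(2)] by blast
qed

end

subsection \<open>Invariant measures on the orbit closure\<close>

lemma sigma_sets_trace:
  assumes "W \<in> sigma_sets \<Omega> \<A>" "X \<subseteq> \<Omega>"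
  shows "W \<inter> X \<in> sigma_sets X ((\<lambda>B. B \<inter> X) ` \<A>)"
  using assms(1)
proof (induction rule: sigma_sets.induct)
  case (Compl A)
  have "(\<Omega> - A) \<inter> X = X - A \<inter> X"
    using assms(2) by blast
  then show ?case
    using sigma_sets.Compl[OF Compl.IH] by simp
next
  case (Union A)
  have "(\<Union>i. A i) \<inter> X = (\<Union>i. A i \<inter> X)"
    by blast
  then show ?case
    using sigma_sets.Union[of "\<lambda>i. A i \<inter> X"] Union.IH by simp
qed (auto intro: sigma_sets.intros)

lemma cluster_filter:
  fixes f :: "nat \<Rightarrow> 'a \<Rightarrow> real"
  assumes "\<And>k a. f k a \<in> {0..1}"
  obtains G m where "G \<noteq> bot" "G \<le> sequentially" "\<And>a. ((\<lambda>k. f k a) \<longlongrightarrow> m a) G" "\<And>a. m a \<in> {0..1}"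
proof -
  let ?S = "Pi\<^sub>E UNIV (\<lambda>_::'a. {0..1::real})"
  have "compactin (product_topology (\<lambda>_. euclidean) UNIV) ?S"
    unfolding compactin_PiE by simp
  then have "compact ?S"
    by (simp add: euclidean_product_topology)
  moreover have "eventually (\<lambda>x. x \<in> ?S) (filtermap f sequentially)"
    using assms by (simp add: eventually_filtermap PiE_def Pi_def)
  moreover have "filtermap f sequentially \<noteq> bot"
    by (simp add: filtermap_bot_iff)
  ultimately obtain m where m: "m \<in> ?S" "inf (nhds m) (filtermap f sequentially) \<noteq> bot"
    unfolding compact_filter by blast
  define G where "G = inf sequentially (filtercomap f (nhds m))"
  have "G \<noteq> bot"
  proof
    assume "G = bot"
    then have "eventually (\<lambda>_. False) G"
      by simp
    then obtain A B where AB: "eventually A sequentially" "eventually B (filtercomap f (nhds m))" "\<And>k. A k \<Longrightarrow> B k \<Longrightarrow> False"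
      unfolding G_def eventually_inf by blast
    obtain R where R: "eventually R (nhds m)" "\<And>k. R (f k) \<Longrightarrow> B k"
      using AB(2) unfolding eventually_filtercomap by blast
    have "eventually (\<lambda>y. \<not> R y) (filtermap f sequentially)"
      unfolding eventually_filtermap using AB(1) by (rule eventually_mono) (use AB(3) R(2) in blast)
    then have "eventually (\<lambda>_. False) (inf (nhds m) (filtermap f sequentially))"
      unfolding eventually_inf using R(1) by blast
    then show False
      using m(2) by (simp add: trivial_limit_def)
  qed
  moreover have "G \<le> sequentially"
    by (simp add: G_def)
  moreover have "((\<lambda>k. f k a) \<longlongrightarrow> m a) G" for a
  proof -
    have "filterlim f (nhds m) G"
      unfolding filterlim_iff_le_filtercomap G_def by simp
    moreover have "open ((\<lambda>g::'a \<Rightarrow> real. g a) -` S)" if "open S" for S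
      by (rule open_vimage[OF that continuous_on_product_coordinates])
    ultimately have "eventually (\<lambda>k. f k \<in> (\<lambda>g. g a) -` S) G" if "open S" "m a \<in> S" for S
      using that by (intro topological_tendstoD) auto
    then show ?thesis
      by (intro topological_tendstoI) simp
  qed
  ultimately show thesis
    using that m(1) by blast
qed

locale orbit_system = haar_action act r vol D
  for act :: "'g::{topological_group_add, metric_space} \<Rightarrow>
      'm::{metric_space, second_countable_topology} \<Rightarrow> 'm"
    and r :: real and vol :: "'g measure" and D :: "nat \<Rightarrow> 'g set" +
  fixes \<P> :: "'m set set"
  assumes nonempty: "\<P> \<noteq> {}" and point_sets: "\<P> \<subseteq> point_sets r"
begin

definition orbits :: "'m set set" where
  "orbits = {act x ` P | x P. P \<in> \<P>}"

abbreviation X :: "'m set set" where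
  "X \<equiv> orbit_closure act r \<P>"

abbreviation XT :: "'m set topology" where
  "XT \<equiv> subtopology (vague_topology r) X"

abbreviation BX :: "'m set set set" where
  "BX \<equiv> sigma_sets X {U. openin XT U}"

lemma X_eq: "X = vague_topology r closure_of orbits"
  by (simp add: orbit_closure_def orbits_def)

lemma orbits_subset: "orbits \<subseteq> point_sets r"
  using point_sets by (auto simp: orbits_def)

lemma orbits_act:
  assumes "P \<in> orbits"
  shows "act x ` P \<in> orbits"
proof -
  obtain y P0 where "P = act y ` P0" "P0 \<in> \<P>"
    using assms unfolding orbits_def by blast
  then have "act x ` P = act (x + y) ` P0" "P0 \<in> \<P>"
    by (simp_all only: act_image_add)
  then show ?thesis
    unfolding orbits_def by blast
qed

lemma \<P>_subset_orbits: "P \<in> \<P> \<Longrightarrow> act x ` P \<in> orbits"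
  by (auto simp: orbits_def)

lemma X_subset: "X \<subseteq> point_sets r"
  unfolding X_eq using closure_of_subset_topspace[of "vague_topology r"] by simp

lemma orbits_subset_X: "orbits \<subseteq> X"
  unfolding X_eq using orbits_subset by (intro closure_of_subset) simp

lemma X_nonempty: "X \<noteq> {}"
  using nonempty \<P>_subset_orbits orbits_subset_X by blast

lemma topspace_XT [simp]: "topspace XT = X"
  using X_subset by auto

lemma closedin_X: "closedin (vague_topology r) X"
  unfolding X_eq by simp

lemma compact_space_XT: "compact_space XT"
  using closedin_compact_space[OF compact_space_vague[OF r_pos] closedin_X]
  by (simp add: compact_space_subtopology)

lemma X_act:
  assumes "P \<in> X"
  shows "act x ` P \<in> X"
proof -
  have "(`) (act x) ` X \<subseteq> vague_topology r closure_of ((`) (act x) ` orbits)"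
    unfolding X_eq by (rule continuous_map_image_closure_subset[OF continuous_map_vague_act])
  also have "\<dots> \<subseteq> X"
    unfolding X_eq using orbits_act by (intro closure_of_mono) auto
  finally show ?thesis
    using assms by blast
qed

lemma X_act_iff [simp]: "act x ` P \<in> X \<longleftrightarrow> P \<in> X"
  using X_act[of P x] X_act[of "act x ` P" "- x"] by auto

lemma image_act_eq: "A \<subseteq> X \<Longrightarrow> (`) (act x) ` A = {P \<in> X. act (- x) ` P \<in> A}"
  by (auto simp: image_iff) (metis act_image_minus' subsetD)

lemma continuous_map_XT_act: "continuous_map XT XT ((`) (act x))"
  by (rule continuous_map_into_subtopology[OF continuous_map_from_subtopology[OF continuous_map_vague_act]])
    (use topspace_XT in auto)

lemma openin_XT_act:
  assumes "openin XT U"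
  shows "openin XT ((`) (act x) ` U)"
proof -
  have "U \<subseteq> X"
    using openin_subset[OF assms] unfolding topspace_XT .
  then show ?thesis
    using openin_continuous_map_preimage[OF continuous_map_XT_act assms, of "- x"]
    unfolding topspace_XT by (simp only: image_act_eq)
qed

lemma closedin_XT_act:
  assumes "closedin XT U"
  shows "closedin XT ((`) (act x) ` U)"
proof -
  have "U \<subseteq> X"
    using closedin_subset[OF assms] unfolding topspace_XT .
  then show ?thesis
    using closedin_continuous_map_preimage[OF continuous_map_XT_act assms, of "- x"]
    unfolding topspace_XT by (simp only: image_act_eq)
qed

sublocale BX: sigma_algebra X BX
  by (rule sigma_algebra_sigma_sets) (use openin_subset topspace_XT in blast)

lemma BX_act:
  assumes "A \<in> BX"
  shows "(`) (act x) ` A \<in> BX"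
  using assms
proof (induction rule: sigma_sets.induct)
  case (Basic U)
  then show ?case
    using openin_XT_act by (intro sigma_sets.Basic) simp
next
  case (Compl A)
  have "A \<subseteq> X"
    using Compl.hyps BX.space_closed by blast
  then have "(`) (act x) ` (X - A) = X - (`) (act x) ` A"
    by (auto simp: image_act_eq)
  then show ?case
    using Compl.IH by (simp add: sigma_sets.Compl)
next
  case (Union A)
  then show ?case
    unfolding image_UN by (intro sigma_sets.Union)
qed (auto intro: sigma_sets.Empty)

lemma sets_orbit_closure_borel: "sets (orbit_closure_borel act r \<P>) = BX"
  unfolding orbit_closure_borel_def
  by (rule sets_measure_of) (use openin_subset topspace_XT in blast)

lemma space_orbit_closure_borel: "space (orbit_closure_borel act r \<P>) = X"
  unfolding orbit_closure_borel_def
  by (rule space_measure_of) (use openin_subset topspace_XT in blast)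

lemma BX_eq_hits: "BX = sigma_sets X ((\<lambda>B. B \<inter> X) ` hits_balls r)"
proof (rule sigma_sets_eqI)
  fix U assume "U \<in> {U. openin XT U}"
  then obtain W where W: "openin (vague_topology r) W" "U = W \<inter> X"
    unfolding mem_Collect_eq openin_subtopology by blast
  show "U \<in> sigma_sets X ((\<lambda>B. B \<inter> X) ` hits_balls r)"
    unfolding W(2) by (rule sigma_sets_trace[OF openin_vague_in_sigma[OF r_pos balls_compact W(1)] X_subset])
next
  fix U assume "U \<in> (\<lambda>B. B \<inter> X) ` hits_balls r"
  then obtain a t where U: "U = hits r (ball a t) \<inter> X"
    unfolding hits_balls_def by blast
  have "openin XT U"
    unfolding U by (rule openin_subtopology_Int[OF openin_hits_vague[OF r_pos balls_compact open_ball]])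
  then show "U \<in> sigma_sets X {U. openin XT U}"
    by (intro sigma_sets.Basic) simp
qed

lemma measurable_visits:
  assumes P: "P \<in> X" and A: "A \<in> BX"
  shows "{x. act x ` P \<in> A} \<in> sets borel"
  using A
proof (induction rule: sigma_sets.induct)
  case (Basic U)
  then obtain W where W: "openin (vague_topology r) W" "U = W \<inter> X"
    unfolding mem_Collect_eq openin_subtopology by blast
  have "{x. act x ` P \<in> U} = {x. act x ` P \<in> W}"
    using P by (auto simp: W(2))
  then show ?case
    using measurable_orbit_visits[OF subsetD[OF X_subset P] openin_vague_in_sigma[OF r_pos balls_compact W(1)]]
    by simp
next
  case (Compl A)
  have "{x. act x ` P \<in> X - A} = space borel - {x. act x ` P \<in> A}"
    using P by auto
  then show ?case
    using Compl.IH sets.compl_sets by metis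
next
  case (Union A)
  have "{x. act x ` P \<in> \<Union> (range A)} = (\<Union>i. {x. act x ` P \<in> A i})"
    by auto
  then show ?case
    using Union by auto
qed auto

definition visits :: "nat \<Rightarrow> 'm set \<Rightarrow> 'm set set \<Rightarrow> real" where
  "visits n P A = measure vol {x \<in> D n. act x ` P \<in> A} / measure vol (D n)"

lemma visit_set_borel:
  "P \<in> X \<Longrightarrow> A \<in> BX \<Longrightarrow> {x \<in> D n. act x ` P \<in> A} \<in> sets borel"
  using measurable_visits[of P A] compact_D[of n] by (auto simp: Collect_conj_eq)

lemma fmeasurable_compact: "compact K \<Longrightarrow> K \<in> fmeasurable vol"
  using vol_compact[of K] by (auto simp: fmeasurable_def)

lemma fmeasurable_subset_compact:
  "compact K \<Longrightarrow> A \<subseteq> K \<Longrightarrow> A \<in> sets borel \<Longrightarrow> A \<in> fmeasurable vol"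
  using fmeasurableI2[OF fmeasurable_compact] by auto

lemma visit_set_fmeasurable:
  "P \<in> X \<Longrightarrow> A \<in> BX \<Longrightarrow> {x \<in> D n. act x ` P \<in> A} \<in> fmeasurable vol"
  using visit_set_borel by (intro fmeasurable_subset_compact[OF compact_D]) auto

lemma visits_bounds: "visits n P A \<in> {0..1}"
proof (cases "{x \<in> D n. act x ` P \<in> A} \<in> sets vol")
  case True
  have "measure vol {x \<in> D n. act x ` P \<in> A} \<le> measure vol (D n)"
    using True fmeasurable_compact[OF compact_D] by (intro measure_mono_fmeasurable) auto
  then show ?thesis
    by (auto simp: visits_def divide_le_eq_1 zero_less_measure_iff order.strict_iff_order)
next
  case False
  then show ?thesis
    by (simp add: visits_def measure_notin_sets)
qed

lemma visits_additive:
  assumes "P \<in> X" "A \<in> BX" "B \<in> BX" "A \<inter> B = {}"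
  shows "visits n P (A \<union> B) = visits n P A + visits n P B"
proof -
  have "{x \<in> D n. act x ` P \<in> A \<union> B} = {x \<in> D n. act x ` P \<in> A} \<union> {x \<in> D n. act x ` P \<in> B}"
    by auto
  moreover have "measure vol \<dots> = measure vol {x \<in> D n. act x ` P \<in> A} + measure vol {x \<in> D n. act x ` P \<in> B}"
    using visit_set_fmeasurable[OF assms(1,2), of n] visit_set_fmeasurable[OF assms(1,3), of n] assms(4)
    by (intro measure_Union) (auto simp: fmeasurable_def)
  ultimately show ?thesis
    by (simp add: visits_def add_divide_distrib)
qed

lemma measure_diff_le:
  assumes "A \<in> fmeasurable M" "B \<in> fmeasurable M" "E \<in> fmeasurable M" "A - B \<subseteq> E" "B - A \<subseteq> E"
  shows "\<bar>measure M A - measure M B\<bar> \<le> measure M E"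
proof -
  have "measure M A \<le> measure M B + measure M E"
    if "A \<in> fmeasurable M" "B \<in> fmeasurable M" "A - B \<subseteq> E" for A B
  proof -
    have "measure M A \<le> measure M (B \<union> E)"
      using that assms(3) by (intro measure_mono_fmeasurable) auto
    also have "\<dots> \<le> measure M B + measure M E"
      using that assms(3) by (intro measure_Un_le) auto
    finally show ?thesis .
  qed
  from this[OF assms(1,2,4)] this[OF assms(2,1,5)] show ?thesis
    by simp
qed

lemma visits_invariance:
  assumes "P \<in> X" "A \<in> BX"
  shows "\<bar>visits n P ((`) (act x) ` A) - visits n P A\<bar>
    \<le> measure vol (boundary {- x} n) / measure vol (D n)"
proof -
  let ?E = "boundary {- x} n"
  let ?S = "{y \<in> D n. act y ` P \<in> (`) (act x) ` A}" and ?S1 = "{y \<in> (+) (- x) ` D n. act y ` P \<in> A}"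
    and ?S2 = "{y \<in> D n. act y ` P \<in> A}"
  have AX: "A \<subseteq> X"
    using assms(2) BX.space_closed by blast
  have cD: "compact ((+) (- x) ` D n)"
    by (rule compact_continuous_image[OF _ compact_D]) (auto intro!: continuous_intros)
  have S1: "?S1 \<in> fmeasurable vol"
    by (rule fmeasurable_subset_compact[OF cD])
      (use measurable_visits[OF assms] cD in \<open>auto simp: Collect_conj_eq\<close>)
  have "?S = (+) x ` ?S1"
  proof (intro equalityI subsetI)
    fix y assume y: "y \<in> ?S"
    then have "act (- x + y) ` P \<in> A"
      using AX unfolding act_image_add by (auto simp del: act_image_minus simp: image_act_eq)
    then have "- x + y \<in> ?S1"
      using y by simp
    then have "x + (- x + y) \<in> (+) x ` ?S1"
      by (rule imageI)
    then show "y \<in> (+) x ` ?S1"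
      by (simp add: add.assoc[symmetric])
  next
    fix y assume "y \<in> (+) x ` ?S1"
    then obtain d where d: "d \<in> D n" "y = x + (- x + d)" "act (- x + d) ` P \<in> A"
      by auto
    then have "act y ` P \<in> (`) (act x) ` A"
      unfolding d(2) act_image_add[of x] by (intro imageI)
    then show "y \<in> ?S"
      using d(1,2) by (simp add: add.assoc[symmetric])
  qed
  then have "measure vol ?S = measure vol ?S1"
    using vol_left[of ?S1 x] S1 by (simp add: measure_def fmeasurable_def)
  moreover have "\<bar>measure vol ?S1 - measure vol ?S2\<bar> \<le> measure vol ?E"
  proof (rule measure_diff_le[OF S1 visit_set_fmeasurable[OF assms]])
    show "?E \<in> fmeasurable vol"
      using van_hove_boundary_borel[of "{- x}" n] van_hove_boundary_finite[of "{- x}" n] by (simp add: fmeasurable_def)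
    show "?S1 - ?S2 \<subseteq> ?E"
      using interior_subset[of "D n"] by (auto simp: van_hove_boundary_def set_plus_def)
    show "?S2 - ?S1 \<subseteq> ?E"
    proof
      fix y assume y: "y \<in> ?S2 - ?S1"
      have "y = - x + (x + y)"
        by (simp add: add.assoc[symmetric])
      then have "x + y \<notin> D n"
        using y by (metis (mono_tags, lifting) DiffD1 DiffD2 image_eqI mem_Collect_eq)
      then have "x + y \<in> closure (- D n)"
        using closure_subset[of "- D n"] by blast
      moreover have "y = - x + (x + y)"
        by (simp add: add.assoc[symmetric])
      ultimately have "y \<in> {- x} + closure (- D n)"
        by (metis insertI1 set_plus_intro)
      then show "y \<in> ?E"
        using y by (simp add: van_hove_boundary_def)
    qed
  qed
  ultimately have "\<bar>measure vol ?S - measure vol ?S2\<bar> \<le> measure vol ?E"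
    by simp
  then show ?thesis
    by (simp add: visits_def diff_divide_distrib[symmetric] abs_divide divide_right_mono)
qed


lemma openin_hits_X: "open U \<Longrightarrow> openin XT (hits r U \<inter> X)"
  by (rule openin_subtopology_Int[OF openin_hits_vague[OF r_pos balls_compact]])

lemma compact_cball_M: "compact (cball (a::'m) t)"
  by (rule compact_of_closed_bounded[OF balls_compact]) auto

lemma closedin_hits_X:
  assumes "compact K"
  shows "closedin XT (hits r K \<inter> X)"
proof -
  have "openin XT (misses r K \<inter> X)"
    by (rule openin_subtopology_Int[OF openin_misses_vague[OF r_pos balls_compact assms]])
  moreover have "X - hits r K \<inter> X = misses r K \<inter> X"
    using X_subset by (auto simp: misses_eq)
  ultimately show ?thesis
    unfolding closedin_def topspace_XT by simp
qed

lemma hits_ball_mono: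
  shows "hits r (ball a t) \<inter> X \<subseteq> hits r (cball a t) \<inter> X"
    and "s < t \<Longrightarrow> hits r (cball a s) \<inter> X \<subseteq> hits r (ball a t) \<inter> X"
  by (fastforce simp: hits_def)+

lemma BX_eqI:
  assumes \<R>: "\<R> \<subseteq> BX" and hits: "\<And>a t. hits r (ball a t) \<inter> X \<in> sigma_sets X \<R>"
  shows "sigma_sets X \<R> = BX"
proof (rule antisym)
  show "sigma_sets X \<R> \<subseteq> BX"
    by (rule BX.sigma_sets_subset[OF \<R>])
  show "BX \<subseteq> sigma_sets X \<R>"
    unfolding BX_eq_hits
  proof (rule sigma_sets_mono, rule subsetI)
    fix B assume "B \<in> (\<lambda>B. B \<inter> X) ` hits_balls r"
    then obtain a t where "B = hits r (ball a t) \<inter> X"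
      unfolding hits_balls_def by blast
    then show "B \<in> sigma_sets X \<R>"
      by (simp only: hits)
  qed
qed

lemma BX_subset_of_hits_balls:
  assumes \<R>: "\<R> \<subseteq> BX" and countable: "\<And>a. countable {t. hits r (ball a t) \<inter> X \<notin> \<R>}"
  shows "sigma_sets X \<R> = BX"
proof (rule BX_eqI[OF \<R>])
  fix a t
    have "\<exists>s. t - 1 / Suc k < s \<and> s < t \<and> hits r (ball a s) \<inter> X \<in> \<R>" for k
    proof -
      have "uncountable {t - 1 / Suc k <..< t}"
        by (simp add: uncountable_open_interval)
      then have "\<not> {t - 1 / Suc k <..< t} \<subseteq> {t. hits r (ball a t) \<inter> X \<notin> \<R>}"
        using countable[of a] countable_subset by blast
      then show ?thesis
        by auto
    qed
    then obtain s where s: "\<And>k. t - 1 / Suc k < s k" "\<And>k. s k < t" "\<And>k. hits r (ball a (s k)) \<inter> X \<in> \<R>"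
      by metis
    have "ball a t = (\<Union>k. ball a (s k))"
    proof (intro equalityI subsetI)
      fix x assume "x \<in> ball a t"
      then obtain k where "1 / Suc k < t - dist a x"
        using reals_Archimedean[of "t - dist a x"] by (auto simp: inverse_eq_divide)
      then have "dist a x < s k"
        using s(1)[of k] by linarith
      then show "x \<in> (\<Union>k. ball a (s k))"
        by auto
    next
      fix x assume "x \<in> (\<Union>k. ball a (s k))"
      then obtain k where "dist a x < s k"
        by auto
      then show "x \<in> ball a t"
        using s(2)[of k] by simp
    qed
    then have eq: "hits r (ball a t) \<inter> X = (\<Union>k. hits r (ball a (s k)) \<inter> X)"
      by (simp add: hits_UN)
    show "hits r (ball a t) \<inter> X \<in> sigma_sets X \<R>"
      unfolding eq by (intro sigma_sets.Union sigma_sets.Basic s(3))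
qed

text \<open>The Krylov-Bogolyubov argument: the visit frequencies along a subnet converge to a finitely
  additive set function, whose restriction to the regular sets extends to an invariant measure.\<close>

lemma krylov_bogolyubov:
  fixes n :: "nat \<Rightarrow> nat" and P :: "nat \<Rightarrow> 'm set"
  assumes n: "filterlim n at_top sequentially" and P: "\<And>k. P k \<in> X"
  obtains \<mu> G m where "invariant_borel_prob act r \<P> \<mu>" "G \<noteq> bot" "G \<le> sequentially"
    "\<And>A. ((\<lambda>k. visits (n k) (P k) A) \<longlongrightarrow> m A) G"
    "\<And>H C. (\<And>t. openin XT (H t)) \<Longrightarrow> (\<And>t. closedin XT (C t)) \<Longrightarrow> (\<And>t. H t \<subseteq> C t) \<Longrightarrow>
      (\<And>s t. s < t \<Longrightarrow> C s \<subseteq> H t) \<Longrightarrow> countable {t::real. measure \<mu> (H t) \<noteq> m (H t)}"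
proof -
  obtain G m where G: "G \<noteq> bot" "G \<le> sequentially"
    and lim: "\<And>A. ((\<lambda>k. visits (n k) (P k) A) \<longlongrightarrow> m A) G" and m01: "\<And>A. m A \<in> {0..1}"
    using cluster_filter[of "\<lambda>k. visits (n k) (P k)"] visits_bounds by blast
  have unique: "a = b" if "(f \<longlongrightarrow> a) G" "(f \<longlongrightarrow> b) G" for f :: "nat \<Rightarrow> real" and a b
    using tendsto_unique[OF G(1) that] .
  have additive: "m (A \<union> B) = m A + m B" if "A \<in> BX" "B \<in> BX" "A \<inter> B = {}" for A B
    by (rule unique[OF lim]) (simp add: visits_additive[OF P that] tendsto_add lim)
  have total: "m X = 1"
  proof (rule unique[OF lim])
    have "eventually (\<lambda>k. measure vol (D (n k)) > 0) G"
    proof (rule filter_leD[OF G(2)])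
      show "eventually (\<lambda>k. measure vol (D (n k)) > 0) sequentially"
        using n measure_D_pos by (rule eventually_compose_filterlim[rotated])
    qed
    then have "eventually (\<lambda>k. visits (n k) (P k) X = 1) G"
      by eventually_elim (use P in \<open>simp add: visits_def\<close>)
    then show "((\<lambda>k. visits (n k) (P k) X) \<longlongrightarrow> 1) G"
      by (rule tendsto_eventually)
  qed
  have m_act: "m ((`) (act x) ` A) = m A" if A: "A \<in> BX" for x A
  proof -
    let ?d = "\<lambda>k. visits (n k) (P k) ((`) (act x) ` A) - visits (n k) (P k) A"
    have "((\<lambda>k. measure vol (boundary {- x} (n k)) / measure vol (D (n k))) \<longlongrightarrow> 0) sequentially"
      using filterlim_compose[OF van_hove_tendsto n, of "{- x}"] by simp
    then have "((\<lambda>k. measure vol (boundary {- x} (n k)) / measure vol (D (n k))) \<longlongrightarrow> 0) G"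
      by (rule tendsto_mono[OF G(2)])
    then have "(?d \<longlongrightarrow> 0) G"
      by (rule Lim_null_comparison[rotated]) (simp add: visits_invariance[OF P A])
    moreover have "(?d \<longlongrightarrow> m ((`) (act x) ` A) - m A) G"
      by (intro tendsto_diff lim)
    ultimately show ?thesis
      using unique by fastforce
  qed
  interpret M: finitely_additive_prob XT m
    by unfold_locales (use m01 additive total in \<open>auto simp only: topspace_XT atLeastAtMost_iff\<close>)
  define \<R> where "\<R> = M.regular_sets"
  have \<R>BX: "\<R> \<subseteq> BX"
    using M.regular_sets_Bor unfolding \<R>_def topspace_XT by blast
  have \<sigma>\<R>: "sigma_sets X \<R> = BX"
  proof (rule BX_subset_of_hits_balls[OF \<R>BX])
    fix a
    show "countable {t. hits r (ball a t) \<inter> X \<notin> \<R>}"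
      unfolding \<R>_def
      by (rule M.countable_irregular_parameters[of _ "\<lambda>t. hits r (cball a t) \<inter> X"])
        (rule openin_hits_X closedin_hits_X hits_ball_mono open_ball compact_cball_M | assumption)+
  qed
  interpret R: algebra X \<R>
    using M.algebra_regular_sets unfolding \<R>_def topspace_XT .
  obtain \<nu> where \<nu>: "\<And>A. A \<in> \<R> \<Longrightarrow> \<nu> A = ennreal (m A)" "measure_space X BX \<nu>"
    using M.regular_extension[OF compact_space_XT] \<sigma>\<R> unfolding \<R>_def topspace_XT by metis
  define \<mu> where "\<mu> = measure_of X BX \<nu>"
  have sets\<mu>: "sets \<mu> = BX" and space\<mu>: "space \<mu> = X"
    using BX.space_closed by (simp_all add: \<mu>_def)
  have em\<mu>: "emeasure \<mu> A = \<nu> A" if "A \<in> BX" for A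
    unfolding \<mu>_def using \<nu>(2) that BX.sigma_algebra_axioms
    by (intro emeasure_measure_of_sigma) (auto simp: measure_space_def)
  have em\<R>: "emeasure \<mu> A = ennreal (m A)" if "A \<in> \<R>" for A
    using em\<mu> \<nu>(1) \<R>BX that by auto
  have me\<R>: "measure \<mu> A = m A" if "A \<in> \<R>" for A
    using em\<R>[OF that] m01[of A] by (simp add: measure_def)
  have prob: "prob_space \<mu>"
    by (rule prob_spaceI) (simp add: space\<mu> em\<R>[OF R.top] total)
  have \<R>_act: "(`) (act x) ` A \<in> \<R>" if A: "A \<in> \<R>" for A x
    unfolding \<R>_def M.regular_sets_def
  proof (intro CollectI conjI allI impI)
    show "(`) (act x) ` A \<in> sigma_sets (topspace XT) {U. openin XT U}"
      unfolding topspace_XT using A \<R>BX by (intro BX_act) blast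
    fix e :: real assume "e > 0"
    then obtain K U where KU: "closedin XT K" "openin XT U" "K \<subseteq> A" "A \<subseteq> U" "m (U - K) < e"
      using M.regular_setsE A unfolding \<R>_def by blast
    have "inj ((`) (act x))"
      by (rule injI) (metis act_image_minus)
    then have "(`) (act x) ` U - (`) (act x) ` K = (`) (act x) ` (U - K)"
      by (simp add: image_set_diff)
    moreover have "U - K \<in> BX"
      using M.open_Bor[OF KU(2)] M.closed_Bor[OF KU(1)] unfolding topspace_XT by (rule BX.Diff)
    ultimately have "m ((`) (act x) ` U - (`) (act x) ` K) < e"
      using KU(5) by (simp add: m_act)
    then show "\<exists>K U. closedin XT K \<and> openin XT U \<and> K \<subseteq> (`) (act x) ` A \<and> (`) (act x) ` A \<subseteq> U \<and> m (U - K) < e"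
      using KU openin_XT_act closedin_XT_act image_mono by meson
  qed
  have invariant: "emeasure \<mu> ((`) (act x) ` B) = emeasure \<mu> B" if B: "B \<in> BX" for x B
  proof -
    have pre: "(`) (act (- x)) -` A \<inter> X = (`) (act x) ` A" if "A \<in> BX" for A
    proof -
      have "A \<subseteq> X"
        using that BX.space_closed by blast
      then show ?thesis
        by (auto simp: image_act_eq)
    qed
    have meas: "(`) (act (- x)) \<in> measurable \<mu> \<mu>"
      by (rule measurableI) (auto simp: space\<mu> sets\<mu> pre BX_act)
    have "distr \<mu> \<mu> ((`) (act (- x))) = \<mu>"
    proof (rule measure_eqI_generator_eq[of \<R> X _ _ "\<lambda>_. X"])
      show "Int_stable \<R>"
        by (rule R.Int_stable)
      fix A assume A: "A \<in> \<R>"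
      then have "emeasure (distr \<mu> \<mu> ((`) (act (- x)))) A = emeasure \<mu> ((`) (act x) ` A)"
        using \<R>BX meas by (subst emeasure_distr) (auto simp: space\<mu> sets\<mu> pre)
      also have "\<dots> = emeasure \<mu> A"
        using A \<R>BX by (simp add: em\<R> \<R>_act m_act subset_iff)
      finally show "emeasure (distr \<mu> \<mu> ((`) (act (- x)))) A = emeasure \<mu> A" .
    next
      show "emeasure (distr \<mu> \<mu> ((`) (act (- x)))) X \<noteq> \<infinity>"
        using prob_space.prob_space_distr[OF prob meas] finite_measure.emeasure_finite[OF prob_space.axioms(1)] by auto
    qed (use R.top R.space_closed \<sigma>\<R> sets\<mu> in auto)
    then have "emeasure \<mu> B = emeasure (distr \<mu> \<mu> ((`) (act (- x)))) B"
      by simp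
    also have "\<dots> = emeasure \<mu> ((`) (act x) ` B)"
      using B meas by (subst emeasure_distr) (auto simp: space\<mu> sets\<mu> pre)
    finally show ?thesis
      by simp
  qed
  have "invariant_borel_prob act r \<P> \<mu>"
    unfolding invariant_borel_prob_def using prob invariant by (simp add: sets\<mu> sets_orbit_closure_borel)
  moreover have "countable {t::real. measure \<mu> (H t) \<noteq> m (H t)}"
    if HC: "\<And>t. openin XT (H t)" "\<And>t. closedin XT (C t)" "\<And>t. H t \<subseteq> C t" "\<And>s t. s < t \<Longrightarrow> C s \<subseteq> H t" for H C
  proof (rule countable_subset)
    show "{t. measure \<mu> (H t) \<noteq> m (H t)} \<subseteq> {t. H t \<notin> \<R>}"
      using me\<R> by blast
    show "countable {t. H t \<notin> \<R>}"
      unfolding \<R>_def by (rule M.countable_irregular_parameters[OF HC])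
  qed
  ultimately show thesis
    using that[OF _ G lim] by blast
qed

end

subsection \<open>Frequencies and finite local complexity\<close>

context orbit_system
begin

definition frequency :: "'m set \<Rightarrow> nat \<Rightarrow> 'm set \<Rightarrow> real" where
  "frequency Q n P = real (card (copies Q n P)) / measure vol (D n)"

lemma pattern_frequency_eq: "pattern_frequency act vol D Q n y P = frequency Q n (act y ` P)"
proof -
  have "bij_betw ((`) (act y)) {Q'. Q' \<subseteq> P \<and> (\<exists>x\<in>(\<lambda>a. a + y) ` D n. act x ` Q' = Q)}
    {Q'. Q' \<subseteq> act y ` P \<and> (\<exists>x\<in>D n. act x ` Q' = Q)}"
  proof (rule bij_betwI[where g = "(`) (act (- y))"])
    show "(`) (act y) \<in> {Q'. Q' \<subseteq> P \<and> (\<exists>x\<in>(\<lambda>a. a + y) ` D n. act x ` Q' = Q)} \<rightarrow>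
      {Q'. Q' \<subseteq> act y ` P \<and> (\<exists>x\<in>D n. act x ` Q' = Q)}"
    proof
      fix Q' assume "Q' \<in> {Q'. Q' \<subseteq> P \<and> (\<exists>x\<in>(\<lambda>a. a + y) ` D n. act x ` Q' = Q)}"
      then obtain a where "Q' \<subseteq> P" "a \<in> D n" "act (a + y) ` Q' = Q"
        by blast
      then show "act y ` Q' \<in> {Q'. Q' \<subseteq> act y ` P \<and> (\<exists>x\<in>D n. act x ` Q' = Q)}"
        unfolding act_image_add by (auto intro: image_mono)
    qed
    show "(`) (act (- y)) \<in> {Q'. Q' \<subseteq> act y ` P \<and> (\<exists>x\<in>D n. act x ` Q' = Q)} \<rightarrow>
      {Q'. Q' \<subseteq> P \<and> (\<exists>x\<in>(\<lambda>a. a + y) ` D n. act x ` Q' = Q)}"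
    proof
      fix Q' assume "Q' \<in> {Q'. Q' \<subseteq> act y ` P \<and> (\<exists>x\<in>D n. act x ` Q' = Q)}"
      then obtain a where a: "Q' \<subseteq> act y ` P" "a \<in> D n" "act a ` Q' = Q"
        by blast
      have "act (- y) ` Q' \<subseteq> P"
        using image_mono[OF a(1), of "act (- y)"] by simp
      moreover have "act (a + y) ` act (- y) ` Q' = Q"
        using a(3) by (simp only: act_image_add act_image_minus')
      ultimately show "act (- y) ` Q' \<in> {Q'. Q' \<subseteq> P \<and> (\<exists>x\<in>(\<lambda>a. a + y) ` D n. act x ` Q' = Q)}"
        using a(2) by blast
    qed
  qed simp_all
  then show ?thesis
    unfolding pattern_frequency_def frequency_def by (simp only: bij_betw_same_card)
qed

lemma uniform_pattern_frequencies_iff: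
  "uniform_pattern_frequencies act vol D \<P> \<longleftrightarrow>
    (\<forall>Q. (\<exists>P\<in>\<P>. pattern_of P Q) \<longrightarrow> (\<exists>\<nu>. uniform_limit orbits (frequency Q) (\<lambda>_. \<nu>) sequentially))"
proof -
  have "(\<forall>z\<in>UNIV \<times> \<P>. dist (case z of (y, P) \<Rightarrow> frequency Q n (act y ` P)) \<nu> < e) \<longleftrightarrow>
    (\<forall>P\<in>orbits. dist (frequency Q n P) \<nu> < e)" for Q n \<nu> e
    unfolding orbits_def by auto
  then show ?thesis
    unfolding uniform_pattern_frequencies_def uniform_limit_iff pattern_frequency_eq by simp
qed

lemma equivalent_sets_refl: "equivalent_sets act A A"
  unfolding equivalent_sets_def by (rule exI[of _ 0]) simp

lemma equivalent_sets_sym: "equivalent_sets act A B \<Longrightarrow> equivalent_sets act B A"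
  unfolding equivalent_sets_def by (metis act_image_minus)

lemma equivalent_sets_trans: "equivalent_sets act A B \<Longrightarrow> equivalent_sets act B C \<Longrightarrow> equivalent_sets act A C"
  unfolding equivalent_sets_def by (metis act_image_add)

lemma equivalent_sets_act: "equivalent_sets act (act x ` A) A"
  unfolding equivalent_sets_def by (rule exI[of _ "- x"]) simp

lemma card_equivalent_sets: "equivalent_sets act A B \<Longrightarrow> card A = card B"
  unfolding equivalent_sets_def using card_image[OF inj_act] by metis

lemma interior_act_image: "interior (act x ` V) = act x ` interior V"
proof -
  have le: "act x ` interior V \<subseteq> interior (act x ` V)" for x V
    by (intro interior_maximal image_mono interior_subset open_act_image open_interior)
  have "act x ` act (- x) ` interior (act x ` V) \<subseteq> act x ` interior (act (- x) ` act x ` V)"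
    by (intro image_mono le)
  then show ?thesis
    using le[of x V] by simp
qed

lemma flc_window:
  assumes flc: "finite_local_complexity act \<P>" and V: "compact V"
  obtains F where "finite F" "\<And>Q. Q \<in> F \<Longrightarrow> \<exists>P\<in>\<P>. pattern_of P Q"
    "\<And>P. P \<in> orbits \<Longrightarrow> \<exists>Q\<in>F. equivalent_sets act (P \<inter> interior V) Q"
proof -
  obtain F where F: "finite F" "\<forall>Q'\<in>F. \<exists>P\<in>\<P>. pattern_of P Q'"
    "\<forall>P\<in>\<P>. \<forall>Q. pattern_of P Q \<longrightarrow> (\<exists>V'. is_support P Q V' \<and> equivalent_sets act V' V) \<longrightarrow>
            (\<exists>Q'\<in>F. equivalent_sets act Q Q')"
    using flc[unfolded finite_local_complexity_def, THEN spec, THEN mp, OF V]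
    by (elim exE conjE) (rule that)
  have "\<exists>Q\<in>F. equivalent_sets act (P \<inter> interior V) Q" if "P \<in> orbits" for P
  proof -
    obtain x P0 where P: "P = act x ` P0" "P0 \<in> \<P>"
      using \<open>P \<in> orbits\<close> unfolding orbits_def by blast
    define Q where "Q = P0 \<inter> interior (act (- x) ` V)"
    have Q: "P \<inter> interior V = act x ` Q"
      unfolding Q_def P interior_act_image by (simp add: image_Int[OF inj_act])
    have P0: "P0 \<in> point_sets r"
      using P(2) point_sets by blast
    have cV: "compact (act (- x) ` V)"
      by (rule compact_act_image[OF V])
    have "Q \<subseteq> P0 \<inter> act (- x) ` V"
      unfolding Q_def using interior_subset by blast
    then have "finite Q"
      using finite_point_set_Int_compact[OF P0 r_pos cV] finite_subset by blast
    then have "pattern_of P0 Q"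
      unfolding pattern_of_def Q_def by blast
    moreover have "is_support P0 Q (act (- x) ` V)"
      unfolding is_support_def Q_def using cV by blast
    ultimately obtain Q' where "Q' \<in> F" "equivalent_sets act Q Q'"
      using F(3) P(2) equivalent_sets_act by blast
    then show ?thesis
      unfolding Q using equivalent_sets_act equivalent_sets_trans by blast
  qed
  then show thesis
    using that F(1,2) by blast
qed

definition close_sets :: "real \<Rightarrow> 'm set \<Rightarrow> 'm set \<Rightarrow> bool" where
  "close_sets e A B \<longleftrightarrow> (\<forall>a\<in>A. \<exists>b\<in>B. dist a b < e) \<and> (\<forall>b\<in>B. \<exists>a\<in>A. dist a b < e)"

lemma close_sets_mono: "close_sets d A B \<Longrightarrow> d \<le> e \<Longrightarrow> close_sets e A B"
  unfolding close_sets_def by (meson less_le_trans)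

lemma eq_of_close_sets:
  assumes "finite A" "finite B" "\<And>e. e > 0 \<Longrightarrow> close_sets e A B"
  shows "A = B"
proof -
  have "x \<in> B" if B: "finite B" and e: "\<And>e. e > 0 \<Longrightarrow> \<exists>b\<in>B. dist x b < e" for x and B :: "'m set"
  proof (rule ccontr)
    assume "x \<notin> B"
    then obtain e where "e > 0" "ball x e \<subseteq> - B"
      using finite_imp_closed[OF B] by (metis ComplI open_Compl open_contains_ball)
    then show False
      using e by (metis ComplD mem_ball subsetD)
  qed
  then show ?thesis
    using assms unfolding close_sets_def by (metis dist_commute subset_antisym subset_iff)
qed

lemma equivalent_of_close_orbit:
  assumes A: "finite A" and B: "finite B" "B \<noteq> {}"
    and close: "\<And>e. e > 0 \<Longrightarrow> \<exists>y. close_sets e (act y ` A) B"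
  shows "equivalent_sets act A B"
proof -
  have "\<forall>k. \<exists>y. close_sets (1 / Suc k) (act y ` A) B"
    using close by simp
  then obtain y where y: "\<And>k. close_sets (1 / Suc k) (act (y k) ` A) B"
    by metis
  obtain b where b: "b \<in> B"
    using B(2) by blast
  have "y k \<in> {x. \<exists>m\<in>A. act x m \<in> cball b 1}" for k
  proof -
    obtain a where "a \<in> A" "dist (act (y k) a) b < 1 / Suc k"
      using y[of k] b unfolding close_sets_def by blast
    moreover have "1 / real (Suc k) \<le> 1"
      by simp
    ultimately have "a \<in> A" "dist b (act (y k) a) \<le> 1"
      by (simp_all only: dist_commute)
    then show ?thesis
      by auto
  qed
  then have mem: "\<forall>k. y k \<in> {x. \<exists>m\<in>A. act x m \<in> cball b 1}"
    by (rule allI)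
  have "compact {x. \<exists>m\<in>A. act x m \<in> cball b 1}"
    by (rule compact_return_set[OF finite_imp_compact[OF A] compact_cball_M])
  then obtain z s where s: "strict_mono (s :: nat \<Rightarrow> nat)" "(y \<circ> s) \<longlonglongrightarrow> z"
    by (rule seq_compactE[OF compact_imp_seq_compact, OF _ mem])
  have "close_sets e (act z ` A) B" if e: "e > 0" for e
  proof -
    have "eventually (\<lambda>k. dist (act (y (s k)) a) (act z a) < e/2) sequentially" for a
    proof -
      have "continuous_on UNIV (\<lambda>x. act x a)"
        by (intro continuous_intros)
      then have "(\<lambda>k. act ((y \<circ> s) k) a) \<longlonglongrightarrow> act z a"
        using continuous_on_tendsto_compose[of UNIV "\<lambda>x. act x a" "y \<circ> s" z sequentially] s(2) by simp
      then show ?thesis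
        using e by (auto dest: tendstoD[of _ _ _ "e/2"])
    qed
    then have "eventually (\<lambda>k. \<forall>a\<in>A. dist (act (y (s k)) a) (act z a) < e/2) sequentially"
      using A by (simp add: eventually_ball_finite)
    moreover have "eventually (\<lambda>k. 1 / real (Suc (s k)) < e/2) sequentially"
    proof -
      have "(\<lambda>k. 1 / real (Suc k)) \<longlonglongrightarrow> 0"
        using LIMSEQ_inverse_real_of_nat by (simp add: inverse_eq_divide)
      then have "((\<lambda>k. 1 / real (Suc k)) \<circ> s) \<longlonglongrightarrow> 0"
        by (rule LIMSEQ_subseq_LIMSEQ[OF _ s(1)])
      then have "eventually (\<lambda>k. ((\<lambda>k. 1 / real (Suc k)) \<circ> s) k < e/2) sequentially"
        by (rule order_tendstoD(2)) (use e in simp)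
      then show ?thesis
        by (simp only: o_def)
    qed
    ultimately have "\<exists>k. (\<forall>a\<in>A. dist (act (y (s k)) a) (act z a) < e/2) \<and> 1 / real (Suc (s k)) < e/2"
      by (intro eventually_happens'[OF sequentially_bot] eventually_conj)
    then obtain k where k: "\<And>a. a \<in> A \<Longrightarrow> dist (act (y (s k)) a) (act z a) < e/2" "1 / real (Suc (s k)) < e/2"
      by blast
    have cl: "close_sets (e/2) (act (y (s k)) ` A) B"
      using close_sets_mono[OF y] k(2) by simp
    have tri: "dist (act z a) b < e" if "a \<in> A" "dist (act (y (s k)) a) b < e/2" for a b
      using k(1)[OF that(1)] that(2) dist_triangle_half_r[of "act (y (s k)) a" "act z a" e b] by simp
    show ?thesis
      unfolding close_sets_def
    proof (intro conjI ballI)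
      fix a' assume "a' \<in> act z ` A"
      then obtain a where a: "a \<in> A" "a' = act z a"
        by blast
      then obtain b where "b \<in> B" "dist (act (y (s k)) a) b < e/2"
        using cl unfolding close_sets_def by blast
      then show "\<exists>b\<in>B. dist a' b < e"
        using tri[OF a(1)] a(2) by blast
    next
      fix b assume "b \<in> B"
      then obtain a where "a \<in> A" "dist (act (y (s k)) a) b < e/2"
        using cl unfolding close_sets_def by blast
      then show "\<exists>a\<in>act z ` A. dist a b < e"
        using tri by blast
    qed
  qed
  then have "act z ` A = B"
    by (rule eq_of_close_sets[OF finite_imageI[OF A] B(1)])
  then show ?thesis
    unfolding equivalent_sets_def by blast
qed

lemma close_copy_equivalent:
  assumes flc: "finite_local_complexity act \<P>" and Q: "finite Q" "Q \<noteq> {}"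
  obtains \<epsilon> where "\<epsilon> > 0" "\<epsilon> \<le> r/2"
    "\<And>P \<delta>. P \<in> orbits \<Longrightarrow> \<delta> \<le> \<epsilon> \<Longrightarrow> (\<And>q. q \<in> Q \<Longrightarrow> P \<inter> ball q \<delta> \<noteq> {}) \<Longrightarrow>
      equivalent_sets act (P \<inter> (\<Union>q\<in>Q. ball q \<delta>)) Q"
proof -
  define V where "V = closure (\<Union>q\<in>Q. ball q (r/2))"
  have V: "compact V"
    unfolding V_def using Q(1) by (intro compact_of_closed_bounded[OF balls_compact]) auto
  have V_sub: "V \<subseteq> (\<Union>q\<in>Q. cball q (r/2))"
    unfolding V_def using Q(1) by (intro closure_minimal) auto
  have V_sup: "(\<Union>q\<in>Q. ball q (r/2)) \<subseteq> interior V"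
    unfolding V_def by (intro interior_maximal closure_subset) auto
  obtain F where F: "finite F" "\<And>Q. Q \<in> F \<Longrightarrow> \<exists>P\<in>\<P>. pattern_of P Q"
    "\<And>P. P \<in> orbits \<Longrightarrow> \<exists>Q\<in>F. equivalent_sets act (P \<inter> interior V) Q"
    using flc_window[OF flc V] by metis
  have "\<forall>R\<in>F. \<exists>e>0. \<not> equivalent_sets act R Q \<longrightarrow> (\<forall>y. \<not> close_sets e (act y ` R) Q)"
  proof
    fix R assume "R \<in> F"
    then have "finite R"
      using F(2) by (auto simp: pattern_of_def)
    then show "\<exists>e>0. \<not> equivalent_sets act R Q \<longrightarrow> (\<forall>y. \<not> close_sets e (act y ` R) Q)"
      using equivalent_of_close_orbit[of R Q] Q by (meson zero_less_one)
  qed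
  then obtain e where e: "\<And>R. R \<in> F \<Longrightarrow> e R > 0"
    "\<And>R y. R \<in> F \<Longrightarrow> \<not> equivalent_sets act R Q \<Longrightarrow> \<not> close_sets (e R) (act y ` R) Q"
    by metis
  define \<epsilon> where "\<epsilon> = Min (insert (r/2) (e ` F))"
  have \<epsilon>: "\<epsilon> > 0"
    unfolding \<epsilon>_def using F(1) e(1) r_pos by simp
  have \<epsilon>_le: "\<epsilon> \<le> r/2" "\<And>R. R \<in> F \<Longrightarrow> \<epsilon> \<le> e R"
    unfolding \<epsilon>_def by (rule Min_le; use F(1) in simp)+
  have "equivalent_sets act (P \<inter> (\<Union>q\<in>Q. ball q \<delta>)) Q"
    if P: "P \<in> orbits" and \<delta>: "\<delta> \<le> \<epsilon>" and hit: "\<And>q. q \<in> Q \<Longrightarrow> P \<inter> ball q \<delta> \<noteq> {}" for P \<delta>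
  proof -
    have PS: "P \<in> point_sets r"
      using P orbits_subset by blast
    have eq: "P \<inter> (\<Union>q\<in>Q. ball q \<delta>) = P \<inter> interior V"
    proof (intro equalityI subsetI)
      fix p assume "p \<in> P \<inter> (\<Union>q\<in>Q. ball q \<delta>)"
      then obtain q where "p \<in> P" "q \<in> Q" "p \<in> ball q (r/2)"
        using \<delta> \<epsilon>_le(1) by auto
      then show "p \<in> P \<inter> interior V"
        using V_sup by blast
    next
      fix p assume p: "p \<in> P \<inter> interior V"
      then have "p \<in> V"
        using interior_subset by blast
      then obtain q where q: "q \<in> Q" "dist q p \<le> r/2"
        using V_sub by auto
      obtain p' where p': "p' \<in> P" "dist q p' < \<delta>"
        using hit[OF q(1)] by auto
      have "p = p'"
        using point_setsD[OF PS, of p p' q] p p' q \<delta> \<epsilon>_le(1) r_pos by auto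
      then show "p \<in> P \<inter> (\<Union>q\<in>Q. ball q \<delta>)"
        using p' q(1) by auto
    qed
    obtain R where R: "R \<in> F" "equivalent_sets act (P \<inter> interior V) R"
      using F(3)[OF P] by blast
    obtain y where y: "act y ` R = P \<inter> (\<Union>q\<in>Q. ball q \<delta>)"
      using equivalent_sets_sym[OF R(2)] unfolding eq equivalent_sets_def by blast
    have "close_sets \<delta> (P \<inter> (\<Union>q\<in>Q. ball q \<delta>)) Q"
      unfolding close_sets_def
    proof (intro conjI ballI)
      fix a assume "a \<in> P \<inter> (\<Union>q\<in>Q. ball q \<delta>)"
      then show "\<exists>b\<in>Q. dist a b < \<delta>"
        by (auto simp: dist_commute)
    next
      fix b assume b: "b \<in> Q"
      obtain p where "p \<in> P" "dist b p < \<delta>"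
        using hit[OF b] by auto
      then show "\<exists>a\<in>P \<inter> (\<Union>q\<in>Q. ball q \<delta>). dist a b < \<delta>"
        using b by (intro bexI[of _ p]) (auto simp: dist_commute)
    qed
    then have "close_sets (e R) (act y ` R) Q"
      unfolding y using close_sets_mono \<delta> \<epsilon>_le(2)[OF R(1)] by (meson order_trans)
    then have "equivalent_sets act R Q"
      using e(2)[OF R(1)] by blast
    then show ?thesis
      unfolding eq using R(2) equivalent_sets_trans by blast
  qed
  then show thesis
    using that[OF \<epsilon> \<epsilon>_le(1)] by blast
qed


lemma frequency_empty: "uniform_limit orbits (frequency {}) (\<lambda>_. 0) sequentially"
proof -
  have "{Q'. Q' \<subseteq> P \<and> (\<exists>x\<in>D n. act x ` Q' = {})} = {{}}" for P n
    using D_nonempty[of n] by auto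
  then have eq: "frequency {} n P = 1 / measure vol (D n)" for n P
    by (simp add: frequency_def)
  have "(\<lambda>n. 1 / measure vol (D n)) \<longlonglongrightarrow> 0"
    by (rule tendsto_divide_0[OF tendsto_const filterlim_at_top_imp_at_infinity[OF measure_D_at_top]])
  then show ?thesis
    unfolding uniform_limit_iff eq by (auto dest: tendstoD elim!: eventually_mono)
qed

definition local_window :: "'m set \<Rightarrow> nat \<Rightarrow> 'm set \<Rightarrow> 'm set" where
  "local_window K n P = P \<inter> (\<lambda>(x, m). act x m) ` (uminus ` D n \<times> K)"

lemma local_window_subset: "local_window K n P \<subseteq> P"
  by (simp add: local_window_def)

lemma finite_local_window:
  assumes "P \<in> point_sets r" "compact K"
  shows "finite (local_window K n P)"
  unfolding local_window_def
  by (intro finite_point_set_Int_compact[OF assms(1) r_pos] compact_act_plus compact_uminus_image compact_D assms(2))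

lemma local_windowI:
  assumes "p \<in> P" "x \<in> D n" "act x p \<in> K"
  shows "p \<in> local_window K n P"
proof -
  have "act (- x) (act x p) \<in> (\<lambda>(x, m). act x m) ` (uminus ` D n \<times> K)"
    using assms(2,3) by (intro rev_image_eqI[of "(- x, act x p)"]) auto
  then show ?thesis
    using assms(1) by (simp add: local_window_def)
qed

lemma close_copies_measurable:
  assumes "finite Q"
  shows "open {x. \<forall>q\<in>Q. act x ` A \<inter> ball q \<delta> \<noteq> {}}"
proof -
  have "{x. \<forall>q\<in>Q. act x ` A \<inter> ball q \<delta> \<noteq> {}} = (\<Inter>q\<in>Q. \<Union>a\<in>A. (\<lambda>x. act x a) -` ball q \<delta>)"
    by auto
  moreover have "open ((\<lambda>x. act x a) -` ball q \<delta>)" for a q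
    by (intro open_vimage) (auto intro!: continuous_intros)
  ultimately show ?thesis
    using assms by (simp only:) (intro open_INT ballI open_UN)
qed

definition near_copies :: "'m set \<Rightarrow> real \<Rightarrow> 'm set set" where
  "near_copies Q \<delta> = {P. \<forall>q\<in>Q. P \<inter> ball q \<delta> \<noteq> {}}"

lemma near_copies_X:
  assumes "finite Q" "Q \<noteq> {}"
  shows "near_copies Q \<delta> \<inter> X = (\<Inter>q\<in>Q. hits r (ball q \<delta>) \<inter> X)"
  using X_subset assms(2) by (auto simp: near_copies_def hits_def)

lemma openin_near_copies:
  assumes "finite Q" "Q \<noteq> {}"
  shows "openin XT (near_copies Q \<delta> \<inter> X)"
  unfolding near_copies_X[OF assms] using assms by (intro openin_INT2 openin_hits_X) auto

lemma near_copies_visits: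
  assumes flc: "finite_local_complexity act \<P>" and Q: "finite Q" "Q \<noteq> {}"
  obtains \<epsilon> c where "\<epsilon> > 0" "\<And>\<delta>. 0 < \<delta> \<Longrightarrow> c \<delta> > 0"
    "\<And>\<delta>. 0 < \<delta> \<Longrightarrow> \<delta> \<le> \<epsilon> \<Longrightarrow>
      uniform_limit orbits (\<lambda>n P. visits n P (near_copies Q \<delta> \<inter> X) - c \<delta> * frequency Q n P) (\<lambda>_. 0) sequentially"
proof -
  obtain \<epsilon> where \<epsilon>: "\<epsilon> > 0" "\<epsilon> \<le> r/2"
    and copy: "\<And>P \<delta>. P \<in> orbits \<Longrightarrow> \<delta> \<le> \<epsilon> \<Longrightarrow> (\<And>q. q \<in> Q \<Longrightarrow> P \<inter> ball q \<delta> \<noteq> {}) \<Longrightarrow>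
      equivalent_sets act (P \<inter> (\<Union>q\<in>Q. ball q \<delta>)) Q"
    using close_copy_equivalent[OF flc Q] by metis
  define g :: "real \<Rightarrow> 'm set \<Rightarrow> real" where "g \<delta> A = indicator (near_copies Q \<delta>) A" for \<delta> A
  have g_eq: "g \<delta> (act x ` A) = indicator {x. \<forall>q\<in>Q. act x ` A \<inter> ball q \<delta> \<noteq> {}} x" for x A \<delta>
    by (simp add: g_def near_copies_def indicator_def)
  have g_meas: "(\<lambda>x. g \<delta> (act x ` A)) \<in> borel_measurable borel" for A \<delta>
    unfolding g_eq using close_copies_measurable[OF Q(1)] by (intro borel_measurable_indicator) auto
  have g_bound: "\<bar>g \<delta> A\<bar> \<le> 1" for A \<delta>
    by (simp add: g_def indicator_def)
  obtain q0 where q0: "q0 \<in> Q"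
    using Q(2) by blast
  define L where "L \<delta> A = {x. \<exists>m\<in>A. act x m \<in> cball q0 \<delta>}" for \<delta> A
  have L: "compact (L \<delta> A)" if "finite A" for A \<delta>
    unfolding L_def by (intro compact_return_set finite_imp_compact that compact_cball_M)
  have supp: "x \<in> L \<delta> A" if "g \<delta> (act x ` A) \<noteq> 0" for x A \<delta>
    using that q0 unfolding g_eq L_def by (fastforce simp: indicator_def split: if_splits)
  have int': "integrable vol (\<lambda>x. indicator (D n) x * g \<delta> (act x ` A))" if "finite A" for A \<delta> n
  proof (rule integrable_compact_support[OF _ _ L[OF that]])
    show "(\<lambda>x. indicator (D n) x * g \<delta> (act x ` A)) \<in> borel_measurable borel"
      using g_meas compact_D by (intro borel_measurable_times borel_measurable_indicator) auto
    show "\<bar>indicator (D n) x * g \<delta> (act x ` A)\<bar> \<le> 1" for x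
      using g_bound by (simp add: indicator_def)
    show "x \<in> L \<delta> A" if "indicator (D n) x * g \<delta> (act x ` A) \<noteq> 0" for x
      using supp that by auto
  qed
  define c where "c \<delta> = (\<integral>x. g \<delta> (act x ` Q) \<partial>vol)" for \<delta>
  have "c \<delta> > 0" if \<delta>: "\<delta> > 0" for \<delta>
  proof -
    let ?S = "{x. \<forall>q\<in>Q. act x ` Q \<inter> ball q \<delta> \<noteq> {}}"
    have S: "open ?S" "0 \<in> ?S"
      using close_copies_measurable[OF Q(1)] \<delta> by auto
    have "emeasure vol ?S \<le> emeasure vol (L \<delta> Q)"
      using L[OF Q(1)] S(1) q0 by (intro emeasure_mono) (auto simp: L_def, force)
    then have "emeasure vol ?S \<noteq> \<infinity>"
      using vol_compact[OF L[OF Q(1)], of \<delta>] by (auto simp: top_unique)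
    moreover have "emeasure vol ?S > 0"
      by (rule vol_open_pos[OF S(1)]) (use S(2) in blast)
    moreover have "c \<delta> = measure vol ?S"
      unfolding c_def g_eq by simp
    ultimately show ?thesis
      by (simp add: measure_def enn2real_positive_iff less_top)
  qed
  moreover have "uniform_limit orbits (\<lambda>n P. visits n P (near_copies Q \<delta> \<inter> X) - c \<delta> * frequency Q n P) (\<lambda>_. 0) sequentially"
    if \<delta>: "0 < \<delta>" "\<delta> \<le> \<epsilon>" for \<delta>
  proof -
    obtain C K where K: "compact K" and bound: "\<And>n P A. P \<in> point_sets r \<Longrightarrow> finite A \<Longrightarrow> A \<subseteq> P \<Longrightarrow>
      (\<And>Q' x. Q' \<subseteq> P \<Longrightarrow> x \<in> D n \<Longrightarrow> act x ` Q' = Q \<Longrightarrow> Q' \<subseteq> A) \<Longrightarrow>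
      \<bar>(\<Sum>Q' | Q' \<subseteq> A \<and> equivalent_sets act Q' Q. window_integral (g \<delta>) n Q')
        - (\<integral>x. g \<delta> (act x ` Q) \<partial>vol) * real (card (copies Q n P))\<bar>
      \<le> C * measure vol (boundary K n)"
      by (rule window_integral_count[where g = "g \<delta>" and L = "L \<delta> Q", OF Q(1) g_bound g_meas L[OF Q(1)] supp]) blast+
    have "\<bar>visits n P (near_copies Q \<delta> \<inter> X) - c \<delta> * frequency Q n P\<bar>
        \<le> C * (measure vol (boundary K n) / measure vol (D n))" if P: "P \<in> orbits" for n P
    proof -
      have PS: "P \<in> point_sets r" and PX: "P \<in> X"
        using P orbits_subset orbits_subset_X by auto
      define B where "B = (\<Union>q\<in>Q. cball q \<delta>)"
      have B: "compact B"
        unfolding B_def using Q(1) compact_cball_M by (intro compact_UN) auto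
      define A where "A = local_window B n P"
      have A: "finite A" "A \<subseteq> P"
        unfolding A_def using finite_local_window[OF PS B] local_window_subset by auto
      define \<Q> where "\<Q> = {Q'. Q' \<subseteq> A \<and> equivalent_sets act Q' Q}"
      have fin\<Q>: "finite \<Q>" "\<And>Q'. Q' \<in> \<Q> \<Longrightarrow> finite Q'"
        unfolding \<Q>_def using A(1) finite_subset by auto
      have pointwise: "(\<Sum>Q'\<in>\<Q>. g \<delta> (act x ` Q')) = indicator (near_copies Q \<delta> \<inter> X) (act x ` P)"
        if x: "x \<in> D n" for x
      proof (cases "act x ` P \<in> near_copies Q \<delta>")
        case True
        have xP: "act x ` P \<in> orbits" "act x ` P \<in> point_sets r" "act x ` P \<in> X"
          using P PX orbits_act PS by auto
        define R where "R = act x ` P \<inter> (\<Union>q\<in>Q. ball q \<delta>)"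
        have R: "equivalent_sets act R Q"
          unfolding R_def using True by (intro copy[OF xP(1) \<delta>(2)]) (simp add: near_copies_def)
        define Q0 where "Q0 = act (- x) ` R"
        have xQ0: "act x ` Q0 = R"
          by (simp add: Q0_def)
        have "Q0 \<subseteq> A"
        proof
          fix p assume p: "p \<in> Q0"
          then have "act x p \<in> R"
            using xQ0 by blast
          moreover have "R \<subseteq> act x ` P" "R \<subseteq> B"
            unfolding R_def B_def using ball_subset_cball by blast+
          ultimately have "act x p \<in> act x ` P" "act x p \<in> B"
            by blast+
          then have "p \<in> P" "act x p \<in> B"
            using inj_act[of x UNIV] by (auto simp: inj_image_mem_iff)
          then show "p \<in> A"
            unfolding A_def by (rule local_windowI[OF _ x])
        qed
        then have "Q0 \<in> \<Q>"
          unfolding \<Q>_def Q0_def using equivalent_sets_trans[OF equivalent_sets_act R] by auto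
        moreover have "g \<delta> (act x ` Q0) = 1"
          using True unfolding xQ0 g_def R_def near_copies_def by (force simp: indicator_def)
        moreover have "g \<delta> (act x ` Q') = 0" if Q': "Q' \<in> \<Q> - {Q0}" for Q'
        proof (rule ccontr)
          assume "g \<delta> (act x ` Q') \<noteq> 0"
          then have near: "\<And>q. q \<in> Q \<Longrightarrow> act x ` Q' \<inter> ball q \<delta> \<noteq> {}"
            by (auto simp: g_def near_copies_def indicator_def split: if_splits)
          have sub: "act x ` Q' \<subseteq> act x ` P"
            using Q' A(2) unfolding \<Q>_def by blast
          have "R \<subseteq> act x ` Q'"
          proof
            fix p assume "p \<in> R"
            then obtain q where q: "q \<in> Q" "p \<in> act x ` P" "dist q p < \<delta>"
              unfolding R_def by auto
            obtain p' where p': "p' \<in> act x ` Q'" "dist q p' < \<delta>"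
              using near[OF q(1)] unfolding ball_def by blast
            have "p = p'"
              using point_setsD[OF xP(2) q(2), of p' q] p' sub q(3) \<delta> \<epsilon> r_pos by auto
            then show "p \<in> act x ` Q'"
              using p' by simp
          qed
          moreover have "card R = card (act x ` Q')"
            using card_equivalent_sets[OF R] card_equivalent_sets[OF equivalent_sets_act, of x Q']
              card_equivalent_sets[of Q' Q] Q' unfolding \<Q>_def by simp
          moreover have "finite (act x ` Q')"
            using Q' fin\<Q> by auto
          ultimately have "R = act x ` Q'"
            by (metis card_subset_eq)
          then have "Q0 = Q'"
            unfolding Q0_def by simp
          then show False
            using Q' by simp
        qed
        ultimately have "(\<Sum>Q'\<in>\<Q>. g \<delta> (act x ` Q')) = 1"
          using sum.remove[OF fin\<Q>(1), of Q0 "\<lambda>Q'. g \<delta> (act x ` Q')"] by simp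
        then show ?thesis
          using True xP(3) by simp
      next
        case False
        have "act x ` Q' \<notin> near_copies Q \<delta>" if "Q' \<in> \<Q>" for Q'
        proof
          assume "act x ` Q' \<in> near_copies Q \<delta>"
          moreover have "act x ` Q' \<subseteq> act x ` P"
            using that A(2) unfolding \<Q>_def by blast
          ultimately show False
            using False unfolding near_copies_def by blast
        qed
        then have "(\<Sum>Q'\<in>\<Q>. g \<delta> (act x ` Q')) = 0"
          by (simp add: g_def)
        then show ?thesis
          using False by simp
      qed
      have nX: "near_copies Q \<delta> \<inter> X \<in> BX"
        using openin_near_copies[OF Q] by (intro sigma_sets.Basic) simp
      have "(\<Sum>Q'\<in>\<Q>. window_integral (g \<delta>) n Q')
          = (\<integral>x. (\<Sum>Q'\<in>\<Q>. indicator (D n) x * g \<delta> (act x ` Q')) \<partial>vol)"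
        by (rule Bochner_Integration.integral_sum[symmetric]) (rule int'[OF fin\<Q>(2)])
      also have "\<dots> = (\<integral>x. indicator {x \<in> D n. act x ` P \<in> near_copies Q \<delta> \<inter> X} x \<partial>vol)"
        using pointwise by (intro Bochner_Integration.integral_cong)
          (auto simp: sum_distrib_left[symmetric] indicator_def)
      also have "\<dots> = measure vol {x \<in> D n. act x ` P \<in> near_copies Q \<delta> \<inter> X}"
        by simp
      finally have sum_eq: "(\<Sum>Q'\<in>\<Q>. window_integral (g \<delta>) n Q')
          = measure vol {x \<in> D n. act x ` P \<in> near_copies Q \<delta> \<inter> X}" .
      have "\<bar>measure vol {x \<in> D n. act x ` P \<in> near_copies Q \<delta> \<inter> X}
          - c \<delta> * real (card (copies Q n P))\<bar>
        \<le> C * measure vol (boundary K n)"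
        unfolding sum_eq[symmetric] \<Q>_def c_def
      proof (rule bound[OF PS A])
        fix Q' x assume Q': "Q' \<subseteq> P" "x \<in> D n" "act x ` Q' = Q"
        show "Q' \<subseteq> A"
        proof
          fix p assume p: "p \<in> Q'"
          then have "act x p \<in> B"
            using Q'(3) \<delta>(1) unfolding B_def by (intro UN_I[of "act x p"]) auto
          then show "p \<in> A"
            unfolding A_def using p Q'(1,2) by (intro local_windowI) auto
        qed
      qed
      then show ?thesis
        unfolding visits_def frequency_def times_divide_eq_right diff_divide_distrib[symmetric] abs_divide
        by (simp add: divide_right_mono)
    qed
    moreover have lim: "(\<lambda>n. C * (measure vol (boundary K n) / measure vol (D n))) \<longlonglongrightarrow> 0"
      using tendsto_mult_right_zero[OF van_hove_tendsto[OF K]] .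
    ultimately show ?thesis
      unfolding uniform_limit_iff
    proof (intro allI impI)
      fix e :: real assume "e > 0"
      then have "eventually (\<lambda>n. C * (measure vol (boundary K n) / measure vol (D n)) < e) sequentially"
        by (rule order_tendstoD(2)[OF lim])
      then show "\<forall>\<^sub>F n in sequentially. \<forall>P\<in>orbits.
          dist (visits n P (near_copies Q \<delta> \<inter> X) - c \<delta> * frequency Q n P) 0 < e"
        by eventually_elim
          (use \<open>\<And>P n. P \<in> orbits \<Longrightarrow> \<bar>visits n P (near_copies Q \<delta> \<inter> X) - c \<delta> * frequency Q n P\<bar>
            \<le> C * (measure vol (boundary K n) / measure vol (D n))\<close> in
            \<open>auto simp: dist_real_def intro: le_less_trans\<close>)
    qed
  qed
  ultimately show thesis
    using that[OF \<epsilon>(1)] by blast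
qed

lemma frequency_limit_unique:
  assumes unique: "uniquely_ergodic_orbit_closure act r \<P>"
    and flc: "finite_local_complexity act \<P>" and Q: "finite Q" "Q \<noteq> {}"
  shows "\<exists>\<nu>. uniform_limit orbits (frequency Q) (\<lambda>_. \<nu>) sequentially"
proof -
  obtain \<epsilon> c where \<epsilon>: "\<epsilon> > 0" and c: "\<And>\<delta>. 0 < \<delta> \<Longrightarrow> c \<delta> > 0"
    and approx: "\<And>\<delta>. 0 < \<delta> \<Longrightarrow> \<delta> \<le> \<epsilon> \<Longrightarrow>
      uniform_limit orbits (\<lambda>n P. visits n P (near_copies Q \<delta> \<inter> X) - c \<delta> * frequency Q n P) (\<lambda>_. 0) sequentially"
    by (rule near_copies_visits[OF flc Q]) blast
  obtain \<mu> where \<mu>: "\<And>\<mu>'. invariant_borel_prob act r \<P> \<mu>' \<Longrightarrow> \<mu>' = \<mu>"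
    using unique unfolding uniquely_ergodic_orbit_closure_def by blast
  have key: "\<exists>G \<nu>. G \<noteq> bot \<and> G \<le> sequentially \<and> ((\<lambda>k. frequency Q (n k) (P k)) \<longlongrightarrow> \<nu>) G \<and>
      countable {\<delta> \<in> {0<..\<epsilon>}. measure \<mu> (near_copies Q \<delta> \<inter> X) \<noteq> c \<delta> * \<nu>}"
    if n: "filterlim n at_top sequentially" and P: "\<And>k. P k \<in> orbits" for n P
  proof -
    have PX: "P k \<in> X" for k
      using P orbits_subset_X by blast
    obtain \<mu>' G m where inv: "invariant_borel_prob act r \<P> \<mu>'" and G: "G \<noteq> bot" "G \<le> sequentially"
      and lim: "\<And>A. ((\<lambda>k. visits (n k) (P k) A) \<longlongrightarrow> m A) G"
      and reg: "\<And>H C. (\<And>t. openin XT (H t)) \<Longrightarrow> (\<And>t. closedin XT (C t)) \<Longrightarrow> (\<And>t. H t \<subseteq> C t) \<Longrightarrow>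
        (\<And>s t. s < t \<Longrightarrow> C s \<subseteq> H t) \<Longrightarrow> countable {t::real. measure \<mu>' (H t) \<noteq> m (H t)}"
      by (rule krylov_bogolyubov[of n P, OF n PX]) blast
    have \<mu>': "\<mu>' = \<mu>"
      by (rule \<mu>[OF inv])
    have freq: "((\<lambda>k. frequency Q (n k) (P k)) \<longlongrightarrow> m (near_copies Q \<delta> \<inter> X) / c \<delta>) G"
      if \<delta>: "0 < \<delta>" "\<delta> \<le> \<epsilon>" for \<delta>
    proof -
      let ?A = "near_copies Q \<delta> \<inter> X"
      have "(\<lambda>k. visits (n k) (P k) ?A - c \<delta> * frequency Q (n k) (P k)) \<longlonglongrightarrow> 0"
      proof (rule tendstoI)
        fix e :: real assume "e > 0"
        then have "eventually (\<lambda>n. \<forall>P\<in>orbits. dist (visits n P ?A - c \<delta> * frequency Q n P) 0 < e) sequentially"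
          using approx[OF \<delta>] unfolding uniform_limit_iff by blast
        then have "eventually (\<lambda>k. \<forall>P\<in>orbits. dist (visits (n k) P ?A - c \<delta> * frequency Q (n k) P) 0 < e) sequentially"
          using n by (rule eventually_compose_filterlim)
        then show "eventually (\<lambda>k. dist (visits (n k) (P k) ?A - c \<delta> * frequency Q (n k) (P k)) 0 < e) sequentially"
          by eventually_elim (use P in blast)
      qed
      then have "((\<lambda>k. visits (n k) (P k) ?A - c \<delta> * frequency Q (n k) (P k)) \<longlongrightarrow> 0) G"
        by (rule tendsto_mono[OF G(2)])
      then have "((\<lambda>k. (visits (n k) (P k) ?A - (visits (n k) (P k) ?A - c \<delta> * frequency Q (n k) (P k))) / c \<delta>)
          \<longlongrightarrow> (m ?A - 0) / c \<delta>) G"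
        using c[OF \<delta>(1)] by (intro tendsto_intros lim) auto
      then show ?thesis
        using c[OF \<delta>(1)] by simp
    qed
    define \<nu> where "\<nu> = m (near_copies Q \<epsilon> \<inter> X) / c \<epsilon>"
    have m_eq: "m (near_copies Q \<delta> \<inter> X) = c \<delta> * \<nu>" if \<delta>: "0 < \<delta>" "\<delta> \<le> \<epsilon>" for \<delta>
    proof -
      have "m (near_copies Q \<delta> \<inter> X) / c \<delta> = \<nu>"
        unfolding \<nu>_def using tendsto_unique[OF G(1) freq[OF \<delta>] freq[OF \<epsilon> order_refl]] .
      then show ?thesis
        using c[OF \<delta>(1)] by (auto simp: field_simps)
    qed
    have "countable {t. measure \<mu> (near_copies Q t \<inter> X) \<noteq> m (near_copies Q t \<inter> X)}"
      unfolding \<mu>'[symmetric]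
    proof (rule reg[of _ "\<lambda>t. \<Inter>q\<in>Q. hits r (cball q t) \<inter> X"])
      show "openin XT (near_copies Q t \<inter> X)" for t
        by (rule openin_near_copies[OF Q])
      show "closedin XT (\<Inter>q\<in>Q. hits r (cball q t) \<inter> X)" for t
        using Q by (intro closedin_INT closedin_hits_X compact_cball_M) auto
      show "near_copies Q t \<inter> X \<subseteq> (\<Inter>q\<in>Q. hits r (cball q t) \<inter> X)" for t
        unfolding near_copies_X[OF Q] by (intro INF_mono' hits_ball_mono)
      show "(\<Inter>q\<in>Q. hits r (cball q s) \<inter> X) \<subseteq> near_copies Q t \<inter> X" if "s < t" for s t
        unfolding near_copies_X[OF Q] by (intro INF_mono' hits_ball_mono that)
    qed
    moreover have "{\<delta> \<in> {0<..\<epsilon>}. measure \<mu> (near_copies Q \<delta> \<inter> X) \<noteq> c \<delta> * \<nu>}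
        \<subseteq> {t. measure \<mu> (near_copies Q t \<inter> X) \<noteq> m (near_copies Q t \<inter> X)}"
      using m_eq by auto
    ultimately have "countable {\<delta> \<in> {0<..\<epsilon>}. measure \<mu> (near_copies Q \<delta> \<inter> X) \<noteq> c \<delta> * \<nu>}"
      by (rule countable_subset[rotated])
    moreover have "((\<lambda>k. frequency Q (n k) (P k)) \<longlongrightarrow> \<nu>) G"
      unfolding \<nu>_def by (rule freq[OF \<epsilon> order_refl])
    ultimately show ?thesis
      using G by blast
  qed
  obtain P0 where P0: "P0 \<in> orbits"
    using nonempty \<P>_subset_orbits by blast
  obtain \<nu> where \<nu>: "countable {\<delta> \<in> {0<..\<epsilon>}. measure \<mu> (near_copies Q \<delta> \<inter> X) \<noteq> c \<delta> * \<nu>}"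
    using key[of "\<lambda>k. k" "\<lambda>_. P0", OF filterlim_ident P0] by (elim exE conjE) (rule that)
  have "uniform_limit orbits (frequency Q) (\<lambda>_. \<nu>) sequentially"
  proof (rule ccontr)
    assume "\<not> ?thesis"
    then obtain e where e: "e > 0" "\<not> eventually (\<lambda>n. \<forall>P\<in>orbits. dist (frequency Q n P) \<nu> < e) sequentially"
      unfolding uniform_limit_iff by blast
    then have "\<forall>k. \<exists>n P. n \<ge> k \<and> P \<in> orbits \<and> \<not> dist (frequency Q n P) \<nu> < e"
      unfolding eventually_sequentially by blast
    then obtain n P where nP: "\<And>k. n k \<ge> k" "\<And>k. P k \<in> orbits" "\<And>k. \<not> dist (frequency Q (n k) (P k)) \<nu> < e"
      by metis
    have n: "filterlim n at_top sequentially"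
      by (rule filterlim_at_top_mono[OF filterlim_ident]) (simp add: nP(1))
    obtain G \<nu>' where G: "G \<noteq> bot" "((\<lambda>k. frequency Q (n k) (P k)) \<longlongrightarrow> \<nu>') G"
      and \<nu>': "countable {\<delta> \<in> {0<..\<epsilon>}. measure \<mu> (near_copies Q \<delta> \<inter> X) \<noteq> c \<delta> * \<nu>'}"
      using key[of n P, OF n nP(2)] by (elim exE conjE) (rule that)
    have "uncountable {0<..\<epsilon>}"
      using \<epsilon> by (simp add: uncountable_half_open_interval_2)
    then obtain \<delta> where \<delta>: "\<delta> \<in> {0<..\<epsilon>}" "measure \<mu> (near_copies Q \<delta> \<inter> X) = c \<delta> * \<nu>"
      "measure \<mu> (near_copies Q \<delta> \<inter> X) = c \<delta> * \<nu>'"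
      using countable_subset[of "{0<..\<epsilon>}", OF _ countable_Un[OF \<nu> \<nu>']] by blast
    then have "\<nu> = \<nu>'"
      using c[of \<delta>] by auto
    then have "eventually (\<lambda>k. dist (frequency Q (n k) (P k)) \<nu> < e) G"
      using tendstoD[OF G(2) e(1)] by simp
    then have "eventually (\<lambda>_. False) G"
      using nP(3) by simp
    then show False
      using G(1) by (simp add: trivial_limit_def)
  qed
  then show ?thesis ..
qed

end

subsection \<open>Laplace functionals\<close>

context orbit_system
begin

definition laplace :: "('m \<Rightarrow> real) \<Rightarrow> 'm set \<Rightarrow> real" where
  "laplace \<psi> P = exp (- (\<Sum>\<^sub>\<infinity>p\<in>P. \<psi> p))"

abbreviation laplace_average :: "('m \<Rightarrow> real) \<Rightarrow> nat \<Rightarrow> 'm set \<Rightarrow> real" where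
  "laplace_average \<psi> n P \<equiv> window_integral (laplace \<psi>) n P / measure vol (D n)"

lemma laplace_act: "laplace \<psi> (act x ` P) = laplace (\<lambda>m. \<psi> (act x m)) P"
  by (simp add: laplace_def infsum_reindex[OF inj_act] o_def)

lemma laplace_bounds:
  assumes "\<And>m. \<psi> m \<ge> 0"
  shows "0 < laplace \<psi> P" "laplace \<psi> P \<le> 1"
  using infsum_nonneg[of P \<psi>] assms by (auto simp: laplace_def)

lemma laplace_act_window:
  assumes \<psi>: "\<psi> \<in> test_functions" and P: "P \<in> point_sets r" and x: "x \<in> D n"
  shows "laplace \<psi> (act x ` P) = exp (- (\<Sum>p\<in>local_window (closure {m. \<psi> m \<noteq> 0}) n P. \<psi> (act x p)))"
proof -
  let ?K = "closure {m. \<psi> m \<noteq> 0}"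
  have K: "compact ?K"
    using \<psi> by (simp add: test_functions_def)
  have "(\<Sum>\<^sub>\<infinity>p\<in>P. \<psi> (act x p)) = (\<Sum>\<^sub>\<infinity>p\<in>local_window ?K n P. \<psi> (act x p))"
  proof (rule infsum_cong_neutral)
    fix p assume "p \<in> P - local_window ?K n P"
    then have "act x p \<notin> ?K"
      using local_windowI[OF _ x, of p P ?K] by blast
    then show "\<psi> (act x p) = 0"
      using closure_subset[of "{m. \<psi> m \<noteq> 0}"] by blast
  qed (use local_window_subset in auto)
  then show ?thesis
    unfolding laplace_act unfolding laplace_def using finite_local_window[OF P K] by simp
qed

lemma continuous_map_laplace:
  assumes \<psi>: "\<psi> \<in> test_functions"
  shows "continuous_map (vague_topology r) euclideanreal (laplace \<psi>)"
proof -
  have "continuous_map (vague_topology r) euclideanreal (\<lambda>P. \<Sum>\<^sub>\<infinity>p\<in>P. \<psi> p)"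
    unfolding continuous_map using openin_vague_test[OF \<psi>] by simp
  moreover have "continuous_map euclideanreal euclideanreal (\<lambda>t::real. exp (- t))"
    by (auto intro!: continuous_intros)
  ultimately have "continuous_map (vague_topology r) euclideanreal ((\<lambda>t. exp (- t)) \<circ> (\<lambda>P. \<Sum>\<^sub>\<infinity>p\<in>P. \<psi> p))"
    by (rule continuous_map_compose)
  moreover have "(\<lambda>t. exp (- t)) \<circ> (\<lambda>P. \<Sum>\<^sub>\<infinity>p\<in>P. \<psi> p) = laplace \<psi>"
    by (simp add: fun_eq_iff laplace_def)
  ultimately show ?thesis
    by simp
qed

lemma measurable_of_continuous_map:
  assumes f: "continuous_map XT euclideanreal f" and \<mu>: "sets \<mu> = BX"
  shows "f \<in> borel_measurable \<mu>"
proof (rule borel_measurableI)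
  fix S :: "real set" assume "open S"
  then have "openin XT {P \<in> topspace XT. f P \<in> S}"
    using f by (intro openin_continuous_map_preimage) auto
  moreover have "space \<mu> = X"
    using sets_eq_imp_space_eq[of \<mu> "orbit_closure_borel act r \<P>"] \<mu>
    by (simp add: sets_orbit_closure_borel space_orbit_closure_borel)
  moreover have "f -` S \<inter> X = {P \<in> X. f P \<in> S}"
    by auto
  ultimately have "f -` S \<inter> space \<mu> \<in> BX"
    unfolding topspace_XT by (auto intro: sigma_sets.Basic)
  then show "f -` S \<inter> space \<mu> \<in> sets \<mu>"
    using \<mu> by simp
qed

lemma class_representatives:
  fixes R0 :: "'m set set"
  assumes "finite R0"
  obtains \<R> where "finite \<R>" "\<R> \<subseteq> R0"
    "\<And>A. (\<exists>S\<in>R0. equivalent_sets act A S) \<Longrightarrow> \<exists>!R. R \<in> \<R> \<and> equivalent_sets act A R"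
proof -
  define rep where "rep A = (SOME S. S \<in> R0 \<and> equivalent_sets act A S)" for A
  have rep: "rep A \<in> R0 \<and> equivalent_sets act A (rep A)" if "\<exists>S\<in>R0. equivalent_sets act A S" for A
    unfolding rep_def by (rule someI_ex) (use that in blast)
  have rep_cong: "rep A = rep B" if "equivalent_sets act A B" for A B
  proof -
    have "equivalent_sets act A S \<longleftrightarrow> equivalent_sets act B S" for S
      using that equivalent_sets_trans equivalent_sets_sym by blast
    then show ?thesis
      by (simp add: rep_def)
  qed
  have R0_rep: "rep S \<in> R0" if "S \<in> R0" for S
    using rep[of S] that equivalent_sets_refl by blast
  have "\<exists>!R. R \<in> rep ` R0 \<and> equivalent_sets act A R" if A: "\<exists>S\<in>R0. equivalent_sets act A S" for A
  proof (rule ex1I[of _ "rep A"])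
    obtain S where S: "S \<in> R0" "equivalent_sets act A S"
      using A by blast
    show "rep A \<in> rep ` R0 \<and> equivalent_sets act A (rep A)"
      using rep[OF A] rep_cong[OF S(2)] S(1) by blast
    fix R assume R: "R \<in> rep ` R0 \<and> equivalent_sets act A R"
    then obtain T where T: "T \<in> R0" "R = rep T"
      by blast
    have "equivalent_sets act T R"
      using rep[of T] T equivalent_sets_refl by blast
    then have "equivalent_sets act A T"
      using R equivalent_sets_sym equivalent_sets_trans by blast
    then show "R = rep A"
      using rep_cong T(2) by simp
  qed
  then show thesis
    using that[of "rep ` R0"] assms R0_rep by blast
qed

text \<open>Expanding \<open>exp (- (\<Sum>p\<in>A. \<psi> p)) = (\<Prod>p\<in>A. 1 + (exp (- \<psi> p) - 1))\<close> writes the Laplace functional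
  as a sum over patterns of a function with bounded support, so that its averages are governed
  by pattern frequencies.\<close>

lemma exp_minus_sum_expand:
  fixes \<psi> :: "'a \<Rightarrow> real"
  assumes "finite A"
  shows "exp (- (\<Sum>p\<in>A. \<psi> p)) = (\<Sum>Q\<in>Pow A. \<Prod>p\<in>Q. exp (- \<psi> p) - 1)"
proof -
  have "exp (- (\<Sum>p\<in>A. \<psi> p)) = (\<Prod>p\<in>A. (exp (- \<psi> p) - 1) + 1)"
    using assms by (simp add: exp_sum flip: sum_negf)
  also have "\<dots> = (\<Sum>Q\<in>Pow A. (\<Prod>p\<in>Q. exp (- \<psi> p) - 1) * (\<Prod>p\<in>A - Q. 1))"
    by (rule prod_add[OF assms])
  finally show ?thesis
    by simp
qed

lemma window_count_uniform_limit:
  fixes g :: "'m set \<Rightarrow> real"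
  assumes Q: "finite Q" and b: "\<And>A. \<bar>g A\<bar> \<le> b"
    and meas: "(\<lambda>x. g (act x ` Q)) \<in> borel_measurable borel"
    and L: "compact L" and supp: "\<And>x. g (act x ` Q) \<noteq> 0 \<Longrightarrow> x \<in> L"
    and freq: "uniform_limit orbits (frequency Q) (\<lambda>_. \<nu>) sequentially"
    and K: "compact K" "Q \<subseteq> K"
  shows "uniform_limit orbits (\<lambda>n P. (\<Sum>Q' | Q' \<subseteq> local_window K n P \<and> equivalent_sets act Q' Q.
      window_integral g n Q') / measure vol (D n))
    (\<lambda>_. (\<integral>x. g (act x ` Q) \<partial>vol) * \<nu>) sequentially"
proof -
  let ?S = "\<lambda>n P. \<Sum>Q' | Q' \<subseteq> local_window K n P \<and> equivalent_sets act Q' Q.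
      window_integral g n Q'"
  let ?c = "\<integral>x. g (act x ` Q) \<partial>vol"
  obtain C K' where K': "compact K'" and bound: "\<And>n P A. P \<in> point_sets r \<Longrightarrow> finite A \<Longrightarrow> A \<subseteq> P \<Longrightarrow>
      (\<And>Q' x. Q' \<subseteq> P \<Longrightarrow> x \<in> D n \<Longrightarrow> act x ` Q' = Q \<Longrightarrow> Q' \<subseteq> A) \<Longrightarrow>
      \<bar>(\<Sum>Q' | Q' \<subseteq> A \<and> equivalent_sets act Q' Q. window_integral g n Q')
        - (\<integral>x. g (act x ` Q) \<partial>vol) * real (card (copies Q n P))\<bar>
      \<le> C * measure vol (boundary K' n)"
    by (rule window_integral_count[of Q g, OF Q b meas L supp]) blast+
  have diff: "\<bar>?S n P / measure vol (D n) - ?c * frequency Q n P\<bar>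
      \<le> C * (measure vol (boundary K' n) / measure vol (D n))" if P: "P \<in> orbits" for n P
  proof -
    have PS: "P \<in> point_sets r"
      using P orbits_subset by blast
    have "\<bar>?S n P - ?c * real (card (copies Q n P))\<bar>
      \<le> C * measure vol (boundary K' n)"
    proof (rule bound[OF PS finite_local_window[OF PS K(1)] local_window_subset])
      fix Q' x assume Q': "Q' \<subseteq> P" "x \<in> D n" "act x ` Q' = Q"
      show "Q' \<subseteq> local_window K n P"
      proof
        fix p assume "p \<in> Q'"
        then have "p \<in> P" "act x p \<in> K"
          using Q' K(2) by auto
        then show "p \<in> local_window K n P"
          by (rule local_windowI[OF _ Q'(2)])
      qed
    qed
    then show ?thesis
      unfolding frequency_def times_divide_eq_right diff_divide_distrib[symmetric] abs_divide
      by (simp add: divide_right_mono)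
  qed
  have lim: "(\<lambda>n. C * (measure vol (boundary K' n) / measure vol (D n))) \<longlonglongrightarrow> 0"
    by (rule tendsto_mult_right_zero[OF van_hove_tendsto[OF K']])
  have "uniform_limit orbits (\<lambda>n P. ?S n P / measure vol (D n) - ?c * frequency Q n P) (\<lambda>_. 0) sequentially"
    unfolding uniform_limit_iff
  proof (intro allI impI)
    fix e :: real assume "e > 0"
    then have "eventually (\<lambda>n. C * (measure vol (boundary K' n) / measure vol (D n)) < e) sequentially"
      by (rule order_tendstoD(2)[OF lim])
    then show "\<forall>\<^sub>F n in sequentially. \<forall>P\<in>orbits. dist (?S n P / measure vol (D n) - ?c * frequency Q n P) 0 < e"
      by eventually_elim (use diff in \<open>auto simp: dist_real_def intro: le_less_trans\<close>)
  qed
  moreover have "uniform_limit orbits (\<lambda>n P. ?c * frequency Q n P) (\<lambda>_. ?c * \<nu>) sequentially"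
    by (rule bounded_linear.uniform_limit[OF bounded_linear_mult_right freq])
  ultimately show ?thesis
    using uniform_limit_add by fastforce
qed

lemma uniform_limit_sum_finite:
  fixes f :: "'i \<Rightarrow> nat \<Rightarrow> 'b \<Rightarrow> real"
  assumes "finite I" "\<And>i. i \<in> I \<Longrightarrow> uniform_limit S (f i) (l i) sequentially"
  shows "uniform_limit S (\<lambda>n x. \<Sum>i\<in>I. f i n x) (\<lambda>x. \<Sum>i\<in>I. l i x) sequentially"
  using assms
proof (induction I rule: finite_induct)
  case empty
  then show ?case
    by (simp add: uniform_limit_const)
next
  case (insert i I)
  then show ?case
    by (simp add: uniform_limit_add)
qed

lemma laplace_average_uniform:
  assumes flc: "finite_local_complexity act \<P>" and freq: "uniform_pattern_frequencies act vol D \<P>"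
    and \<psi>: "\<psi> \<in> test_functions" and \<psi>0: "\<And>m. \<psi> m \<ge> 0"
  shows "\<exists>c. uniform_limit orbits (\<lambda>n P. laplace_average \<psi> n P)
    (\<lambda>_. c) sequentially"
proof -
  define K where "K = closure {m. \<psi> m \<noteq> 0}"
  have K: "compact K" and cont: "continuous_on UNIV \<psi>"
    using \<psi> by (auto simp: K_def test_functions_def)
  have "open {m. \<psi> m \<noteq> 0}"
    using continuous_on_open_vimage[of UNIV \<psi>] cont open_vimage[of "- {0}" \<psi>] by (auto simp: vimage_def)
  then have supp: "{m. \<psi> m \<noteq> 0} \<subseteq> interior K"
    unfolding K_def by (intro interior_maximal closure_subset)
  obtain F where F: "finite F" "\<And>Q. Q \<in> F \<Longrightarrow> \<exists>P\<in>\<P>. pattern_of P Q"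
    "\<And>P. P \<in> orbits \<Longrightarrow> \<exists>Q\<in>F. equivalent_sets act (P \<inter> interior K) Q"
    using flc_window[OF flc K] by metis
  define R0 where "R0 = (\<Union>Q\<in>F. Pow Q) - {{}}"
  have finF: "finite Q" if "Q \<in> F" for Q
    using F(2)[OF that] by (auto simp: pattern_of_def)
  have R0: "finite R0" "\<And>R. R \<in> R0 \<Longrightarrow> \<exists>P\<in>\<P>. pattern_of P R" "\<And>R. R \<in> R0 \<Longrightarrow> finite R \<and> R \<noteq> {}"
  proof -
    show "finite R0"
      unfolding R0_def using F(1) finF by auto
    show "\<exists>P\<in>\<P>. pattern_of P R" if R: "R \<in> R0" for R
    proof -
      obtain Q where Q: "Q \<in> F" "R \<subseteq> Q"
        using R unfolding R0_def by blast
      then show ?thesis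
        using F(2)[OF Q(1)] finite_subset unfolding pattern_of_def by blast
    qed
    show "finite R \<and> R \<noteq> {}" if "R \<in> R0" for R
      using that finF finite_subset unfolding R0_def by blast
  qed
  obtain \<R> where \<R>: "finite \<R>" "\<R> \<subseteq> R0"
    and \<R>_unique: "\<And>A. (\<exists>S\<in>R0. equivalent_sets act A S) \<Longrightarrow> \<exists>!R. R \<in> \<R> \<and> equivalent_sets act A R"
    by (rule class_representatives[OF R0(1)]) blast
  define g where "g A = (\<Prod>a\<in>A. exp (- \<psi> a) - 1)" for A
  have g_bound: "\<bar>g A\<bar> \<le> 1" for A
    unfolding g_def abs_prod by (rule prod_le_1) (use \<psi>0 in \<open>auto simp: abs_le_iff\<close>)
  have g_act: "g (act x ` A) = (\<Prod>a\<in>A. exp (- \<psi> (act x a)) - 1)" for x A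
    by (simp add: g_def prod.reindex[OF inj_act])
  have g_cont: "continuous_on UNIV (\<lambda>x. g (act x ` A))" for A
    unfolding g_act by (intro continuous_intros continuous_on_compose2[OF cont]) auto
  have g_meas: "(\<lambda>x. g (act x ` A)) \<in> borel_measurable borel" for A
    by (rule borel_measurable_continuous_onI[OF g_cont])
  have g_supp: "act x ` A \<subseteq> {m. \<psi> m \<noteq> 0}" if "g (act x ` A) \<noteq> 0" "finite A" for x A
    using that unfolding g_act by auto
  define L where "L A = {x. \<exists>m\<in>A. act x m \<in> K}" for A
  have L: "compact (L A)" if "finite A" for A
    unfolding L_def by (intro compact_return_set finite_imp_compact that K)
  have g_L: "x \<in> L A" if "g (act x ` A) \<noteq> 0" "finite A" "A \<noteq> {}" for x A
    using g_supp[OF that(1,2)] that(3) closure_subset[of "{m. \<psi> m \<noteq> 0}"] unfolding L_def K_def by blast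
  let ?I = "\<lambda>n Q'. window_integral g n Q'"
  have int: "integrable vol (\<lambda>x. indicator (D n) x * g (act x ` A))" for A n
  proof (rule integrable_compact_support[OF _ _ compact_D])
    show "(\<lambda>x. indicator (D n) x * g (act x ` A)) \<in> borel_measurable borel"
      using g_meas compact_D by (intro borel_measurable_times borel_measurable_indicator) auto
    show "\<bar>indicator (D n) x * g (act x ` A)\<bar> \<le> 1" for x
      using g_bound by (simp add: indicator_def)
  qed (auto simp: indicator_def split: if_splits)
  have "\<forall>R\<in>\<R>. \<exists>\<nu>. uniform_limit orbits (frequency R) (\<lambda>_. \<nu>) sequentially"
    using freq R0(2) \<R>(2) unfolding uniform_pattern_frequencies_iff by blast
  then obtain \<nu> where \<nu>: "\<And>R. R \<in> \<R> \<Longrightarrow> uniform_limit orbits (frequency R) (\<lambda>_. \<nu> R) sequentially"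
    by metis
  define K1 where "K1 = K \<union> \<Union>\<R>"
  have K1: "compact K1"
  proof -
    have "finite (\<Union>\<R>)"
      using \<R> R0(3) by (intro finite_Union) auto
    then show ?thesis
      unfolding K1_def by (intro compact_Un K finite_imp_compact)
  qed
  let ?W = "\<lambda>n P. local_window K1 n P"
  have expand: "(\<integral>x. indicator (D n) x * laplace \<psi> (act x ` P) \<partial>vol)
      = measure vol (D n) + (\<Sum>R\<in>\<R>. \<Sum>Q' | Q' \<subseteq> ?W n P \<and> equivalent_sets act Q' R. ?I n Q')"
    if P: "P \<in> orbits" for n P
  proof -
    have PS: "P \<in> point_sets r"
      using P orbits_subset by blast
    have W: "finite (?W n P)" "?W n P \<subseteq> P"
      using finite_local_window[OF PS K1] local_window_subset by auto
    have KW: "local_window K n P \<subseteq> ?W n P"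
      unfolding local_window_def K1_def by blast
    have lap: "laplace \<psi> (act x ` P) = (\<Sum>Q'\<in>Pow (?W n P). g (act x ` Q'))" if x: "x \<in> D n" for x
    proof -
      have "laplace \<psi> (act x ` P) = exp (- (\<Sum>p\<in>local_window K n P. \<psi> (act x p)))"
        using laplace_act_window[OF \<psi> PS x] by (simp add: K_def)
      also have "(\<Sum>p\<in>local_window K n P. \<psi> (act x p)) = (\<Sum>p\<in>?W n P. \<psi> (act x p))"
      proof (rule sum.mono_neutral_left[OF W(1) KW], rule ballI)
        fix p assume p: "p \<in> ?W n P - local_window K n P"
        then have "act x p \<notin> K"
          using local_windowI[OF _ x, of p P K] W(2) by blast
        then show "\<psi> (act x p) = 0"
          using closure_subset[of "{m. \<psi> m \<noteq> 0}"] unfolding K_def by blast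
      qed
      also have "exp (- (\<Sum>p\<in>?W n P. \<psi> (act x p))) = (\<Sum>Q'\<in>Pow (?W n P). g (act x ` Q'))"
        unfolding exp_minus_sum_expand[OF W(1)] g_act ..
      finally show ?thesis .
    qed
    have "(\<integral>x. indicator (D n) x * laplace \<psi> (act x ` P) \<partial>vol)
        = (\<integral>x. (\<Sum>Q'\<in>Pow (?W n P). indicator (D n) x * g (act x ` Q')) \<partial>vol)"
      using lap by (intro Bochner_Integration.integral_cong) (auto simp: sum_distrib_left[symmetric] indicator_def)
    also have "\<dots> = (\<Sum>Q'\<in>Pow (?W n P). ?I n Q')"
      by (rule Bochner_Integration.integral_sum) (rule int)
    also have "\<dots> = ?I n {} + (\<Sum>Q'\<in>Pow (?W n P) - {{}}. ?I n Q')"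
      by (rule sum.remove) (use W(1) in auto)
    also have "?I n {} = measure vol (D n)"
      by (simp add: g_def)
    also have "(\<Sum>Q'\<in>Pow (?W n P) - {{}}. ?I n Q')
        = (\<Sum>Q'\<in>(\<Union>R\<in>\<R>. {Q'. Q' \<subseteq> ?W n P \<and> equivalent_sets act Q' R}). ?I n Q')"
    proof (rule sum.mono_neutral_right)
      show "finite (Pow (?W n P) - {{}})"
        using W(1) by simp
      show "(\<Union>R\<in>\<R>. {Q'. Q' \<subseteq> ?W n P \<and> equivalent_sets act Q' R}) \<subseteq> Pow (?W n P) - {{}}"
        using \<R>(2) R0(3) unfolding equivalent_sets_def by fastforce
      show "\<forall>Q'\<in>Pow (?W n P) - {{}} - (\<Union>R\<in>\<R>. {Q'. Q' \<subseteq> ?W n P \<and> equivalent_sets act Q' R}). ?I n Q' = 0"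
      proof
        fix Q' assume Q': "Q' \<in> Pow (?W n P) - {{}} - (\<Union>R\<in>\<R>. {Q'. Q' \<subseteq> ?W n P \<and> equivalent_sets act Q' R})"
        have fQ': "finite Q'"
          using Q' W(1) finite_subset by blast
        have "indicator (D n) x * g (act x ` Q') = 0" for x
        proof (rule ccontr)
          assume "indicator (D n) x * g (act x ` Q') \<noteq> 0"
          then have "act x ` Q' \<subseteq> interior K"
            using g_supp[OF _ fQ', of x] supp by auto
          moreover have "act x ` Q' \<subseteq> act x ` P"
            using Q' W(2) by (intro image_mono) blast
          ultimately have sub: "act x ` Q' \<subseteq> act x ` P \<inter> interior K"
            by blast
          obtain Q where Q: "Q \<in> F" "equivalent_sets act (act x ` P \<inter> interior K) Q"
            using F(3)[OF orbits_act[OF P]] by blast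
          then obtain y where y: "act y ` (act x ` P \<inter> interior K) = Q"
            unfolding equivalent_sets_def by blast
          have "act y ` act x ` Q' \<subseteq> Q"
            unfolding y[symmetric] by (rule image_mono[OF sub])
          then have "act y ` act x ` Q' \<in> R0"
            using Q(1) Q' unfolding R0_def by blast
          moreover have "equivalent_sets act Q' (act y ` act x ` Q')"
            unfolding equivalent_sets_def by (rule exI[of _ "y + x"]) (rule act_image_add)
          ultimately obtain R where "R \<in> \<R>" "equivalent_sets act Q' R"
            using \<R>_unique[of Q'] by blast
          then show False
            using Q' by blast
        qed
        then have "(\<lambda>x. indicator (D n) x * g (act x ` Q')) = (\<lambda>_. 0)"
          by (rule ext)
        then show "?I n Q' = 0"
          by simp
      qed
    qed
    also have "\<dots> = (\<Sum>R\<in>\<R>. \<Sum>Q' | Q' \<subseteq> ?W n P \<and> equivalent_sets act Q' R. ?I n Q')"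
    proof (rule sum.UNION_disjoint[OF \<R>(1)])
      show "\<forall>R\<in>\<R>. finite {Q'. Q' \<subseteq> ?W n P \<and> equivalent_sets act Q' R}"
        using W(1) by simp
      show "\<forall>R\<in>\<R>. \<forall>S\<in>\<R>. R \<noteq> S \<longrightarrow>
          {Q'. Q' \<subseteq> ?W n P \<and> equivalent_sets act Q' R} \<inter> {Q'. Q' \<subseteq> ?W n P \<and> equivalent_sets act Q' S} = {}"
        using \<R>_unique \<R>(2) by blast
    qed
    finally show ?thesis .
  qed
  have each: "uniform_limit orbits (\<lambda>n P. (\<Sum>Q' | Q' \<subseteq> ?W n P \<and> equivalent_sets act Q' R. ?I n Q') / measure vol (D n))
      (\<lambda>_. (\<integral>x. g (act x ` R) \<partial>vol) * \<nu> R) sequentially" if R: "R \<in> \<R>" for R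
  proof -
    have fR: "finite R" "R \<noteq> {}"
      using R \<R>(2) R0(3) by auto
    show ?thesis
    proof (rule window_count_uniform_limit[OF fR(1) g_bound g_meas L[OF fR(1)] _ \<nu>[OF R] K1])
      show "x \<in> L R" if "g (act x ` R) \<noteq> 0" for x
        by (rule g_L[OF that fR])
      show "R \<subseteq> K1"
        using R by (auto simp: K1_def)
    qed
  qed
  have "uniform_limit orbits (\<lambda>n P. \<Sum>R\<in>\<R>. (\<Sum>Q' | Q' \<subseteq> ?W n P \<and> equivalent_sets act Q' R. ?I n Q') / measure vol (D n))
      (\<lambda>_. \<Sum>R\<in>\<R>. (\<integral>x. g (act x ` R) \<partial>vol) * \<nu> R) sequentially"
    by (rule uniform_limit_sum_finite[OF \<R>(1) each])
  then have lim: "uniform_limit orbits (\<lambda>n P. 1 + (\<Sum>R\<in>\<R>. (\<Sum>Q' | Q' \<subseteq> ?W n P \<and> equivalent_sets act Q' R. ?I n Q') / measure vol (D n)))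
      (\<lambda>_. 1 + (\<Sum>R\<in>\<R>. (\<integral>x. g (act x ` R) \<partial>vol) * \<nu> R)) sequentially"
    by (intro uniform_limit_add uniform_limit_const)
  have "uniform_limit orbits (\<lambda>n P. laplace_average \<psi> n P)
      (\<lambda>_. 1 + (\<Sum>R\<in>\<R>. (\<integral>x. g (act x ` R) \<partial>vol) * \<nu> R)) sequentially"
    unfolding uniform_limit_iff
  proof (intro allI impI)
    fix e :: real assume "e > 0"
    with lim have "\<forall>\<^sub>F n in sequentially. \<forall>P\<in>orbits.
        dist (1 + (\<Sum>R\<in>\<R>. (\<Sum>Q' | Q' \<subseteq> ?W n P \<and> equivalent_sets act Q' R. ?I n Q') / measure vol (D n)))
          (1 + (\<Sum>R\<in>\<R>. (\<integral>x. g (act x ` R) \<partial>vol) * \<nu> R)) < e"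
      unfolding uniform_limit_iff by blast
    then show "\<forall>\<^sub>F n in sequentially. \<forall>P\<in>orbits.
        dist (laplace_average \<psi> n P)
          (1 + (\<Sum>R\<in>\<R>. (\<integral>x. g (act x ` R) \<partial>vol) * \<nu> R)) < e"
      using measure_D_pos
    proof eventually_elim
      case (elim n)
      show ?case
      proof
        fix P assume P: "P \<in> orbits"
        have "laplace_average \<psi> n P
            = 1 + (\<Sum>R\<in>\<R>. (\<Sum>Q' | Q' \<subseteq> ?W n P \<and> equivalent_sets act Q' R. ?I n Q') / measure vol (D n))"
          unfolding expand[OF P] using elim(2) by (simp add: add_divide_distrib sum_divide_distrib)
        then show "dist (laplace_average \<psi> n P)
          (1 + (\<Sum>R\<in>\<R>. (\<integral>x. g (act x ` R) \<partial>vol) * \<nu> R)) < e"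
          using elim(1) P by simp
      qed
    qed
  qed
  then show ?thesis ..
qed


text \<open>Uniform continuity of \<open>\<psi> (x m)\<close> in \<open>x\<close>: the average over \<open>D n\<close> is a uniform limit of finite
  convex combinations of translates, which makes it continuous and lets invariant measures
  commute with averaging without a Fubini argument.\<close>

lemma laplace_average_approx:
  assumes \<psi>: "\<psi> \<in> test_functions" and \<psi>0: "\<And>m. \<psi> m \<ge> 0" and Dn: "measure vol (D n) > 0" and e: "e > 0"
  obtains k :: nat and x :: "nat \<Rightarrow> 'g" and w :: "nat \<Rightarrow> real"
  where "\<And>i. w i \<ge> 0" "(\<Sum>i<k. w i) = 1"
    "\<And>P. P \<in> X \<Longrightarrow> \<bar>laplace_average \<psi> n P
        - (\<Sum>i<k. w i * laplace \<psi> (act (x i) ` P))\<bar> \<le> e"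
proof -
  define K where "K = closure {m. \<psi> m \<noteq> 0}"
  have K: "compact K" and cont: "continuous_on UNIV \<psi>"
    using \<psi> by (auto simp: K_def test_functions_def)
  define C where "C = (\<lambda>(x, m). act x m) ` (uminus ` D n \<times> K)"
  have C: "compact C"
    unfolding C_def by (intro compact_act_plus compact_uminus_image compact_D K)
  obtain N where N: "\<And>P. P \<in> point_sets r \<Longrightarrow> finite (P \<inter> C) \<and> card (P \<inter> C) \<le> N"
    using card_point_set_bounded[OF C r_pos] by metis
  have "continuous_on (D n \<times> C) (\<lambda>(x, m). \<psi> (act x m))"
    unfolding case_prod_unfold
    by (rule continuous_on_compose2[OF cont]) (auto intro!: continuous_intros)
  then have uc: "uniformly_continuous_on (D n \<times> C) (\<lambda>(x, m). \<psi> (act x m))"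
    by (intro compact_uniformly_continuous compact_Times compact_D C)
  have "e / (real N + 1) > 0"
    using e by simp
  then obtain d where d: "d > 0" "\<And>z z'. z \<in> D n \<times> C \<Longrightarrow> z' \<in> D n \<times> C \<Longrightarrow> dist z' z < d \<Longrightarrow>
      dist ((\<lambda>(x, m). \<psi> (act x m)) z') ((\<lambda>(x, m). \<psi> (act x m)) z) < e / (real N + 1)"
    using uc unfolding uniformly_continuous_on_def by metis
  have close: "\<bar>laplace \<psi> (act y ` P) - laplace \<psi> (act z ` P)\<bar> \<le> e"
    if P: "P \<in> X" and yz: "y \<in> D n" "z \<in> D n" "dist y z < d" for P y z
  proof -
    have PS: "P \<in> point_sets r"
      using P X_subset by blast
    let ?A = "P \<inter> C"
    have eq: "laplace \<psi> (act y ` P) = exp (- (\<Sum>p\<in>?A. \<psi> (act y p)))" if "y \<in> D n" for y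
      using laplace_act_window[OF \<psi> PS that] by (simp add: local_window_def C_def K_def)
    have "\<bar>exp (- a) - exp (- b)\<bar> \<le> \<bar>a - b\<bar>" if "a \<ge> 0" "b \<ge> 0" for a b :: real
    proof -
      have "exp (- a) - exp (- b) \<le> b - a" if "a \<ge> 0" "a \<le> b" for a b :: real
      proof -
        have "1 - exp (a - b) \<le> b - a"
          using exp_ge_add_one_self[of "a - b"] by linarith
        then have "exp (- a) * (1 - exp (a - b)) \<le> 1 * (b - a)"
          using that by (intro mult_mono) auto
        then show ?thesis
          by (simp add: right_diff_distrib flip: exp_add)
      qed
      from this[of a b] this[of b a] that show ?thesis
        by (cases "a \<le> b") (auto simp: abs_real_def)
    qed
    then have "\<bar>laplace \<psi> (act y ` P) - laplace \<psi> (act z ` P)\<bar>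
        \<le> \<bar>(\<Sum>p\<in>?A. \<psi> (act y p)) - (\<Sum>p\<in>?A. \<psi> (act z p))\<bar>"
      unfolding eq[OF yz(1)] eq[OF yz(2)] by (simp add: sum_nonneg \<psi>0)
    also have "\<dots> \<le> (\<Sum>p\<in>?A. \<bar>\<psi> (act y p) - \<psi> (act z p)\<bar>)"
      by (simp flip: sum_subtractf)
    also have "\<dots> \<le> (\<Sum>p\<in>?A. e / (real N + 1))"
    proof (rule sum_mono)
      fix p assume "p \<in> ?A"
      then show "\<bar>\<psi> (act y p) - \<psi> (act z p)\<bar> \<le> e / (real N + 1)"
        using d(2)[of "(z, p)" "(y, p)"] yz by (simp add: dist_Pair_Pair dist_real_def less_imp_le)
    qed
    also have "\<dots> \<le> real N * (e / (real N + 1))"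
      using N[OF PS] e by (simp add: divide_right_mono mult_right_mono)
    also have "\<dots> \<le> e"
      using e by (simp add: field_simps)
    finally show ?thesis .
  qed
  have "D n \<subseteq> (\<Union>y\<in>D n. ball y d)"
    using d(1) by auto
  then obtain Y where Y: "Y \<subseteq> D n" "finite Y" "D n \<subseteq> (\<Union>y\<in>Y. ball y d)"
    using compactE_image[OF compact_D, of "D n" "\<lambda>y. ball y d"] by auto
  obtain k :: nat and x where kx: "Y = x ` {i. i < k}"
    using finite_imp_nat_seg_image_inj_on[OF Y(2)] by blast
  define U where "U i = (if i < k then ball (x i) d else {})" for i
  define B where "B i = D n \<inter> disjointed U i" for i
  have B_borel: "B i \<in> sets borel" for i
  proof -
    have "range U \<subseteq> sets borel"
      by (auto simp: U_def)
    then have "disjointed U i \<in> sets borel"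
      using sets.range_disjointed_sets[of U borel] by blast
    then show ?thesis
      unfolding B_def using compact_D by auto
  qed
  have B_fm: "B i \<in> fmeasurable vol" for i
    using B_borel by (intro fmeasurable_subset_compact[OF compact_D]) (auto simp: B_def)
  have B_disj: "disjoint_family_on B {..<k}"
    using disjoint_family_disjointed[of U] unfolding disjoint_family_on_def B_def by blast
  have B_sub: "y \<in> D n \<and> dist y (x i) < d \<and> x i \<in> D n" if "y \<in> B i" for y i
  proof -
    have "y \<in> U i"
      using that disjointed_subset[of U i] by (auto simp: B_def)
    then have "i < k" "dist y (x i) < d"
      by (auto simp: U_def dist_commute split: if_splits)
    moreover have "x i \<in> D n"
      using \<open>i < k\<close> kx Y(1) by blast
    ultimately show ?thesis
      using that by (simp add: B_def)
  qed
  have B_UN: "(\<Union>i<k. B i) = D n"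
  proof (intro equalityI subsetI)
    fix y assume y: "y \<in> D n"
    then obtain i where "i < k" "y \<in> ball (x i) d"
      using Y(3) kx by auto
    then have "y \<in> (\<Union>i. U i)"
      by (auto simp: U_def intro!: exI[of _ i])
    then have "y \<in> (\<Union>i. disjointed U i)"
      by (simp add: UN_disjointed_eq)
    then obtain j where j: "y \<in> disjointed U j"
      by blast
    then have "j < k"
      using disjointed_subset[of U j] by (auto simp: U_def split: if_splits)
    then show "y \<in> (\<Union>i<k. B i)"
      using j y by (auto simp: B_def)
  qed (auto simp: B_def)
  define w where "w i = measure vol (B i) / measure vol (D n)" for i
  have w0: "w i \<ge> 0" for i
    by (simp add: w_def)
  have "measure vol (\<Union>i<k. B i) = (\<Sum>i<k. measure vol (B i))"
    using B_borel B_disj fmeasurableD2[OF B_fm] by (intro measure_finite_Union) auto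
  then have w1: "(\<Sum>i<k. w i) = 1"
    using Dn unfolding w_def B_UN by (simp flip: sum_divide_distrib)
  have "\<bar>laplace_average \<psi> n P
        - (\<Sum>i<k. w i * laplace \<psi> (act (x i) ` P))\<bar> \<le> e" if P: "P \<in> X" for P
  proof -
    let ?f = "\<lambda>y. laplace \<psi> (act y ` P)"
    have PS: "P \<in> point_sets r"
      using P X_subset by blast
    let ?A = "P \<inter> C"
    have eqA: "indicator (D n) y * ?f y = indicator (D n) y * exp (- (\<Sum>p\<in>?A. \<psi> (act y p)))" for y
      using laplace_act_window[OF \<psi> PS, of y n] by (auto simp: local_window_def C_def K_def indicator_def)
    have "continuous_on UNIV (\<lambda>y. exp (- (\<Sum>p\<in>?A. \<psi> (act y p))))"
      by (intro continuous_intros continuous_on_compose2[OF cont]) auto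
    then have m1: "(\<lambda>y. exp (- (\<Sum>p\<in>?A. \<psi> (act y p)))) \<in> borel_measurable borel"
      by (rule borel_measurable_continuous_onI)
    have m: "(\<lambda>y. indicator (D n) y * ?f y) \<in> borel_measurable borel"
      unfolding eqA using m1 compact_D by (intro borel_measurable_times borel_measurable_indicator) auto
    have int: "integrable vol (\<lambda>y. indicator (B i) y * ?f y)" for i
    proof (rule integrable_compact_support[OF _ _ compact_D])
      have "(\<lambda>y. indicator (B i) y * (indicator (D n) y * ?f y)) = (\<lambda>y. indicator (B i) y * ?f y)"
        by (auto simp: indicator_def B_def)
      moreover have "(\<lambda>y. indicator (B i) y * (indicator (D n) y * ?f y)) \<in> borel_measurable borel"
        by (rule borel_measurable_times[OF borel_measurable_indicator[OF B_borel] m])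
      ultimately show "(\<lambda>y. indicator (B i) y * ?f y) \<in> borel_measurable borel"
        by (simp only:)
      show "\<bar>indicator (B i) y * ?f y\<bar> \<le> 1" for y
        using laplace_bounds[of \<psi> "act y ` P"] \<psi>0 by (auto simp: indicator_def less_imp_le)
      show "y \<in> D n" if "indicator (B i) y * ?f y \<noteq> 0" for y
        using that by (auto simp: B_def indicator_def split: if_splits)
    qed
    have piece: "\<bar>(\<integral>y. indicator (B i) y * ?f y \<partial>vol) - measure vol (B i) * ?f (x i)\<bar> \<le> e * measure vol (B i)" for i
    proof -
      have intB: "integrable vol (\<lambda>y. indicator (B i) y * c)" for c :: real
        using B_fm[of i] by (intro integrable_mult_left integrable_real_indicator) (auto simp: fmeasurable_def)
      have "(\<integral>y. indicator (B i) y * ?f y \<partial>vol) - measure vol (B i) * ?f (x i)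
          = (\<integral>y. indicator (B i) y * ?f y - indicator (B i) y * ?f (x i) \<partial>vol)"
        using int intB by (subst Bochner_Integration.integral_diff) auto
      also have "\<bar>\<dots>\<bar> \<le> (\<integral>y. \<bar>indicator (B i) y * ?f y - indicator (B i) y * ?f (x i)\<bar> \<partial>vol)"
        by (rule integral_abs_bound)
      also have "\<dots> \<le> (\<integral>y. indicator (B i) y * e \<partial>vol)"
      proof (rule integral_mono)
        show "integrable vol (\<lambda>y. \<bar>indicator (B i) y * ?f y - indicator (B i) y * ?f (x i)\<bar>)"
          by (intro integrable_abs Bochner_Integration.integrable_diff int intB)
        show "\<bar>indicator (B i) y * ?f y - indicator (B i) y * ?f (x i)\<bar> \<le> indicator (B i) y * e" for y
          using close[OF P, of y "x i"] B_sub[of y i] by (auto simp: indicator_def)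
      qed (rule intB)
      also have "\<dots> = e * measure vol (B i)"
        by simp
      finally show ?thesis .
    qed
    have "indicator (D n) y = (\<Sum>i<k. indicator (B i) y :: real)" for y
      using indicator_UN_disjoint[of "{..<k}" B y] B_disj unfolding B_UN by simp
    then have "(\<integral>y. indicator (D n) y * ?f y \<partial>vol) = (\<integral>y. (\<Sum>i<k. indicator (B i) y * ?f y) \<partial>vol)"
      by (simp add: sum_distrib_right)
    also have "\<dots> = (\<Sum>i<k. \<integral>y. indicator (B i) y * ?f y \<partial>vol)"
      by (rule Bochner_Integration.integral_sum) (rule int)
    finally have "\<bar>(\<integral>y. indicator (D n) y * ?f y \<partial>vol) - (\<Sum>i<k. measure vol (B i) * ?f (x i))\<bar>
        = \<bar>\<Sum>i<k. (\<integral>y. indicator (B i) y * ?f y \<partial>vol) - measure vol (B i) * ?f (x i)\<bar>"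
      by (simp add: sum_subtractf)
    also have "\<dots> \<le> (\<Sum>i<k. e * measure vol (B i))"
      by (rule order_trans[OF sum_abs sum_mono]) (rule piece)
    also have "\<dots> = e * measure vol (D n)"
      using w1 Dn unfolding w_def by (simp add: divide_simps flip: sum_distrib_left sum_divide_distrib)
    finally have "\<bar>(\<integral>y. indicator (D n) y * ?f y \<partial>vol) - (\<Sum>i<k. measure vol (B i) * ?f (x i))\<bar> / measure vol (D n) \<le> e"
      using Dn by (simp add: divide_simps)
    moreover have "\<bar>(\<integral>y. indicator (D n) y * ?f y \<partial>vol) - (\<Sum>i<k. measure vol (B i) * ?f (x i))\<bar> / measure vol (D n)
        = \<bar>(\<integral>y. indicator (D n) y * ?f y \<partial>vol) / measure vol (D n) - (\<Sum>i<k. w i * ?f (x i))\<bar>"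
    proof -
      have "(\<Sum>i<k. w i * ?f (x i)) = (\<Sum>i<k. measure vol (B i) * ?f (x i)) / measure vol (D n)"
        by (simp add: w_def sum_divide_distrib)
      then show ?thesis
        using Dn by (simp only: diff_divide_distrib[symmetric] abs_divide abs_of_pos)
    qed
    ultimately show ?thesis
      by simp
  qed
  then show thesis
    using that w0 w1 by blast
qed

lemma invariant_measureD:
  assumes "invariant_borel_prob act r \<P> \<mu>"
  shows "sets \<mu> = BX" "space \<mu> = X" "prob_space \<mu>"
    "\<And>x B. B \<in> BX \<Longrightarrow> emeasure \<mu> ((`) (act x) ` B) = emeasure \<mu> B"
proof -
  show s: "sets \<mu> = BX"
    using assms by (simp add: invariant_borel_prob_def sets_orbit_closure_borel)
  then show "space \<mu> = X"
    using sets_eq_imp_space_eq[of \<mu> "orbit_closure_borel act r \<P>"]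
    by (simp add: sets_orbit_closure_borel space_orbit_closure_borel)
  show "prob_space \<mu>" "\<And>x B. B \<in> BX \<Longrightarrow> emeasure \<mu> ((`) (act x) ` B) = emeasure \<mu> B"
    using assms s by (auto simp: invariant_borel_prob_def)
qed

lemma laplace_measurable:
  assumes \<mu>: "invariant_borel_prob act r \<P> \<mu>" and \<psi>: "\<psi> \<in> test_functions" and \<psi>0: "\<And>m. \<psi> m \<ge> 0"
  shows "integrable \<mu> (laplace \<psi>)"
proof -
  interpret prob_space \<mu>
    by (rule invariant_measureD(3)[OF \<mu>])
  have "laplace \<psi> \<in> borel_measurable \<mu>"
    by (rule measurable_of_continuous_map[OF continuous_map_from_subtopology[OF continuous_map_laplace[OF \<psi>]]
          invariant_measureD(1)[OF \<mu>]])
  then show ?thesis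
    by (rule integrable_const_bound[of _ 1, rotated])
      (use laplace_bounds[of \<psi>] \<psi>0 in \<open>auto simp: less_imp_le\<close>)
qed

lemma integral_laplace_act:
  assumes \<mu>: "invariant_borel_prob act r \<P> \<mu>" and \<psi>: "\<psi> \<in> test_functions" and \<psi>0: "\<And>m. \<psi> m \<ge> 0"
  shows "(\<integral>P. laplace \<psi> (act x ` P) \<partial>\<mu>) = (\<integral>P. laplace \<psi> P \<partial>\<mu>)"
proof -
  note inv = invariant_measureD[OF \<mu>]
  have pre: "(`) (act x) -` A \<inter> X = (`) (act (- x)) ` A" if "A \<in> BX" for A
  proof -
    have "A \<subseteq> X"
      using that BX.space_closed by blast
    then show ?thesis
      by (auto simp: image_act_eq)
  qed
  have meas: "(`) (act x) \<in> measurable \<mu> \<mu>"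
    by (rule measurableI) (auto simp: inv(1,2) pre BX_act)
  have "distr \<mu> \<mu> ((`) (act x)) = \<mu>"
  proof (rule measure_eqI)
    fix A assume "A \<in> sets (distr \<mu> \<mu> ((`) (act x)))"
    then show "emeasure (distr \<mu> \<mu> ((`) (act x))) A = emeasure \<mu> A"
      using meas by (subst emeasure_distr) (auto simp: inv pre)
  qed simp
  then have "(\<integral>P. laplace \<psi> P \<partial>\<mu>) = (\<integral>P. laplace \<psi> P \<partial>distr \<mu> \<mu> ((`) (act x)))"
    by simp
  also have "\<dots> = (\<integral>P. laplace \<psi> (act x ` P) \<partial>\<mu>)"
    using laplace_measurable[OF \<mu> \<psi> \<psi>0] by (intro integral_distr meas) auto
  finally show ?thesis
    by simp
qed

lemma integral_laplace:
  assumes \<mu>: "invariant_borel_prob act r \<P> \<mu>" and \<psi>: "\<psi> \<in> test_functions" and \<psi>0: "\<And>m. \<psi> m \<ge> 0"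
    and lim: "uniform_limit orbits (\<lambda>n P. laplace_average \<psi> n P)
      (\<lambda>_. c) sequentially"
  shows "(\<integral>P. laplace \<psi> P \<partial>\<mu>) = c"
proof -
  interpret prob_space \<mu>
    by (rule invariant_measureD(3)[OF \<mu>])
  have "\<bar>(\<integral>P. laplace \<psi> P \<partial>\<mu>) - c\<bar> \<le> 2 * e" if e: "e > 0" for e
  proof -
    have "\<forall>\<^sub>F n in sequentially. (\<forall>P\<in>orbits. dist (laplace_average \<psi> n P) c < e)
        \<and> measure vol (D n) > 0"
      using lim e measure_D_pos unfolding uniform_limit_iff by (intro eventually_conj) blast+
    then obtain n where n: "\<forall>P\<in>orbits. dist (laplace_average \<psi> n P) c < e"
      "measure vol (D n) > 0"
      using eventually_happens'[OF sequentially_bot] by blast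
    obtain k :: nat and x w where w: "\<And>i. w i \<ge> 0" "(\<Sum>i<k. w i) = 1"
      and approx: "\<And>P. P \<in> X \<Longrightarrow> \<bar>laplace_average \<psi> n P
        - (\<Sum>i<k. w i * laplace \<psi> (act (x i) ` P))\<bar> \<le> e"
      by (rule laplace_average_approx[OF \<psi> \<psi>0 n(2) e]) blast
    define s where "s P = (\<Sum>i<k. w i * laplace \<psi> (act (x i) ` P))" for P
    have "continuous_map (vague_topology r) euclideanreal (\<lambda>P. laplace \<psi> (act y ` P))" for y
      unfolding laplace_act by (rule continuous_map_laplace[OF test_function_act[OF \<psi>]])
    then have s_cont: "continuous_map (vague_topology r) euclideanreal s"
      unfolding s_def by (intro continuous_map_sum continuous_map_real_mult_left) auto
    have "closedin (vague_topology r) {P \<in> topspace (vague_topology r). s P \<in> {c - 2 * e..c + 2 * e}}"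
      by (rule closedin_continuous_map_preimage[OF s_cont]) simp
    moreover have "orbits \<subseteq> {P \<in> topspace (vague_topology r). s P \<in> {c - 2 * e..c + 2 * e}}"
    proof
      fix P assume P: "P \<in> orbits"
      then have "P \<in> X" "P \<in> point_sets r"
        using orbits_subset orbits_subset_X by auto
      then show "P \<in> {P \<in> topspace (vague_topology r). s P \<in> {c - 2 * e..c + 2 * e}}"
        using approx[of P] n(1)[rule_format, OF P] unfolding s_def dist_real_def by (simp add: abs_le_iff) linarith
    qed
    ultimately have sX: "X \<subseteq> {P \<in> topspace (vague_topology r). s P \<in> {c - 2 * e..c + 2 * e}}"
      unfolding X_eq by (intro closure_of_minimal)
    have int_act: "integrable \<mu> (\<lambda>P. laplace \<psi> (act y ` P))" for y
      unfolding laplace_act by (rule laplace_measurable[OF \<mu> test_function_act[OF \<psi>] \<psi>0])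
    have "(\<integral>P. s P \<partial>\<mu>) = (\<Sum>i<k. w i * (\<integral>P. laplace \<psi> (act (x i) ` P) \<partial>\<mu>))"
      unfolding s_def using int_act by (subst Bochner_Integration.integral_sum) auto
    also have "\<dots> = (\<integral>P. laplace \<psi> P \<partial>\<mu>)"
      unfolding integral_laplace_act[OF \<mu> \<psi> \<psi>0] using w(2) by (simp flip: sum_distrib_right)
    finally have eq: "(\<integral>P. laplace \<psi> P \<partial>\<mu>) = (\<integral>P. s P \<partial>\<mu>)"
      by simp
    have ints: "integrable \<mu> s"
      unfolding s_def using int_act by (intro Bochner_Integration.integrable_sum integrable_mult_right)
    have sp: "space \<mu> = X"
      by (rule invariant_measureD(2)[OF \<mu>])
    have "(\<integral>P. s P \<partial>\<mu>) \<le> (\<integral>P. c + 2 * e \<partial>\<mu>)"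
      by (rule integral_mono[OF ints]) (use sX sp in auto)
    moreover have "(\<integral>P. c - 2 * e \<partial>\<mu>) \<le> (\<integral>P. s P \<partial>\<mu>)"
      by (rule integral_mono[OF _ ints]) (use sX sp in auto)
    ultimately show ?thesis
      unfolding eq by (simp add: prob_space abs_le_iff)
  qed
  from this[of "\<bar>(\<integral>P. laplace \<psi> P \<partial>\<mu>) - c\<bar> / 4"] show ?thesis
    by (cases "(\<integral>P. laplace \<psi> P \<partial>\<mu>) = c") auto
qed

lemma test_function_scale:
  fixes \<psi> :: "'m \<Rightarrow> real"
  assumes \<psi>: "\<psi> \<in> test_functions"
  shows "(\<lambda>m. c * \<psi> m) \<in> test_functions"
proof -
  have "compact (closure {m. \<psi> m \<noteq> 0})"
    using \<psi> by (simp add: test_functions_def)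
  then have "compact (closure {m. c * \<psi> m \<noteq> 0})"
  proof (rule compact_closure_of_subset)
    have "{m. c * \<psi> m \<noteq> 0} \<subseteq> {m. \<psi> m \<noteq> 0}"
      by auto
    then show "{m. c * \<psi> m \<noteq> 0} \<subseteq> closure {m. \<psi> m \<noteq> 0}"
      using closure_subset by (rule order_trans)
  qed
  then show ?thesis
    using \<psi> by (auto simp: test_functions_def intro!: continuous_intros)
qed

definition avoids :: "('m \<Rightarrow> real) \<Rightarrow> 'm set set" where
  "avoids \<psi> = {P \<in> X. \<forall>p\<in>P. \<psi> p = 0}"

lemma measure_avoids:
  assumes \<mu>: "invariant_borel_prob act r \<P> \<mu>" and \<psi>: "\<psi> \<in> test_functions" and \<psi>0: "\<And>m. \<psi> m \<ge> 0"
  shows "avoids \<psi> \<in> BX" and "(\<lambda>k. \<integral>P. laplace (\<lambda>m. real k * \<psi> m) P \<partial>\<mu>) \<longlonglongrightarrow> measure \<mu> (avoids \<psi>)"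
proof -
  interpret prob_space \<mu>
    by (rule invariant_measureD(3)[OF \<mu>])
  have sp: "space \<mu> = X" "sets \<mu> = BX"
    by (rule invariant_measureD[OF \<mu>])+
  have K: "compact (closure {m. \<psi> m \<noteq> 0})"
    using \<psi> by (simp add: test_functions_def)
  have sum_eq: "(\<Sum>\<^sub>\<infinity>p\<in>P. \<psi> p) = (\<Sum>p\<in>P \<inter> closure {m. \<psi> m \<noteq> 0}. \<psi> p)" if "P \<in> X" for P
  proof (rule infsum_eq_sum_support[OF _ r_pos K])
    show "P \<in> point_sets r"
      using that X_subset by blast
    show "\<psi> m = 0" if "m \<notin> closure {m. \<psi> m \<noteq> 0}" for m
      using that closure_subset[of "{m. \<psi> m \<noteq> 0}"] by auto
  qed
  have zero_iff: "(\<Sum>\<^sub>\<infinity>p\<in>P. \<psi> p) = 0 \<longleftrightarrow> P \<in> avoids \<psi>" if P: "P \<in> X" for P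
  proof -
    have "finite (P \<inter> closure {m. \<psi> m \<noteq> 0})"
      using P X_subset by (intro finite_point_set_Int_compact[OF _ r_pos K]) blast
    then have "(\<Sum>\<^sub>\<infinity>p\<in>P. \<psi> p) = 0 \<longleftrightarrow> (\<forall>p\<in>P \<inter> closure {m. \<psi> m \<noteq> 0}. \<psi> p = 0)"
      unfolding sum_eq[OF P] using \<psi>0 by (simp add: sum_nonneg_eq_0_iff)
    also have "\<dots> \<longleftrightarrow> (\<forall>p\<in>P. \<psi> p = 0)"
      using closure_subset[of "{m. \<psi> m \<noteq> 0}"] by auto
    finally show ?thesis
      using P by (simp add: avoids_def)
  qed
  have scaled: "(\<lambda>m. real k * \<psi> m) \<in> test_functions" for k
    by (rule test_function_scale[OF \<psi>])
  have lap_scaled: "laplace (\<lambda>m. real k * \<psi> m) P = exp (- (real k * (\<Sum>\<^sub>\<infinity>p\<in>P. \<psi> p)))" for k P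
    by (simp add: laplace_def infsum_cmult_right')
  have av: "avoids \<psi> = {P \<in> X. laplace \<psi> P = 1}"
    using zero_iff by (auto simp: laplace_def avoids_def)
  have "{P \<in> space \<mu>. laplace \<psi> P = 1} \<in> sets \<mu>"
    using laplace_measurable[OF \<mu> \<psi> \<psi>0] by measurable
  then show avBX: "avoids \<psi> \<in> BX"
    unfolding av sp .
  have "(\<lambda>k. \<integral>P. laplace (\<lambda>m. real k * \<psi> m) P \<partial>\<mu>) \<longlonglongrightarrow> (\<integral>P. indicator (avoids \<psi>) P \<partial>\<mu>)"
  proof (rule integral_dominated_convergence[where w = "\<lambda>_. 1"])
    show "(\<lambda>P. indicator (avoids \<psi>) P :: real) \<in> borel_measurable \<mu>"
      using avBX sp by (intro borel_measurable_indicator) simp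
    show "laplace (\<lambda>m. real k * \<psi> m) \<in> borel_measurable \<mu>" for k
      using laplace_measurable[OF \<mu> scaled] \<psi>0 by (auto intro: borel_measurable_integrable)
    show "AE P in \<mu>. norm (laplace (\<lambda>m. real k * \<psi> m) P) \<le> 1" for k
      using laplace_bounds[of "\<lambda>m. real k * \<psi> m"] \<psi>0 by (auto simp: less_imp_le)
    show "AE P in \<mu>. (\<lambda>k. laplace (\<lambda>m. real k * \<psi> m) P) \<longlonglongrightarrow> indicator (avoids \<psi>) P"
    proof (rule AE_I2)
      fix P assume "P \<in> space \<mu>"
      then have P: "P \<in> X"
        using sp by simp
      show "(\<lambda>k. laplace (\<lambda>m. real k * \<psi> m) P) \<longlonglongrightarrow> indicator (avoids \<psi>) P"
      proof (cases "P \<in> avoids \<psi>")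
        case True
        then show ?thesis
          using zero_iff[OF P] by (simp add: lap_scaled)
      next
        case False
        let ?s = "\<Sum>\<^sub>\<infinity>p\<in>P. \<psi> p"
        have "?s > 0"
          using False zero_iff[OF P] infsum_nonneg[of P \<psi>] \<psi>0 by (simp add: order.strict_iff_order)
        then have "(\<lambda>k. exp (- ?s) ^ k) \<longlonglongrightarrow> 0"
          by (intro LIMSEQ_realpow_zero) auto
        moreover have "exp (- ?s) ^ k = laplace (\<lambda>m. real k * \<psi> m) P" for k
          unfolding lap_scaled by (simp flip: exp_of_nat_mult)
        ultimately show ?thesis
          using False by simp
      qed
    qed
  qed simp
  then show "(\<lambda>k. \<integral>P. laplace (\<lambda>m. real k * \<psi> m) P \<partial>\<mu>) \<longlonglongrightarrow> measure \<mu> (avoids \<psi>)"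
    using avBX sp BX.sets_into_space[of "avoids \<psi>"] by (simp add: Int_absorb2)
qed


lemma uniquely_ergodic_of_frequencies:
  assumes flc: "finite_local_complexity act \<P>" and freq: "uniform_pattern_frequencies act vol D \<P>"
  shows "uniquely_ergodic_orbit_closure act r \<P>"
  unfolding uniquely_ergodic_orbit_closure_def
proof (rule ex_ex1I)
  obtain P where P: "P \<in> X"
    using X_nonempty by blast
  then show "\<exists>\<mu>. invariant_borel_prob act r \<P> \<mu>"
    using krylov_bogolyubov[of "\<lambda>k. k" "\<lambda>_. P", OF filterlim_ident P] by metis
next
  fix \<mu>1 \<mu>2 assume \<mu>1: "invariant_borel_prob act r \<P> \<mu>1" and \<mu>2: "invariant_borel_prob act r \<P> \<mu>2"
  have laplace_eq: "(\<integral>P. laplace \<psi> P \<partial>\<mu>1) = (\<integral>P. laplace \<psi> P \<partial>\<mu>2)"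
    if \<psi>: "\<psi> \<in> test_functions" and \<psi>0: "\<And>m. \<psi> m \<ge> 0" for \<psi>
  proof -
    obtain c where "uniform_limit orbits (\<lambda>n P. laplace_average \<psi> n P)
        (\<lambda>_. c) sequentially"
      using laplace_average_uniform[OF flc freq \<psi> \<psi>0] by blast
    then show ?thesis
      using integral_laplace[OF \<mu>1 \<psi> \<psi>0] integral_laplace[OF \<mu>2 \<psi> \<psi>0] by simp
  qed
  define \<E> where "\<E> = {avoids \<psi> | \<psi>. \<psi> \<in> test_functions \<and> (\<forall>m. \<psi> m \<ge> 0)}"
  have \<E>BX: "\<E> \<subseteq> BX"
    unfolding \<E>_def using measure_avoids(1)[OF \<mu>1] by blast
  have \<sigma>\<E>: "sigma_sets X \<E> = BX"
  proof (rule BX_eqI[OF \<E>BX])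
    fix a :: 'm and t :: real
    define \<psi> where "\<psi> x = max 0 (t - dist x a)" for x
    have "\<psi> \<in> test_functions"
      unfolding \<psi>_def by (rule bump_test_function[OF balls_compact])
    then have "avoids \<psi> \<in> \<E>"
      unfolding \<E>_def by (auto simp: \<psi>_def)
    moreover have "hits r (ball a t) \<inter> X = X - avoids \<psi>"
      using X_subset by (force simp: hits_def avoids_def \<psi>_def dist_commute max_def)
    ultimately show "hits r (ball a t) \<inter> X \<in> sigma_sets X \<E>"
      by (metis sigma_sets.Basic sigma_sets.Compl)
  qed
  show "\<mu>1 = \<mu>2"
  proof (rule measure_eqI_generator_eq[of \<E> X _ _ "\<lambda>_. X"])
    show "Int_stable \<E>"
    proof (rule Int_stableI)
      fix A B assume "A \<in> \<E>" "B \<in> \<E>"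
      then obtain \<psi> \<phi> where A: "A = avoids \<psi>" "\<psi> \<in> test_functions" "\<And>m. \<psi> m \<ge> 0"
        and B: "B = avoids \<phi>" "\<phi> \<in> test_functions" "\<And>m. \<phi> m \<ge> 0"
        unfolding \<E>_def by blast
      have "{m. \<psi> m + \<phi> m \<noteq> 0} \<subseteq> {m. \<psi> m \<noteq> 0} \<union> {m. \<phi> m \<noteq> 0}"
        by auto
      also have "\<dots> \<subseteq> closure {m. \<psi> m \<noteq> 0} \<union> closure {m. \<phi> m \<noteq> 0}"
        by (intro Un_mono closure_subset)
      finally have "{m. \<psi> m + \<phi> m \<noteq> 0} \<subseteq> \<dots>" .
      moreover have "compact (closure {m. \<psi> m \<noteq> 0} \<union> closure {m. \<phi> m \<noteq> 0})"
        using A(2) B(2) by (auto simp: test_functions_def)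
      ultimately have "compact (closure {m. \<psi> m + \<phi> m \<noteq> 0})"
        by (rule compact_closure_of_subset[rotated])
      then have "(\<lambda>m. \<psi> m + \<phi> m) \<in> test_functions"
        using A(2) B(2) by (auto simp: test_functions_def intro!: continuous_intros)
      moreover have "A \<inter> B = avoids (\<lambda>m. \<psi> m + \<phi> m)"
        using A(3) B(3) by (auto simp: A(1) B(1) avoids_def add_nonneg_eq_0_iff)
      ultimately show "A \<inter> B \<in> \<E>"
        unfolding \<E>_def using A(3) B(3) by (intro CollectI exI[of _ "\<lambda>m. \<psi> m + \<phi> m"]) auto
    qed
    have "(\<lambda>_. 0) \<in> (test_functions :: ('m \<Rightarrow> real) set)"
      by (simp add: test_functions_def)
    moreover have "avoids (\<lambda>_. 0) = X"
      by (simp add: avoids_def)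
    ultimately have "X \<in> \<E>"
      unfolding \<E>_def by (intro CollectI exI[of _ "\<lambda>_. 0"]) auto
    then show "range (\<lambda>_::nat. X) \<subseteq> \<E>"
      by auto
    show "\<E> \<subseteq> Pow X"
      using \<E>BX BX.space_closed by blast
    show "sets \<mu>1 = sigma_sets X \<E>" "sets \<mu>2 = sigma_sets X \<E>"
      unfolding \<sigma>\<E> using invariant_measureD(1) \<mu>1 \<mu>2 by auto
    show "emeasure \<mu>1 X \<noteq> \<infinity>"
      using finite_measure.emeasure_finite[OF prob_space.axioms(1)[OF invariant_measureD(3)[OF \<mu>1]]] by simp
    fix A assume "A \<in> \<E>"
    then obtain \<psi> where \<psi>: "A = avoids \<psi>" "\<psi> \<in> test_functions" "\<And>m. \<psi> m \<ge> 0"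
      unfolding \<E>_def by blast
    have lim: "(\<lambda>k. \<integral>P. laplace (\<lambda>m. real k * \<psi> m) P \<partial>\<mu>) \<longlonglongrightarrow> measure \<mu> (avoids \<psi>)"
      if "invariant_borel_prob act r \<P> \<mu>" for \<mu>
      by (rule measure_avoids(2)[OF that \<psi>(2,3)])
    have "(\<integral>P. laplace (\<lambda>m. real k * \<psi> m) P \<partial>\<mu>1) = (\<integral>P. laplace (\<lambda>m. real k * \<psi> m) P \<partial>\<mu>2)" for k
      by (rule laplace_eq[OF test_function_scale[OF \<psi>(2)]]) (simp add: \<psi>(3))
    then have "measure \<mu>1 A = measure \<mu>2 A"
      unfolding \<psi>(1) using LIMSEQ_unique lim[OF \<mu>1] lim[OF \<mu>2] by auto
    then show "emeasure \<mu>1 A = emeasure \<mu>2 A"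
      using finite_measure.emeasure_eq_measure[OF prob_space.axioms(1)[OF invariant_measureD(3)[OF \<mu>1]]]
        finite_measure.emeasure_eq_measure[OF prob_space.axioms(1)[OF invariant_measureD(3)[OF \<mu>2]]] by simp
  qed simp
qed

lemma frequencies_of_uniquely_ergodic:
  assumes flc: "finite_local_complexity act \<P>" and unique: "uniquely_ergodic_orbit_closure act r \<P>"
  shows "uniform_pattern_frequencies act vol D \<P>"
  unfolding uniform_pattern_frequencies_iff
proof (intro allI impI)
  fix Q assume "\<exists>P\<in>\<P>. pattern_of P Q"
  then have "finite Q"
    by (auto simp: pattern_of_def)
  then show "\<exists>\<nu>. uniform_limit orbits (frequency Q) (\<lambda>_. \<nu>) sequentially"
    using frequency_empty frequency_limit_unique[OF unique flc] by (cases "Q = {}") blast+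
qed

end

theorem proposition2p32:
  fixes act :: "'g::{topological_group_add, metric_space} \<Rightarrow>
                'm::{metric_space, second_countable_topology} \<Rightarrow> 'm"
    and vol :: "'g measure"
    and D :: "nat \<Rightarrow> 'g set"
    and r :: real
    and \<P> :: "'m set set"
  assumes "locally compact (UNIV :: 'm set)"
    and "\<not> compact (UNIV :: 'g set)"
    and "left_action act"
    and "continuous_action act"
    and "proper_action act"
    and "isometric_action act"
    and "\<And>(m::'m) \<rho>. compact (closure (ball m \<rho>))"
    and "left_haar_measure vol"
    and "r > 0"
    and "unimodular vol"
    and "van_hove_sequence vol D"
    and "\<P> \<noteq> {}"
    and "\<P> \<subseteq> point_sets r"
    and "finite_local_complexity act \<P>"
  shows "uniquely_ergodic_orbit_closure act r \<P> \<longleftrightarrow> uniform_pattern_frequencies act vol D \<P>"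
proof -
  interpret orbit_system act r vol D \<P>
    by unfold_locales (fact assms)+
  show ?thesis
    using uniquely_ergodic_of_frequencies frequencies_of_uniquely_ergodic assms(14) by blast
qed

end
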